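(* Let $p\ge q\ge 1$ be integers, $n=p+q$. For each $w\in\mathbf S_q$ avoiding the pattern $231$, the Hessenberg variety $\mathrm{Hess}(\mathsf x_{p,q},\mathbf m(w))$ is irreducible and equal to the closure of the $K$-orbit $\mathcal O_{\gamma_w}$. Furthermore, every irreducible Hessenberg variety $\mathrm{Hess}(\mathsf x_{p,q},\mathbf m)$ ($\mathbf m$ a Hessenberg vector of length $n$) is of this form.
   Context: $[k]=\{1,\dots,k\}$. A permutation $w\in\mathbf S_q$ avoids $231$ if there are no $i<j<k$ with $w(k)<w(i)<w(j)$. A Hessenberg vector of length $n$ is a weakly increasing integer sequence $\mathbf m=(m_1,\dots,m_n)$ with $i\le m_i\le n$ for all $i$. For $w\in \mathbf S_q$ avoiding $231$, the Hessenberg vector $\mathbf m(w)$ of length $n$ is $m(w)_i=\max\{w^{-1}(k)+p : k\le i\}$ for $i\le q$ and $m(w)_i=n$ for $i>q$. $G=GL_n(\mathbb C)$, $B$ is the group of upper triangular matrices, and $\mathcal B=G/B$ is identified with the variety of full flags $V_\bullet=(0<V_1<\dots<V_n=\mathbb C^n)$, $\dim V_i=i$. $\mathrm{Hess}(\mathsf x,\mathbf m)=\{V_\bullet\in\mathcal B : \mathsf x V_i\le V_{m_i}\text{ for all } i\in[n]\}$. $\mathsf x_{p,q}=\mathrm{diag}(\lambda_1,\dots,\lambda_1,\lambda_2,\dots,\lambda_2)$ ($p$ copies of $\lambda_1$, $q$ copies of $\lambda_2$), $\lambda_1\ne\lambda_2$ in $\mathbb C$. $K\cong GL_p(\mathbb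 C)\times GL_q(\mathbb C)$ is the centralizer of $\mathsf x_{p,q}$ in $G$ (block diagonal matrices), acting on $\mathcal B$ by left multiplication. For $w\in\mathbf S_q$, $\mathcal O_{\gamma_w}$ is the $K$-orbit of the flag $V_\bullet$ with $V_i=\mathrm{span}(v_1,\dots,v_i)$, where, with $e_1,\dots,e_n$ the standard basis: $v_i=e_i+e_{p+w^{-1}(i)}$ for $1\le i\le q$; $v_i=e_i$ for $q<i\le p$; $v_{p+j}=e_{w(j)}-e_{p+j}$ for $1\le j\le q$. (It is the orbit attached to the clan $\gamma_w=1\,2\cdots q\,+\cdots+\,w(1)\cdots w(q)$ with $p-q$ plus signs.) *)

theory Defs
  imports
    "HOL-Analysis.Abstract_Topology"
    "HOL-Combinatorics.Permutations"
    "Jordan_Normal_Form.DL_Rank"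
begin

section \<open>Permutations and Hessenberg vectors\<close>

text \<open>Permutations in \<open>S\<^sub>q\<close> are functions \<open>w\<close> with \<open>w permutes {1..q}\<close>.
  Sequences indexed by \<open>1, \<dots>, n\<close> are functions on \<open>nat\<close> of which only the values on
  \<open>{1..n}\<close> are ever used.\<close>

definition avoids_231 :: "nat \<Rightarrow> (nat \<Rightarrow> nat) \<Rightarrow> bool" where
  "avoids_231 q w \<longleftrightarrow>
     \<not> (\<exists>i j k. i \<in> {1..q} \<and> j \<in> {1..q} \<and> k \<in> {1..q} \<and> i < j \<and> j < k \<and> w k < w i \<and> w i < w j)"

definition hessenberg_vector :: "nat \<Rightarrow> (nat \<Rightarrow> nat) \<Rightarrow> bool" where
  "hessenberg_vector n m \<longleftrightarrow>
     (\<forall>i\<in>{1..n}. i \<le> m i \<and> m i \<le> n) \<and> (\<forall>i\<in>{1..n}. \<forall>j\<in>{1..n}. i \<le> j \<longrightarrow> m i \<le> m j)"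

definition hess_vec_of_perm :: "nat \<Rightarrow> nat \<Rightarrow> (nat \<Rightarrow> nat) \<Rightarrow> nat \<Rightarrow> nat" where
  "hess_vec_of_perm p q w i =
     (if i \<le> q then Max ((\<lambda>k. Hilbert_Choice.inv w k + p) ` {1..i}) else p + q)"

lemma hessenberg_vector_of_perm:
  assumes "q \<le> p" and w: "w permutes {1..q}"
  shows "hessenberg_vector (p + q) (hess_vec_of_perm p q w)"
proof -
  let ?f = "\<lambda>k. Hilbert_Choice.inv w k + p"
  have f: "?f k \<in> {p + 1..p + q}" if "k \<in> {1..q}" for k
    using permutes_in_image[OF permutes_inv[OF w], of k] that by simp
  have bounds: "p < Max (?f ` {1..i}) \<and> Max (?f ` {1..i}) \<le> p + q" if "i \<in> {1..q}" for i
  proof -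
    have ne: "?f ` {1..i} \<noteq> {}" and fin: "finite (?f ` {1..i})" using that by auto
    have "Max (?f ` {1..i}) \<in> ?f ` {1..i}" by (rule Max_in[OF fin ne])
    then obtain k where k: "k \<in> {1..i}" "Max (?f ` {1..i}) = ?f k" by blast
    have "k \<in> {1..q}" using k(1) that by auto
    from f[OF this] show ?thesis unfolding k(2) by simp
  qed
  have mono: "Max (?f ` {1..i}) \<le> Max (?f ` {1..j})" if "1 \<le> i" "i \<le> j" for i j
    by (rule Max_mono) (use that in auto)
  show ?thesis
    unfolding hessenberg_vector_def hess_vec_of_perm_def
  proof (intro conjI ballI impI)
    fix i assume i: "i \<in> {1..p + q}"
    have iq: "i \<in> {1..q}" if "i \<le> q" using that i by simp
    show "i \<le> (if i \<le> q then Max (?f ` {1..i}) else p + q)"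
    proof (cases "i \<le> q")
      case True
      then have "i \<le> p" using assms(1) by linarith
      then show ?thesis using bounds[OF iq[OF True]] True by simp
    qed (use i in simp)
    show "(if i \<le> q then Max (?f ` {1..i}) else p + q) \<le> p + q"
      using bounds[OF iq] by (cases "i \<le> q") simp_all
    fix j assume j: "i \<le> j"
    show "(if i \<le> q then Max (?f ` {1..i}) else p + q)
        \<le> (if j \<le> q then Max (?f ` {1..j}) else p + q)"
    proof (cases "i \<le> q")
      case True
      then show ?thesis using bounds[OF iq[OF True]] mono[OF _ j] i
        by (cases "j \<le> q") simp_all
    qed (use j in simp)
  qed
qed


section \<open>Irreducible topological spaces\<close>

definition irreducible_space :: "'a topology \<Rightarrow> bool" where
  "irreducible_space X \<longleftrightarrow> topspace X \<noteq> {} \<and>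
     (\<forall>A B. closedin X A \<longrightarrow> closedin X B \<longrightarrow> A \<union> B = topspace X \<longrightarrow>
        A = topspace X \<or> B = topspace X)"


section \<open>The general linear group with its Zariski topology\<close>

definition GL :: "nat \<Rightarrow> complex mat set" where
  "GL n = {g \<in> carrier_mat n n. invertible_mat g}"

text \<open>Polynomial functions in the entries of an \<open>n \<times> n\<close> matrix.\<close>

inductive_set poly_fun :: "nat \<Rightarrow> (complex mat \<Rightarrow> complex) set" for n :: nat where
  const: "(\<lambda>g. c) \<in> poly_fun n"
| entry: "i < n \<Longrightarrow> j < n \<Longrightarrow> (\<lambda>g. g $$ (i, j)) \<in> poly_fun n"
| add: "f \<in> poly_fun n \<Longrightarrow> h \<in> poly_fun n \<Longrightarrow> (\<lambda>g. f g + h g) \<in> poly_fun n"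
| mult: "f \<in> poly_fun n \<Longrightarrow> h \<in> poly_fun n \<Longrightarrow> (\<lambda>g. f g * h g) \<in> poly_fun n"

text \<open>Regular functions on \<open>GL n\<close> may also involve \<open>1 / det\<close>, but clearing denominators shows
  that polynomial functions cut out the same closed sets.\<close>

definition GL_zero_locus :: "nat \<Rightarrow> (complex mat \<Rightarrow> complex) set \<Rightarrow> complex mat set" where
  "GL_zero_locus n F = {g \<in> GL n. \<forall>f\<in>F. f g = 0}"

definition GL_zariski :: "nat \<Rightarrow> complex mat topology" where
  "GL_zariski n = topology (\<lambda>U. \<exists>F \<subseteq> poly_fun n. U = GL n - GL_zero_locus n F)"

lemma istopology_GL_zariski: "istopology (\<lambda>U. \<exists>F \<subseteq> poly_fun n. U = GL n - GL_zero_locus n F)"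
  unfolding istopology_def
proof (intro conjI allI impI)
  fix S T
  assume "\<exists>F \<subseteq> poly_fun n. S = GL n - GL_zero_locus n F"
    and "\<exists>F \<subseteq> poly_fun n. T = GL n - GL_zero_locus n F"
  then obtain F H where FH: "F \<subseteq> poly_fun n" "H \<subseteq> poly_fun n"
    and ST: "S = GL n - GL_zero_locus n F" "T = GL n - GL_zero_locus n H" by blast
  let ?P = "(\<lambda>(f, h) g. f g * h g) ` (F \<times> H)"
  have "?P \<subseteq> poly_fun n" using FH by (auto intro!: poly_fun.mult)
  moreover have "S \<inter> T = GL n - GL_zero_locus n ?P"
    unfolding ST GL_zero_locus_def by fastforce
  ultimately show "\<exists>F \<subseteq> poly_fun n. S \<inter> T = GL n - GL_zero_locus n F" by blast
next
  fix \<K>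
  assume "\<forall>S\<in>\<K>. \<exists>F \<subseteq> poly_fun n. S = GL n - GL_zero_locus n F"
  then obtain F where F: "\<And>S. S \<in> \<K> \<Longrightarrow> F S \<subseteq> poly_fun n"
    "\<And>S. S \<in> \<K> \<Longrightarrow> S = GL n - GL_zero_locus n (F S)" by metis
  have "(\<Union>S\<in>\<K>. F S) \<subseteq> poly_fun n" using F(1) by blast
  moreover have "\<Union>\<K> = GL n - GL_zero_locus n (\<Union>S\<in>\<K>. F S)"
  proof -
    have "\<Union>\<K> = (\<Union>S\<in>\<K>. GL n - GL_zero_locus n (F S))" using F(2) by auto
    also have "\<dots> = GL n - GL_zero_locus n (\<Union>S\<in>\<K>. F S)"
      unfolding GL_zero_locus_def by auto
    finally show ?thesis .
  qed
  ultimately show "\<exists>F \<subseteq> poly_fun n. \<Union>\<K> = GL n - GL_zero_locus n F" by blast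
qed

lemma openin_GL_zariski:
  "openin (GL_zariski n) U \<longleftrightarrow> (\<exists>F \<subseteq> poly_fun n. U = GL n - GL_zero_locus n F)"
  unfolding GL_zariski_def by (simp add: topology_inverse'[OF istopology_GL_zariski])

lemma topspace_GL_zariski [simp]: "topspace (GL_zariski n) = GL n"
proof -
  have "GL n = GL n - GL_zero_locus n {\<lambda>g. 1}" by (simp add: GL_zero_locus_def)
  then have "openin (GL_zariski n) (GL n)"
    unfolding openin_GL_zariski by (metis empty_subsetI insert_subset poly_fun.const)
  moreover have "U \<subseteq> GL n" if "openin (GL_zariski n) U" for U
    using that unfolding openin_GL_zariski by blast
  ultimately show ?thesis by (metis openin_subset openin_topspace subset_antisym)
qed


section \<open>The flag variety\<close>

abbreviation cspace :: "nat \<Rightarrow> (complex, complex vec) module" where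
  "cspace n \<equiv> module_vec TYPE(complex) n"

abbreviation cspan :: "nat \<Rightarrow> complex vec set \<Rightarrow> complex vec set" where
  "cspan n S \<equiv> LinearCombinations.module.span class_ring (cspace n) S"

text \<open>Restriction to \<open>{0..n}\<close> (extensionality) makes equality of flags the equality of their
  members.\<close>

definition flags :: "nat \<Rightarrow> (nat \<Rightarrow> complex vec set) set" where
  "flags n = {V \<in> extensional {0..n}.
     (\<forall>i\<le>n. VectorSpace.subspace class_ring (V i) (cspace n) \<and>
            vectorspace.dim class_ring (cspace n\<lparr>carrier := V i\<rparr>) = i) \<and>
     (\<forall>i<n. V i \<subseteq> V (Suc i))}"

definition flag_spanned_by :: "nat \<Rightarrow> (nat \<Rightarrow> complex vec) \<Rightarrow> nat \<Rightarrow> complex vec set" where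
  "flag_spanned_by n v = (\<lambda>i\<in>{0..n}. cspan n (v ` {1..i}))"

text \<open>The map \<open>G \<rightarrow> G/B\<close>, with \<open>gB\<close> identified with the flag spanned by the columns of
  \<open>g\<close> (columns of matrices are indexed from \<open>0\<close>).\<close>

definition flag_of_mat :: "nat \<Rightarrow> complex mat \<Rightarrow> nat \<Rightarrow> complex vec set" where
  "flag_of_mat n g = flag_spanned_by n (\<lambda>i. col g (i - 1))"

text \<open>The Zariski topology of \<open>G/B\<close> is the quotient topology of the Zariski topology of \<open>G\<close>.\<close>

definition flag_zariski :: "nat \<Rightarrow> (nat \<Rightarrow> complex vec set) topology" where
  "flag_zariski n =
     topology (\<lambda>U. U \<subseteq> flags n \<and> openin (GL_zariski n) {g \<in> GL n. flag_of_mat n g \<in> U})"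

lemma istopology_flag_zariski:
  "istopology (\<lambda>U. U \<subseteq> flags n \<and> openin (GL_zariski n) {g \<in> GL n. flag_of_mat n g \<in> U})"
  unfolding istopology_def
proof (intro conjI allI impI)
  fix S T
  assume S: "S \<subseteq> flags n \<and> openin (GL_zariski n) {g \<in> GL n. flag_of_mat n g \<in> S}"
    and T: "T \<subseteq> flags n \<and> openin (GL_zariski n) {g \<in> GL n. flag_of_mat n g \<in> T}"
  show "S \<inter> T \<subseteq> flags n" using S by blast
  have "{g \<in> GL n. flag_of_mat n g \<in> S \<inter> T}
      = {g \<in> GL n. flag_of_mat n g \<in> S} \<inter> {g \<in> GL n. flag_of_mat n g \<in> T}" by blast
  then show "openin (GL_zariski n) {g \<in> GL n. flag_of_mat n g \<in> S \<inter> T}"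
    using S T by (simp add: openin_Int)
next
  fix \<K>
  assume K: "\<forall>S\<in>\<K>. S \<subseteq> flags n \<and> openin (GL_zariski n) {g \<in> GL n. flag_of_mat n g \<in> S}"
  show "\<Union>\<K> \<subseteq> flags n" using K by blast
  have "{g \<in> GL n. flag_of_mat n g \<in> \<Union>\<K>} = (\<Union>S\<in>\<K>. {g \<in> GL n. flag_of_mat n g \<in> S})"
    by blast
  then show "openin (GL_zariski n) {g \<in> GL n. flag_of_mat n g \<in> \<Union>\<K>}"
    using K by (metis (no_types, lifting) openin_clauses(3) imageE)
qed

lemma openin_flag_zariski:
  "openin (flag_zariski n) U \<longleftrightarrow>
     U \<subseteq> flags n \<and> openin (GL_zariski n) {g \<in> GL n. flag_of_mat n g \<in> U}"
  unfolding flag_zariski_def by (simp add: topology_inverse'[OF istopology_flag_zariski])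

lemma flag_of_mat_in_flags:
  assumes "g \<in> GL n"
  shows "flag_of_mat n g \<in> flags n"
proof -
  interpret vec_space "TYPE(complex)" n .
  have g: "g \<in> carrier_mat n n" using assms by (simp add: GL_def)
  obtain h where gh: "g * h = 1\<^sub>m n" "h \<in> carrier_mat n n"
  proof -
    obtain h where h: "inverts_mat g h" "inverts_mat h g"
      using assms unfolding GL_def invertible_mat_def by blast
    have "h \<in> carrier_mat n n"
      using h g unfolding inverts_mat_def
      by (metis carrier_matD(1) carrier_matI index_mult_mat(2,3) index_one_mat(3) carrier_matD(2))
    then show thesis using that h(1) g unfolding inverts_mat_def by auto
  qed
  have "det g * det h = 1" using det_mult[OF g gh(2)] gh(1) by simp
  then have rank: "rank g = n" using det_rank_iff[OF g] by auto
  then have dist: "distinct (cols g)" using non_distinct_low_rank[OF g] by auto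
  have indpt: "lin_indpt (set (cols g))" by (rule full_rank_lin_indpt[OF g rank dist])
  have carr: "set (cols g) \<subseteq> carrier_vec n" using cols_dim g by blast
  let ?S = "\<lambda>i. (\<lambda>k. col g (k - 1)) ` {1..i}"
  have sub: "?S i \<subseteq> set (cols g)" if "i \<le> n" for i
    using that g by (auto simp: cols_def)
  have card: "card (?S i) = i" if "i \<le> n" for i
  proof -
    have "inj_on (\<lambda>k. col g (k - 1)) {1..i}"
    proof (rule inj_onI)
      fix a b assume ab: "a \<in> {1..i}" "b \<in> {1..i}" "col g (a - 1) = col g (b - 1)"
      then have "cols g ! (a - 1) = cols g ! (b - 1)" "a - 1 < length (cols g)" "b - 1 < length (cols g)"
        using that g by auto
      then have "a - 1 = b - 1" using dist nth_eq_iff_index_eq by blast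
      then show "a = b" using ab by auto
    qed
    then show ?thesis by (simp add: card_image)
  qed
  have subsp: "VectorSpace.subspace class_ring (span (?S i)) V" if "i \<le> n" for i
    using span_is_subspace[of "?S i"] sub[OF that] carr by auto
  have dim: "vectorspace.dim class_ring (span_vs (?S i)) = i" if "i \<le> n" for i
  proof -
    have "lin_indpt (?S i)" using subset_li_is_li[OF indpt sub[OF that]] .
    then have "maximal (?S i) (\<lambda>T. T \<subseteq> ?S i \<and> lin_indpt T)"
      unfolding maximal_def by blast
    then show ?thesis
      using dim_span[of "?S i" "?S i"] sub[OF that] carr card[OF that] by auto
  qed
  have mono: "span (?S i) \<subseteq> span (?S (Suc i))" for i
    by (rule span_is_monotone) auto
  show ?thesis
    unfolding flags_def flag_of_mat_def flag_spanned_by_def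
    using subsp dim mono by auto
qed

lemma topspace_flag_zariski [simp]: "topspace (flag_zariski n) = flags n"
proof -
  have "{g \<in> GL n. flag_of_mat n g \<in> flags n} = topspace (GL_zariski n)"
    using flag_of_mat_in_flags by auto
  then have "openin (flag_zariski n) (flags n)"
    unfolding openin_flag_zariski by (metis openin_topspace order_refl)
  then show ?thesis
    by (metis openin_flag_zariski openin_subset openin_topspace subset_antisym)
qed


section \<open>Hessenberg varieties and the orbits of \<open>K\<close>\<close>

definition Hess :: "nat \<Rightarrow> complex mat \<Rightarrow> (nat \<Rightarrow> nat) \<Rightarrow> (nat \<Rightarrow> complex vec set) set" where
  "Hess n x m = {V \<in> flags n. \<forall>i\<in>{1..n}. (\<lambda>v. x *\<^sub>v v) ` V i \<subseteq> V (m i)}"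

definition x_mat :: "nat \<Rightarrow> nat \<Rightarrow> complex \<Rightarrow> complex \<Rightarrow> complex mat" where
  "x_mat p q lam1 lam2 = mat_diag (p + q) (\<lambda>i. if i < p then lam1 else lam2)"

definition GL_centralizer :: "nat \<Rightarrow> complex mat \<Rightarrow> complex mat set" where
  "GL_centralizer n x = {g \<in> GL n. g * x = x * g}"

definition flag_act :: "nat \<Rightarrow> complex mat \<Rightarrow> (nat \<Rightarrow> complex vec set) \<Rightarrow> nat \<Rightarrow> complex vec set" where
  "flag_act n g V = (\<lambda>i\<in>{0..n}. (\<lambda>v. g *\<^sub>v v) ` V i)"

text \<open>\<open>e\<^sub>i\<close> for \<open>i = 1, \<dots>, n\<close>; the library's unit vectors are indexed from \<open>0\<close>.\<close>

definition e_vec :: "nat \<Rightarrow> nat \<Rightarrow> complex vec" where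
  "e_vec n i = unit_vec n (i - 1)"

definition clan_vec :: "nat \<Rightarrow> nat \<Rightarrow> (nat \<Rightarrow> nat) \<Rightarrow> nat \<Rightarrow> complex vec" where
  "clan_vec p q w i =
     (if i \<le> q then e_vec (p + q) i + e_vec (p + q) (p + Hilbert_Choice.inv w i)
      else if i \<le> p then e_vec (p + q) i
      else e_vec (p + q) (w (i - p)) - e_vec (p + q) i)"

definition clan_orbit ::
  "nat \<Rightarrow> nat \<Rightarrow> complex \<Rightarrow> complex \<Rightarrow> (nat \<Rightarrow> nat) \<Rightarrow> (nat \<Rightarrow> complex vec set) set" where
  "clan_orbit p q lam1 lam2 w =
     (\<lambda>g. flag_act (p + q) g (flag_spanned_by (p + q) (clan_vec p q w)))
       ` GL_centralizer (p + q) (x_mat p q lam1 lam2)"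

end

theory Submission
  imports Defs
begin

text \<open>
  Write \<open>E\<^sub>1\<close>, \<open>E\<^sub>2\<close> for the eigenspaces and \<open>\<pi>\<close> for the projection onto \<open>E\<^sub>2\<close>. A flag \<open>V\<close> lies in the
  Hessenberg variety of \<open>m\<close> iff \<open>\<pi> V\<^sub>i \<subseteq> V\<^bsub>m i\<^esub>\<close> for all \<open>i\<close>, that is, iff the entries of \<open>g\<^sup>-\<^sup>1 \<pi> g\<close> below
  the profile of \<open>m\<close> vanish, for any matrix \<open>g\<close> of \<open>V\<close>.

  If \<open>m i \<ge> p + i\<close> for \<open>i \<le> q\<close>, there is a flag \<open>F\<close> of \<open>E\<^sub>2\<close> with \<open>\<pi> V\<^sub>i \<subseteq> F\<^sub>i \<subseteq> V\<^bsub>m i\<^esub>\<close>. After moving \<open>F\<close> to the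
  standard flag by the centralizer, the last \<open>q\<close> rows of \<open>g\<close> start late and the last \<open>q\<close> columns of
  \<open>g\<^sup>-\<^sup>1\<close> end early. Multiplying by \<open>2 \<times> 2\<close> blocks, these bounds can be moved towards each other until they
  agree, where the set is visibly a product of irreducible sets. So the set of all \<open>g\<close> is a product of
  irreducible sets of matrices, hence irreducible. For \<open>m = m(w)\<close>, Gaussian elimination shows that a
  nonvanishing condition on minors puts \<open>g\<close> into the orbit: 231-avoidance ensures that all entries
  that the elimination does not reach vanish on the variety. So the orbit is dense.

  If \<open>m i < p + i\<close> for some \<open>i \<le> q\<close>, the variety is the union of the closed subsets where
  \<open>V\<^sub>i \<inter> E\<^sub>1 \<noteq> 0\<close> and where \<open>dim (V\<^bsub>m i\<^esub> \<inter> E\<^sub>2) \<ge> i\<close>, and coordinate flags show that both are proper. The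
  remaining \<open>m\<close> are exactly the \<open>m(w)\<close>.
\<close>

section \<open>Matrices and polynomial functions\<close>

text \<open>Matrices replace flags throughout, since the topology of flags is a quotient of that of
  \<open>GL n\<close>. Irreducibility is used as a statement about functions: two polynomial
  functions, neither of which vanishes on all of a set, are both nonzero at some common point of it.
  In this form it passes to a set of products \<open>s * t\<close> by freezing one factor at a time,
  and for the basic factors (centralizer, triangular matrices, 2 x 2 blocks, affine slices of
  \<open>GL n\<close>) it reduces to polynomials in one variable along a line. The obstacle is that
  the defining equations are sums of products of an entry of the inverse with an entry of
  \<open>g\<close>. The auxiliary flag of \<open>E\<^sub>2\<close> makes every single summand
  vanish, so that only the supports of rows and columns remain. They begin with starts
  \<open>0, ..., q - 1\<close> and ends at \<open>p\<close> or later, and \<open>q \<le> p\<close>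
  keeps the two groups apart. Rows and columns count from 0, flag members and \<open>m\<close> from
  1: hence \<open>m (Suc b)\<close>, and \<open>p + b < m (Suc b)\<close> for the bound
  \<open>p + i \<le> m i\<close>.\<close>

lemma mult_mat_entry:
  assumes "a \<in> carrier_mat n m" "b \<in> carrier_mat m k" "i < n" "j < k"
  shows "(a * b) $$ (i, j) = (\<Sum>l<m. a $$ (i, l) * b $$ (l, j))"
  using assms by (auto simp: scalar_prod_def atLeast0LessThan intro!: sum.cong)

lemma mult_mat_vec_entry:
  assumes "a \<in> carrier_mat n m" "v \<in> carrier_vec m" "i < n"
  shows "(a *\<^sub>v v) $ i = (\<Sum>l<m. a $$ (i, l) * v $ l)"
  using assms by (auto simp: scalar_prod_def atLeast0LessThan intro!: sum.cong)

lemma nonsingular_imp_no_kernel: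
  fixes A :: "complex mat"
  assumes "A \<in> carrier_mat n n" "det A \<noteq> 0" "\<And>i. i < n \<Longrightarrow> (\<Sum>l<n. A $$ (i, l) * z l) = 0" "l < n"
  shows "z l = 0"
proof -
  have "A *\<^sub>v vec n z = 0\<^sub>v n"
    by (rule eq_vecI) (use assms in \<open>simp_all add: mult_mat_vec_entry[where n=n and m=n] del: index_mult_mat_vec\<close>)
  then have "vec n z = 0\<^sub>v n"
    using det_0_iff_vec_prod_zero_field[OF assms(1)] assms(2) vec_carrier by blast
  then show ?thesis using assms(4) by (metis index_vec index_zero_vec(1))
qed

lemma singular_imp_kernel:
  fixes A :: "complex mat"
  assumes A: "A \<in> carrier_mat n n" and d: "det A = 0"
  obtains z where "\<And>i. i < n \<Longrightarrow> (\<Sum>l<n. A $$ (i, l) * z l) = 0" "\<exists>l<n. z l \<noteq> 0"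
proof -
  obtain v where v: "v \<in> carrier_vec n" "v \<noteq> 0\<^sub>v n" "A *\<^sub>v v = 0\<^sub>v n"
    using d det_0_iff_vec_prod_zero_field[OF A] by blast
  show thesis
  proof (rule that[of "\<lambda>l. v $ l"])
    show "(\<Sum>l<n. A $$ (i, l) * v $ l) = 0" if "i < n" for i
      using mult_mat_vec_entry[OF A v(1) that] v(3) that by simp
    show "\<exists>l<n. v $ l \<noteq> 0"
      using v(1,2) by (metis carrier_vecD eq_vecI index_zero_vec(1) index_zero_vec(2))
  qed
qed

text \<open>Padding with zero rows gives a square matrix; its transpose kills the last unit vector,
  so it is singular.\<close>

lemma underdetermined_system:
  fixes A :: "nat \<Rightarrow> nat \<Rightarrow> complex"
  assumes "k < n"
  obtains z where "\<And>i. i < k \<Longrightarrow> (\<Sum>l<n. A i l * z l) = 0" "\<exists>l<n. z l \<noteq> 0"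
proof -
  define M where "M = mat n n (\<lambda>(i, l). if i < k then A i l else 0)"
  have M: "M \<in> carrier_mat n n" by (simp add: M_def)
  have "transpose_mat M *\<^sub>v unit_vec n (n - 1) = 0\<^sub>v n"
    by (rule eq_vecI) (use assms in \<open>auto simp: M_def scalar_prod_right_unit\<close>)
  moreover have "unit_vec n (n - 1) \<noteq> (0\<^sub>v n :: complex vec)" using assms by simp
  ultimately have "det (transpose_mat M) = 0"
    using det_0_iff_vec_prod_zero_field[of "transpose_mat M" n] M
    by (meson transpose_carrier_mat unit_vec_carrier)
  then have "det M = 0" using det_transpose[OF M] by simp
  then obtain z where "\<And>i. i < n \<Longrightarrow> (\<Sum>l<n. M $$ (i, l) * z l) = 0" "\<exists>l<n. z l \<noteq> 0"
    using singular_imp_kernel[OF M] by blast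
  moreover have "(\<Sum>l<n. M $$ (i, l) * z l) = (\<Sum>l<n. A i l * z l)" if "i < k" for i
    using that assms by (intro sum.cong) (auto simp: M_def)
  ultimately show thesis using that[of z] assms by (metis less_trans)
qed

text \<open>The adjugate formula makes every entry of the inverse polynomial up to the factor
  \<open>1 / det g\<close>, so that conditions on the inverse become closed conditions.\<close>

definition minv :: "complex mat \<Rightarrow> complex mat" where
  "minv g = (1 / det g) \<cdot>\<^sub>m adj_mat g"

lemma GL_iff_det: "g \<in> GL n \<longleftrightarrow> g \<in> carrier_mat n n \<and> det g \<noteq> 0"
proof
  assume "g \<in> GL n"
  then have g: "g \<in> carrier_mat n n" and "invertible_mat g" by (auto simp: GL_def)
  then obtain h where h: "g * h = 1\<^sub>m n" "h * g = 1\<^sub>m (dim_row h)"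
    unfolding invertible_mat_def inverts_mat_def by auto
  have "h \<in> carrier_mat n n"
    using h g by (metis carrier_matD carrier_matI index_mult_mat(2,3) index_one_mat(2,3))
  then show "g \<in> carrier_mat n n \<and> det g \<noteq> 0"
    using det_mult[OF g, of h] h(1) g by auto
next
  assume g: "g \<in> carrier_mat n n \<and> det g \<noteq> 0"
  have "g * ((1 / det g) \<cdot>\<^sub>m adj_mat g) = 1\<^sub>m n" "((1 / det g) \<cdot>\<^sub>m adj_mat g) * g = 1\<^sub>m n"
    using g adj_mat[of g n] by (auto simp: mult_smult_distrib mult_smult_assoc_mat)
  then show "g \<in> GL n"
    using g adj_mat(1)[of g n] unfolding GL_def invertible_mat_def inverts_mat_def by fastforce
qed

lemma GL_carrier: "g \<in> GL n \<Longrightarrow> g \<in> carrier_mat n n" by (simp add: GL_def)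

lemma minv_carrier: "g \<in> carrier_mat n n \<Longrightarrow> minv g \<in> carrier_mat n n"
  unfolding minv_def using adj_mat(1)[of g n] by auto

lemma mult_minv: "g \<in> GL n \<Longrightarrow> g * minv g = 1\<^sub>m n"
  unfolding minv_def GL_iff_det using adj_mat[of g n]
  by (auto simp: mult_smult_distrib)

lemma minv_mult: "g \<in> GL n \<Longrightarrow> minv g * g = 1\<^sub>m n"
  unfolding minv_def GL_iff_det using adj_mat[of g n]
  by (auto simp: mult_smult_assoc_mat)

lemma GL_I:
  assumes "g \<in> carrier_mat n n" "h \<in> carrier_mat n n" "g * h = 1\<^sub>m n"
  shows "g \<in> GL n"
  using det_mult[OF assms(1,2)] assms by (auto simp: GL_iff_det)

lemma minv_unique:
  assumes "g \<in> carrier_mat n n" "h \<in> carrier_mat n n" "g * h = 1\<^sub>m n"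
  shows "minv g = h"
proof -
  have g: "g \<in> GL n" by (rule GL_I[OF assms])
  have "minv g = minv g * (g * h)"
    using minv_carrier[OF assms(1)] assms(3) by simp
  also have "\<dots> = h"
    using assms minv_mult[OF g] minv_carrier[OF assms(1)]
    by (metis assoc_mult_mat left_mult_one_mat)
  finally show ?thesis .
qed

lemma GL_mult: "g \<in> GL n \<Longrightarrow> h \<in> GL n \<Longrightarrow> g * h \<in> GL n"
  by (auto simp: GL_iff_det det_mult)

lemma minv_GL: "g \<in> GL n \<Longrightarrow> minv g \<in> GL n"
  by (meson GL_I GL_carrier minv_carrier minv_mult)

lemma minv_minv: "g \<in> GL n \<Longrightarrow> minv (minv g) = g"
  by (meson GL_carrier minv_carrier minv_mult minv_unique)

lemma one_GL: "1\<^sub>m n \<in> GL n" by (simp add: GL_iff_det)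

lemma minv_prod:
  assumes "g \<in> GL n" "h \<in> GL n"
  shows "minv (g * h) = minv h * minv g"
proof (rule minv_unique[of _ n])
  have c: "g \<in> carrier_mat n n" "h \<in> carrier_mat n n" "minv g \<in> carrier_mat n n" "minv h \<in> carrier_mat n n"
    using assms by (auto simp: GL_carrier minv_carrier)
  show "g * h \<in> carrier_mat n n" "minv h * minv g \<in> carrier_mat n n" using c by auto
  have "g * h * (minv h * minv g) = g * (h * minv h) * minv g"
    using c by (simp add: assoc_mult_mat[where ?n\<^sub>1.0=n and ?n\<^sub>2.0=n and ?n\<^sub>3.0=n and ?n\<^sub>4.0=n])
  then show "g * h * (minv h * minv g) = 1\<^sub>m n"
    using c mult_minv[OF assms(1)] mult_minv[OF assms(2)] by simp
qed

lemma mult_minv_cancel: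
  assumes "g \<in> GL n" "h \<in> carrier_mat n k"
  shows "g * (minv g * h) = h" "minv g * (g * h) = h"
proof -
  have c: "g \<in> carrier_mat n n" "minv g \<in> carrier_mat n n"
    using assms(1) by (auto simp: GL_carrier minv_carrier)
  show "g * (minv g * h) = h" "minv g * (g * h) = h"
    using assoc_mult_mat[OF c assms(2)] assoc_mult_mat[OF c(2,1) assms(2)]
      mult_minv[OF assms(1)] minv_mult[OF assms(1)] assms(2) by simp_all
qed

lemma mult_minv_cancel_right:
  assumes "g \<in> GL n" "h \<in> carrier_mat k n"
  shows "h * g * minv g = h" "h * minv g * g = h"
proof -
  have c: "g \<in> carrier_mat n n" "minv g \<in> carrier_mat n n"
    using assms(1) by (auto simp: GL_carrier minv_carrier)
  show "h * g * minv g = h" "h * minv g * g = h"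
    using assoc_mult_mat[OF assms(2) c] assoc_mult_mat[OF assms(2) c(2,1)]
      mult_minv[OF assms(1)] minv_mult[OF assms(1)] assms(2) by simp_all
qed

lemma mult_minv_entry:
  assumes "g \<in> GL n" "i < n" "j < n"
  shows "(\<Sum>l<n. g $$ (i, l) * minv g $$ (l, j)) = (if i = j then 1 else 0)"
  using mult_mat_entry[of g n n "minv g" n i j] assms mult_minv[OF assms(1)]
  by (simp add: GL_carrier minv_carrier)

lemma minv_mult_entry:
  assumes "g \<in> GL n" "i < n" "j < n"
  shows "(\<Sum>l<n. minv g $$ (i, l) * g $$ (l, j)) = (if i = j then 1 else 0)"
  using mult_mat_entry[of "minv g" n n g n i j] assms minv_mult[OF assms(1)]
  by (simp add: GL_carrier minv_carrier)

section \<open>Polynomial functions of matrix entries\<close>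

lemma poly_fun_sum:
  "finite I \<Longrightarrow> (\<And>i. i \<in> I \<Longrightarrow> f i \<in> poly_fun n) \<Longrightarrow> (\<lambda>g. \<Sum>i\<in>I. f i g) \<in> poly_fun n"
  by (induction I rule: finite_induct) (auto intro: poly_fun.intros)

lemma poly_fun_prod:
  "finite I \<Longrightarrow> (\<And>i. i \<in> I \<Longrightarrow> f i \<in> poly_fun n) \<Longrightarrow> (\<lambda>g. \<Prod>i\<in>I. f i g) \<in> poly_fun n"
  by (induction I rule: finite_induct) (auto intro: poly_fun.intros)

lemma poly_fun_det_mat:
  assumes "\<And>i j. i < k \<Longrightarrow> j < k \<Longrightarrow> (\<lambda>g. F g i j) \<in> poly_fun n"
  shows "(\<lambda>g. det (mat k k (\<lambda>(i, j). F g i j))) \<in> poly_fun n"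
proof -
  have "(\<lambda>g. det (mat k k (\<lambda>(i, j). F g i j)))
      = (\<lambda>g. \<Sum>s\<in>{s. s permutes {0..<k}}. signof s * (\<Prod>i\<in>{0..<k}. F g i (s i)))"
  proof
    fix g
    show "det (mat k k (\<lambda>(i, j). F g i j))
        = (\<Sum>s\<in>{s. s permutes {0..<k}}. signof s * (\<Prod>i\<in>{0..<k}. F g i (s i)))"
      unfolding det_def'[OF mat_carrier]
    proof (intro sum.cong refl arg_cong2[of _ _ _ _ "(*)"] prod.cong)
      fix s i assume "s \<in> {s. s permutes {0..<k}}" "i \<in> {0..<k}"
      then have "i < k" "s i < k" using permutes_in_image[of s "{0..<k}" i] by auto
      then show "mat k k (\<lambda>(i, j). F g i j) $$ (i, s i) = F g i (s i)" by simp
    qed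
  qed
  moreover have "(\<lambda>g. \<Sum>s\<in>{s. s permutes {0..<k}}. signof s * (\<Prod>i\<in>{0..<k}. F g i (s i))) \<in> poly_fun n"
  proof (intro poly_fun_sum poly_fun.mult poly_fun.const poly_fun_prod)
    show "finite {s. s permutes {0..<k}}" by (simp add: finite_permutations)
    fix s i assume "s \<in> {s. s permutes {0..<k}}" "i \<in> {0..<k}"
    then have "i < k" "s i < k" using permutes_in_image[of s "{0..<k}" i] by auto
    then show "(\<lambda>g. F g i (s i)) \<in> poly_fun n" using assms by auto
  qed simp
  ultimately show ?thesis by simp
qed

text \<open>Agreement with a polynomial function on \<open>n \<times> n\<close> matrices only, as formulas that involve
  \<open>det\<close> or \<open>adj_mat\<close> have unspecified values elsewhere.\<close>

definition poly_on :: "nat \<Rightarrow> (complex mat \<Rightarrow> complex) \<Rightarrow> bool" where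
  "poly_on n f \<longleftrightarrow> (\<exists>h\<in>poly_fun n. \<forall>g\<in>carrier_mat n n. f g = h g)"

lemma poly_onI:
  "h \<in> poly_fun n \<Longrightarrow> (\<And>g. g \<in> carrier_mat n n \<Longrightarrow> f g = h g) \<Longrightarrow> poly_on n f"
  unfolding poly_on_def by (intro bexI) auto

lemma poly_onE:
  assumes "poly_on n f"
  obtains h where "h \<in> poly_fun n" "\<And>g. g \<in> carrier_mat n n \<Longrightarrow> f g = h g"
  using assms unfolding poly_on_def by auto

lemma poly_on_const [simp]: "poly_on n (\<lambda>g. c)"
  by (rule poly_onI[OF poly_fun.const]) simp

lemma poly_on_entry: "i < n \<Longrightarrow> j < n \<Longrightarrow> poly_on n (\<lambda>g. g $$ (i, j))"
  by (rule poly_onI[OF poly_fun.entry]) simp_all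

lemma poly_on_add: "poly_on n f \<Longrightarrow> poly_on n h \<Longrightarrow> poly_on n (\<lambda>g. f g + h g)"
  by (elim poly_onE, rule poly_onI[OF poly_fun.add], assumption, assumption) simp

lemma poly_on_mult: "poly_on n f \<Longrightarrow> poly_on n h \<Longrightarrow> poly_on n (\<lambda>g. f g * h g)"
  by (elim poly_onE, rule poly_onI[OF poly_fun.mult], assumption, assumption) simp

lemma poly_on_sum:
  "finite I \<Longrightarrow> (\<And>i. i \<in> I \<Longrightarrow> poly_on n (f i)) \<Longrightarrow> poly_on n (\<lambda>g. \<Sum>i\<in>I. f i g)"
  by (induction I rule: finite_induct) (auto intro: poly_on_add)

lemma poly_on_prod:
  "finite I \<Longrightarrow> (\<And>i. i \<in> I \<Longrightarrow> poly_on n (f i)) \<Longrightarrow> poly_on n (\<lambda>g. \<Prod>i\<in>I. f i g)"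
  by (induction I rule: finite_induct) (auto intro: poly_on_mult)

lemma poly_on_cong:
  "poly_on n f \<Longrightarrow> (\<And>g. g \<in> carrier_mat n n \<Longrightarrow> f' g = f g) \<Longrightarrow> poly_on n f'"
  unfolding poly_on_def by (elim bexE, rule bexI) auto

lemma poly_on_det_mat:
  assumes "\<And>i j. i < k \<Longrightarrow> j < k \<Longrightarrow> poly_on n (\<lambda>g. F g i j)"
  shows "poly_on n (\<lambda>g. det (mat k k (\<lambda>(i, j). F g i j)))"
proof -
  obtain H where H: "\<And>i j. i < k \<Longrightarrow> j < k \<Longrightarrow> H i j \<in> poly_fun n \<and> (\<forall>g\<in>carrier_mat n n. F g i j = H i j g)"
    using assms unfolding poly_on_def by metis
  have "(\<lambda>g. det (mat k k (\<lambda>(i, j). H i j g))) \<in> poly_fun n"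
    by (rule poly_fun_det_mat) (use H in auto)
  moreover have "mat k k (\<lambda>(i, j). F g i j) = mat k k (\<lambda>(i, j). H i j g)" if "g \<in> carrier_mat n n" for g
    using H that by (intro eq_matI) auto
  ultimately show ?thesis unfolding poly_on_def by (intro bexI) auto
qed

lemma poly_on_det: "poly_on n det"
proof (rule poly_on_cong)
  show "poly_on n (\<lambda>g. det (mat n n (\<lambda>(i, j). g $$ (i, j))))"
    by (rule poly_on_det_mat) (rule poly_on_entry)
  fix g :: "complex mat" assume "g \<in> carrier_mat n n"
  then have "mat n n (\<lambda>(i, j). g $$ (i, j)) = g" by (intro eq_matI) auto
  then show "det g = det (mat n n (\<lambda>(i, j). g $$ (i, j)))" by simp
qed

lemma poly_on_adj:
  assumes "i < n" "j < n"
  shows "poly_on n (\<lambda>g. adj_mat g $$ (i, j))"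
proof (rule poly_on_cong)
  show "poly_on n (\<lambda>g. (-1) ^ (j + i) * det (mat (n - 1) (n - 1)
      (\<lambda>(i', j'). g $$ (if i' < j then i' else Suc i', if j' < i then j' else Suc j'))))"
    by (intro poly_on_mult poly_on_const poly_on_det_mat poly_on_entry) (use assms in auto)
  fix g :: "complex mat" assume "g \<in> carrier_mat n n"
  then show "adj_mat g $$ (i, j) = (-1) ^ (j + i) * det (mat (n - 1) (n - 1)
      (\<lambda>(i', j'). g $$ (if i' < j then i' else Suc i', if j' < i then j' else Suc j')))"
    using assms by (simp add: adj_mat_def cofactor_def mat_delete_def)
qed

lemma poly_fun_left_mult:
  assumes "f \<in> poly_fun n" "s \<in> carrier_mat n n"
  shows "poly_on n (\<lambda>t. f (s * t))"
  using assms(1)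
proof induction
  case (entry i j)
  show ?case
  proof (rule poly_on_cong)
    show "poly_on n (\<lambda>t. \<Sum>l<n. s $$ (i, l) * t $$ (l, j))"
      using entry by (intro poly_on_sum poly_on_mult poly_on_const poly_on_entry) auto
    show "(s * t) $$ (i, j) = (\<Sum>l<n. s $$ (i, l) * t $$ (l, j))" if "t \<in> carrier_mat n n" for t
      by (rule mult_mat_entry) (use that entry assms in auto)
  qed
qed (auto intro: poly_on_add poly_on_mult)

lemma poly_fun_right_mult:
  assumes "f \<in> poly_fun n" "t \<in> carrier_mat n n"
  shows "poly_on n (\<lambda>s. f (s * t))"
  using assms(1)
proof induction
  case (entry i j)
  show ?case
  proof (rule poly_on_cong)
    show "poly_on n (\<lambda>s. \<Sum>l<n. s $$ (i, l) * t $$ (l, j))"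
      using entry by (intro poly_on_sum poly_on_mult poly_on_const poly_on_entry) auto
    show "(s * t) $$ (i, j) = (\<Sum>l<n. s $$ (i, l) * t $$ (l, j))" if "s \<in> carrier_mat n n" for s
      by (rule mult_mat_entry) (use that entry assms in auto)
  qed
qed (auto intro: poly_on_add poly_on_mult)

text \<open>Irreducibility (of a possibly empty set) in terms of functions: there are no zero divisors
  among the restrictions of polynomial functions.\<close>

definition prime_set :: "nat \<Rightarrow> complex mat set \<Rightarrow> bool" where
  "prime_set n S \<longleftrightarrow> S \<subseteq> carrier_mat n n \<and>
     (\<forall>f h. poly_on n f \<longrightarrow> poly_on n h \<longrightarrow> (\<exists>s\<in>S. f s \<noteq> 0) \<longrightarrow> (\<exists>s\<in>S. h s \<noteq> 0) \<longrightarrow>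
        (\<exists>s\<in>S. f s \<noteq> 0 \<and> h s \<noteq> 0))"

lemma prime_setD:
  "prime_set n S \<Longrightarrow> poly_on n f \<Longrightarrow> poly_on n h \<Longrightarrow> s \<in> S \<Longrightarrow> f s \<noteq> 0 \<Longrightarrow> t \<in> S \<Longrightarrow> h t \<noteq> 0 \<Longrightarrow>
    \<exists>u\<in>S. f u \<noteq> 0 \<and> h u \<noteq> 0"
  unfolding prime_set_def by blast

lemma poly_on_left_mult:
  assumes "poly_on n f" "s \<in> carrier_mat n n"
  shows "poly_on n (\<lambda>t. f (s * t))"
proof -
  obtain h where h: "h \<in> poly_fun n" "\<And>g. g \<in> carrier_mat n n \<Longrightarrow> f g = h g"
    using assms(1) unfolding poly_on_def by blast
  show ?thesis by (rule poly_on_cong[OF poly_fun_left_mult[OF h(1) assms(2)]]) (use h(2) assms(2) in auto)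
qed

lemma poly_on_right_mult:
  assumes "poly_on n f" "t \<in> carrier_mat n n"
  shows "poly_on n (\<lambda>s. f (s * t))"
proof -
  obtain h where h: "h \<in> poly_fun n" "\<And>g. g \<in> carrier_mat n n \<Longrightarrow> f g = h g"
    using assms(1) unfolding poly_on_def by blast
  show ?thesis by (rule poly_on_cong[OF poly_fun_right_mult[OF h(1) assms(2)]]) (use h(2) assms(2) in auto)
qed

text \<open>Freezing the left factors, \<open>f (s1 * t)\<close> and \<open>h (s2 * t)\<close> are
  polynomial in \<open>t\<close> and have a common point of nonvanishing \<open>t\<close> in
  \<open>T\<close>. Freezing this \<open>t\<close>, the same argument on \<open>S\<close> makes the
  left factors agree.\<close>

lemma prime_set_mult:
  assumes S: "prime_set n S" and T: "prime_set n T"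
  shows "prime_set n {s * t |s t. s \<in> S \<and> t \<in> T}"
  unfolding prime_set_def
proof (intro conjI allI impI)
  have c: "S \<subseteq> carrier_mat n n" "T \<subseteq> carrier_mat n n" using S T by (auto simp: prime_set_def)
  then show "{s * t |s t. s \<in> S \<and> t \<in> T} \<subseteq> carrier_mat n n" by fastforce
  fix f h assume fh: "poly_on n f" "poly_on n h"
  assume "\<exists>s\<in>{s * t |s t. s \<in> S \<and> t \<in> T}. f s \<noteq> 0" "\<exists>s\<in>{s * t |s t. s \<in> S \<and> t \<in> T}. h s \<noteq> 0"
  then obtain s1 t1 s2 t2 where st: "s1 \<in> S" "t1 \<in> T" "f (s1 * t1) \<noteq> 0" "s2 \<in> S" "t2 \<in> T" "h (s2 * t2) \<noteq> 0"
    by auto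
  obtain t where t: "t \<in> T" "f (s1 * t) \<noteq> 0" "h (s2 * t) \<noteq> 0"
    using prime_setD[OF T poly_on_left_mult[OF fh(1), of s1] poly_on_left_mult[OF fh(2), of s2] st(2,3,5,6)]
      subsetD[OF c(1)] st(1,4) by auto
  obtain s where "s \<in> S" "f (s * t) \<noteq> 0" "h (s * t) \<noteq> 0"
    using prime_setD[OF S poly_on_right_mult[OF fh(1), of t] poly_on_right_mult[OF fh(2), of t] st(1) t(2) st(4) t(3)]
      subsetD[OF c(2) t(1)] by auto
  then show "\<exists>s\<in>{s * t |s t. s \<in> S \<and> t \<in> T}. f s \<noteq> 0 \<and> h s \<noteq> 0" using t(1) by blast
qed

abbreviation (input) line_mat :: "complex mat \<Rightarrow> complex mat \<Rightarrow> complex \<Rightarrow> complex mat" where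
  "line_mat a b t \<equiv> a + t \<cdot>\<^sub>m (b - a)"

lemma poly_fun_line:
  assumes "f \<in> poly_fun n" "a \<in> carrier_mat n n" "b \<in> carrier_mat n n"
  shows "\<exists>r. \<forall>t. f (line_mat a b t) = poly r t"
  using assms(1)
proof induction
  case (const c)
  show ?case by (rule exI[of _ "[:c:]"]) simp
next
  case (entry i j)
  show ?case by (rule exI[of _ "[:a $$ (i, j), b $$ (i, j) - a $$ (i, j):]"]) (use entry assms in auto)
next
  case (add f h)
  then show ?case by (metis poly_add)
next
  case (mult f h)
  then show ?case by (metis poly_mult)
qed

lemma poly_on_line:
  assumes "poly_on n f" "a \<in> carrier_mat n n" "b \<in> carrier_mat n n"
  shows "\<exists>r. \<forall>t. f (line_mat a b t) = poly r t"
proof -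
  obtain h where h: "h \<in> poly_fun n" "\<And>g. g \<in> carrier_mat n n \<Longrightarrow> f g = h g"
    using assms(1) unfolding poly_on_def by blast
  have "line_mat a b t \<in> carrier_mat n n" for t using assms by auto
  then show ?thesis using poly_fun_line[OF h(1) assms(2,3)] h(2) by auto
qed

text \<open>On the line through \<open>a\<close> and \<open>b\<close>, the functions
  \<open>f\<close>, \<open>h\<close> and \<open>d\<close> become nonzero polynomials in one
  variable; their product has only finitely many roots, and any other parameter gives a point of
  \<open>S\<close>.\<close>

lemma prime_set_line:
  assumes c: "S \<subseteq> carrier_mat n n" and d: "poly_on n d" "\<And>s. s \<in> S \<Longrightarrow> d s \<noteq> 0"
    and line: "\<And>a b t. a \<in> S \<Longrightarrow> b \<in> S \<Longrightarrow> d (line_mat a b t) \<noteq> 0 \<Longrightarrow> line_mat a b t \<in> S"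
  shows "prime_set n S"
  unfolding prime_set_def
proof (intro conjI allI impI c)
  fix f h assume fh: "poly_on n f" "poly_on n h"
  assume "\<exists>s\<in>S. f s \<noteq> 0" "\<exists>s\<in>S. h s \<noteq> 0"
  then obtain a b where ab: "a \<in> S" "f a \<noteq> 0" "b \<in> S" "h b \<noteq> 0" by blast
  have cab: "a \<in> carrier_mat n n" "b \<in> carrier_mat n n" using ab c by auto
  obtain rf rh rd where r: "\<And>t. f (line_mat a b t) = poly rf t" "\<And>t. h (line_mat a b t) = poly rh t"
      "\<And>t. d (line_mat a b t) = poly rd t"
    using poly_on_line[OF fh(1) cab] poly_on_line[OF fh(2) cab] poly_on_line[OF d(1) cab] by blast
  have e: "line_mat a b 0 = a" "line_mat a b 1 = b" using cab by (auto intro!: eq_matI)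
  have "poly rf 0 \<noteq> 0" "poly rh 1 \<noteq> 0" "poly rd 0 \<noteq> 0"
    using r[of 0] r[of 1] e ab d(2)[OF ab(1)] by auto
  then have "rf \<noteq> 0" "rh \<noteq> 0" "rd \<noteq> 0" by auto
  then have "rf * rh * rd \<noteq> 0" by simp
  then have "finite {t. poly (rf * rh * rd) t = 0}" by (rule poly_roots_finite)
  then obtain t where "poly (rf * rh * rd) t \<noteq> 0"
    using infinite_UNIV_char_0 by (metis (mono_tags, lifting) UNIV_eq_I mem_Collect_eq)
  then have "f (line_mat a b t) \<noteq> 0" "h (line_mat a b t) \<noteq> 0" "d (line_mat a b t) \<noteq> 0"
    using r by auto
  then show "\<exists>s\<in>S. f s \<noteq> 0 \<and> h s \<noteq> 0" using line[OF ab(1,3)] by blast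
qed

lemma prime_set_affine:
  "prime_set n {g \<in> GL n. \<forall>i<n. \<forall>j<n. Z i j \<longrightarrow> g $$ (i, j) = a i j}"
proof (rule prime_set_line[where d = det])
  show "poly_on n det" by (rule poly_on_det)
qed (auto simp: GL_iff_det)

section \<open>Flags of matrices\<close>

text \<open>The member \<open>i\<close> of the flag of \<open>g\<close>, written in coordinates with
  respect to the columns of \<open>g\<close>.\<close>

definition lead :: "nat \<Rightarrow> nat \<Rightarrow> complex vec set" where
  "lead n i = {y \<in> carrier_vec n. \<forall>k<n. i \<le> k \<longrightarrow> y $ k = 0}"

lemma flag_of_mat_apply:
  assumes g: "g \<in> carrier_mat n n" and i: "i \<le> n"
  shows "flag_of_mat n g i = (*\<^sub>v) g ` lead n i"
proof -
  interpret vec_space "TYPE(complex)" n .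
  \<comment> \<open>The first \<open>i\<close> columns of \<open>g\<close>: their span is the column
    space of \<open>A\<close>, hence an image under \<open>A\<close>.\<close>
  define A where "A = mat n i (\<lambda>(r, s). g $$ (r, s))"
  have A: "A \<in> carrier_mat n i" by (simp add: A_def)
  have colA: "col A s = col g s" if "s < i" for s
    using that g i by (intro eq_vecI) (auto simp: A_def)
  have "set (cols A) = (\<lambda>k. col g (k - 1)) ` {1..i}"
  proof -
    have "set (cols A) = (\<lambda>s. col g s) ` {0..<i}"
      using A colA by (auto simp: cols_def)
    also have "{0..<i} = (\<lambda>k. k - 1) ` {1..i}"
      by (auto simp: image_iff intro!: bexI[of _ "Suc _"])
    finally show ?thesis by (simp add: image_image)
  qed
  then have "flag_of_mat n g i = col_space A"
    using i by (simp add: flag_of_mat_def flag_spanned_by_def col_space_def)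
  also have "\<dots> = {y \<in> carrier_vec n. \<exists>x\<in>carrier_vec i. A *\<^sub>v x = y}"
    using col_space_eq[OF A] A by simp
  also have "\<dots> = (*\<^sub>v) g ` lead n i"
  proof (intro equalityI subsetI)
    fix y assume "y \<in> {y \<in> carrier_vec n. \<exists>x\<in>carrier_vec i. A *\<^sub>v x = y}"
    then obtain x where x: "x \<in> carrier_vec i" "A *\<^sub>v x = y" by blast
    define x' where "x' = vec n (\<lambda>k. if k < i then x $ k else 0)"
    have x': "x' \<in> lead n i" by (auto simp: x'_def lead_def)
    have "g *\<^sub>v x' = A *\<^sub>v x"
    proof (rule eq_vecI)
      fix r assume "r < dim_vec (A *\<^sub>v x)"
      then have r: "r < n" using A by simp
      have "(g *\<^sub>v x') $ r = (\<Sum>l<n. g $$ (r, l) * (if l < i then x $ l else 0))"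
        using mult_mat_vec_entry[OF g _ r, of x'] by (simp add: x'_def)
      also have "\<dots> = (\<Sum>l<i. g $$ (r, l) * (if l < i then x $ l else 0))"
        by (rule sum.mono_neutral_right) (use i in auto)
      also have "\<dots> = (A *\<^sub>v x) $ r"
        using mult_mat_vec_entry[OF A x(1) r] r by (simp add: A_def)
      finally show "(g *\<^sub>v x') $ r = (A *\<^sub>v x) $ r" .
    qed (use A g in simp)
    then show "y \<in> (*\<^sub>v) g ` lead n i" using x(2) x' by auto
  next
    fix y assume "y \<in> (*\<^sub>v) g ` lead n i"
    then obtain x where x: "x \<in> carrier_vec n" "\<And>k. k < n \<Longrightarrow> i \<le> k \<Longrightarrow> x $ k = 0" "y = g *\<^sub>v x"
      by (auto simp: lead_def)
    define x' where "x' = vec i (\<lambda>k. x $ k)"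
    have "A *\<^sub>v x' = g *\<^sub>v x"
    proof (rule eq_vecI)
      fix r assume "r < dim_vec (g *\<^sub>v x)"
      then have r: "r < n" using g by simp
      have "(g *\<^sub>v x) $ r = (\<Sum>l<n. g $$ (r, l) * x $ l)"
        using mult_mat_vec_entry[OF g x(1) r] .
      also have "\<dots> = (\<Sum>l<i. g $$ (r, l) * x $ l)"
        by (rule sum.mono_neutral_right) (use i x in auto)
      also have "\<dots> = (A *\<^sub>v x') $ r"
        using mult_mat_vec_entry[OF A _ r, of x'] r by (simp add: A_def x'_def)
      finally show "(A *\<^sub>v x') $ r = (g *\<^sub>v x) $ r" by simp
    qed (use A g in simp)
    then show "y \<in> {y \<in> carrier_vec n. \<exists>x\<in>carrier_vec i. A *\<^sub>v x = y}"
      using x(1,3) A g by (auto intro!: bexI[of _ x'] simp: x'_def)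
  qed
  finally show ?thesis .
qed

lemma flag_of_mat_outside: "\<not> i \<le> n \<Longrightarrow> flag_of_mat n g i = undefined"
  by (simp add: flag_of_mat_def flag_spanned_by_def)

lemma flag_of_mat_eqI:
  assumes "g \<in> carrier_mat n n" "h \<in> carrier_mat n n"
    and "\<And>i. i \<le> n \<Longrightarrow> (*\<^sub>v) g ` lead n i = (*\<^sub>v) h ` lead n i"
  shows "flag_of_mat n g = flag_of_mat n h"
proof
  fix i show "flag_of_mat n g i = flag_of_mat n h i"
    using assms by (cases "i \<le> n") (simp_all add: flag_of_mat_apply flag_of_mat_outside)
qed

lemma mult_mat_vec_unit:
  fixes A :: "complex mat"
  assumes "A \<in> carrier_mat n m" "j < m"
  shows "A *\<^sub>v unit_vec m j = col A j"
  using assms by (intro eq_vecI) auto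

lemma minv_mult_mat_vec:
  assumes "g \<in> GL n" "v \<in> carrier_vec n"
  shows "minv g *\<^sub>v (g *\<^sub>v v) = v" "g *\<^sub>v (minv g *\<^sub>v v) = v"
proof -
  have c: "g \<in> carrier_mat n n" "minv g \<in> carrier_mat n n"
    using assms(1) by (auto simp: GL_carrier minv_carrier)
  show "minv g *\<^sub>v (g *\<^sub>v v) = v" "g *\<^sub>v (minv g *\<^sub>v v) = v"
    using assoc_mult_mat_vec[OF c(2,1) assms(2)] assoc_mult_mat_vec[OF c assms(2)]
      mult_minv[OF assms(1)] minv_mult[OF assms(1)] assms(2) by simp_all
qed

definition Borel :: "nat \<Rightarrow> complex mat set" where
  "Borel n = {b \<in> GL n. \<forall>i<n. \<forall>j<n. j < i \<longrightarrow> b $$ (i, j) = 0}"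

lemma BorelD: "b \<in> Borel n \<Longrightarrow> j < i \<Longrightarrow> i < n \<Longrightarrow> b $$ (i, j) = 0"
  by (auto simp: Borel_def)

lemma Borel_GL: "b \<in> Borel n \<Longrightarrow> b \<in> GL n"
  by (auto simp: Borel_def)

lemma Borel_iff_diag:
  assumes b: "b \<in> carrier_mat n n" and ut: "\<And>i j. j < i \<Longrightarrow> i < n \<Longrightarrow> b $$ (i, j) = 0"
  shows "b \<in> Borel n \<longleftrightarrow> (\<forall>i<n. b $$ (i, i) \<noteq> 0)"
proof -
  have "upper_triangular b" using assms by auto
  then have "det b = prod_list (diag_mat b)" using b by (rule det_upper_triangular)
  then have "det b \<noteq> 0 \<longleftrightarrow> (\<forall>i<n. b $$ (i, i) \<noteq> 0)"
    using b by (auto simp: prod_list_zero_iff diag_mat_def)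
  then show ?thesis using assms by (auto simp: Borel_def GL_iff_det)
qed

lemma Borel_diag:
  assumes "b \<in> Borel n" "i < n"
  shows "b $$ (i, i) \<noteq> 0"
  using Borel_iff_diag[of b n] assms Borel_GL[OF assms(1)] BorelD[OF assms(1)] GL_carrier by blast

text \<open>Back substitution in \<open>b * minv b = 1\<close>, from the bottom row upwards; the
  nonzero diagonal of \<open>b\<close> isolates one entry at a time.\<close>

lemma minv_Borel:
  assumes b: "b \<in> Borel n"
  shows "minv b \<in> Borel n"
proof -
  let ?c = "minv b"
  have g: "b \<in> GL n" by (rule Borel_GL[OF b])
  have c: "b \<in> carrier_mat n n" "?c \<in> carrier_mat n n" using g by (auto simp: GL_carrier minv_carrier)
  have "?c $$ (i, j) = 0" if "j < i" "i < n" for i j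
    using that
  proof (induction "n - i" arbitrary: i rule: less_induct)
    case less
    have "0 = (b * ?c) $$ (i, j)" using mult_minv[OF g] less.prems by simp
    also have "\<dots> = (\<Sum>l<n. b $$ (i, l) * ?c $$ (l, j))"
      by (rule mult_mat_entry[OF c]) (use less.prems in auto)
    also have "\<dots> = (\<Sum>l\<in>{i}. b $$ (i, l) * ?c $$ (l, j))"
    proof (rule sum.mono_neutral_right)
      show "\<forall>l\<in>{..<n} - {i}. b $$ (i, l) * ?c $$ (l, j) = 0"
      proof
        fix l assume l: "l \<in> {..<n} - {i}"
        show "b $$ (i, l) * ?c $$ (l, j) = 0"
        proof (cases "l < i")
          case True then show ?thesis using BorelD[OF b] less.prems by simp
        next
          case False
          then have "?c $$ (l, j) = 0" using less.hyps[of l] l less.prems by auto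
          then show ?thesis by simp
        qed
      qed
    qed (use less.prems in auto)
    finally show ?case using Borel_diag[OF b less.prems(2)] by simp
  qed
  then show ?thesis using minv_GL[OF g] by (auto simp: Borel_def)
qed

lemma Borel_lead:
  assumes b: "b \<in> Borel n" and y: "y \<in> lead n i"
  shows "b *\<^sub>v y \<in> lead n i"
proof -
  have c: "b \<in> carrier_mat n n" using b by (auto simp: Borel_GL GL_carrier)
  have y': "y \<in> carrier_vec n" using y by (simp add: lead_def)
  have "(b *\<^sub>v y) $ k = 0" if k: "k < n" "i \<le> k" for k
  proof -
    have "(b *\<^sub>v y) $ k = (\<Sum>l<n. b $$ (k, l) * y $ l)" by (rule mult_mat_vec_entry[OF c y' k(1)])
    also have "\<dots> = 0"
    proof (rule sum.neutral, rule ballI)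
      fix l assume "l \<in> {..<n}"
      then show "b $$ (k, l) * y $ l = 0"
        using BorelD[OF b, of l k] y k by (cases "l < k") (auto simp: lead_def)
    qed
    finally show ?thesis .
  qed
  then show ?thesis using c y' by (auto simp: lead_def)
qed

lemma flag_of_mat_Borel:
  assumes g: "g \<in> GL n" and b: "b \<in> Borel n"
  shows "flag_of_mat n (g * b) = flag_of_mat n g"
proof (rule flag_of_mat_eqI)
  have c: "g \<in> carrier_mat n n" "b \<in> carrier_mat n n" "minv b \<in> carrier_mat n n"
    using g b by (auto simp: Borel_GL GL_carrier minv_carrier)
  then show "g * b \<in> carrier_mat n n" "g \<in> carrier_mat n n" by auto
  fix i
  show "(*\<^sub>v) (g * b) ` lead n i = (*\<^sub>v) g ` lead n i"
  proof (intro equalityI subsetI)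
    fix v assume "v \<in> (*\<^sub>v) (g * b) ` lead n i"
    then obtain y where y: "y \<in> lead n i" "v = g * b *\<^sub>v y" by blast
    then have "v = g *\<^sub>v (b *\<^sub>v y)" using c by (simp add: lead_def assoc_mult_mat_vec)
    then show "v \<in> (*\<^sub>v) g ` lead n i" using Borel_lead[OF b y(1)] by blast
  next
    fix v assume "v \<in> (*\<^sub>v) g ` lead n i"
    then obtain y where y: "y \<in> lead n i" "v = g *\<^sub>v y" by blast
    have yc: "y \<in> carrier_vec n" using y by (simp add: lead_def)
    have "g * b *\<^sub>v (minv b *\<^sub>v y) = g *\<^sub>v (b *\<^sub>v (minv b *\<^sub>v y))"
      using c yc by (simp add: assoc_mult_mat_vec[of _ n n _ n])
    then have "v = g * b *\<^sub>v (minv b *\<^sub>v y)"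
      using minv_mult_mat_vec(2)[OF Borel_GL[OF b] yc] y(2) by simp
    then show "v \<in> (*\<^sub>v) (g * b) ` lead n i" using Borel_lead[OF minv_Borel[OF b] y(1)] by blast
  qed
qed

text \<open>Column \<open>j\<close> of \<open>h\<close> lies in the member \<open>Suc j\<close> of
  the flag of \<open>g\<close>, so in the basis of \<open>g\<close> it has no coordinate beyond
  \<open>j\<close>. Thus the fibres of the map to flags are cosets of the Borel subgroup.\<close>

lemma flag_of_mat_eqD:
  assumes g: "g \<in> GL n" and h: "h \<in> GL n" and eq: "flag_of_mat n g = flag_of_mat n h"
  shows "\<exists>b\<in>Borel n. h = g * b"
proof
  have c: "g \<in> carrier_mat n n" "h \<in> carrier_mat n n" "minv g \<in> carrier_mat n n"
    using g h by (auto simp: GL_carrier minv_carrier)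
  show "h = g * (minv g * h)" using mult_minv_cancel(1)[OF g c(2)] by simp
  have "(minv g * h) $$ (i, j) = 0" if ij: "j < i" "i < n" for i j
  proof -
    have "unit_vec n j \<in> lead n (Suc j)" using ij by (auto simp: lead_def)
    moreover have "h *\<^sub>v unit_vec n j = col h j" by (rule mult_mat_vec_unit[OF c(2)]) (use ij in simp)
    ultimately have "col h j \<in> flag_of_mat n h (Suc j)"
      unfolding flag_of_mat_apply[OF c(2) Suc_leI[OF less_trans[OF ij]]] by (metis imageI)
    then obtain y where y: "y \<in> lead n (Suc j)" "col h j = g *\<^sub>v y"
      unfolding eq[symmetric] flag_of_mat_apply[OF c(1) Suc_leI[OF less_trans[OF ij]]] by blast
    have "(minv g * h) $$ (i, j) = (minv g *\<^sub>v col h j) $ i"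
      using c ij by simp
    also have "\<dots> = y $ i" using minv_mult_mat_vec(1)[OF g, of y] y by (simp add: lead_def)
    finally show ?thesis using y ij by (simp add: lead_def)
  qed
  then show "minv g * h \<in> Borel n"
    using GL_mult[OF minv_GL[OF g] h] by (auto simp: Borel_def)
qed

lemma flag_act_flag_of_mat:
  assumes "k \<in> GL n" "g \<in> GL n"
  shows "flag_act n k (flag_of_mat n g) = flag_of_mat n (k * g)"
proof
  have c: "g \<in> carrier_mat n n" "k \<in> carrier_mat n n" using assms by (auto simp: GL_carrier)
  fix i
  show "flag_act n k (flag_of_mat n g) i = flag_of_mat n (k * g) i"
  proof (cases "i \<le> n")
    case True
    have "(\<lambda>v. k *\<^sub>v v) ` (*\<^sub>v) g ` lead n i = (*\<^sub>v) (k * g) ` lead n i"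
      unfolding image_image
      by (rule image_cong) (use c in \<open>auto simp: lead_def assoc_mult_mat_vec[of _ n n _ n]\<close>)
    then show ?thesis using True c by (simp add: flag_act_def flag_of_mat_apply)
  qed (simp add: flag_act_def flag_of_mat_outside)
qed

text \<open>\<open>minv g * x * g\<close> is the matrix of \<open>x\<close> in the basis formed by
  the columns of \<open>g\<close>. Column \<open>b\<close> belongs to the member
  \<open>Suc b\<close>, and monotonicity of \<open>m\<close> allows the condition on each member to
  be tested on basis vectors.\<close>

lemma flag_of_mat_in_Hess:
  assumes g: "g \<in> GL n" and x: "x \<in> carrier_mat n n" and m: "hessenberg_vector n m"
  shows "flag_of_mat n g \<in> Hess n x m \<longleftrightarrow>
    (\<forall>a<n. \<forall>b<n. m (Suc b) \<le> a \<longrightarrow> (minv g * x * g) $$ (a, b) = 0)" (is "_ \<longleftrightarrow> ?R")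
proof -
  let ?A = "minv g * x * g"
  have c: "g \<in> carrier_mat n n" "minv g \<in> carrier_mat n n" using g by (auto simp: GL_carrier minv_carrier)
  have A: "?A \<in> carrier_mat n n" using c x by auto
  have m_le: "m i \<le> n" if "i \<in> {1..n}" for i using m that by (auto simp: hessenberg_vector_def)
  have comm: "x *\<^sub>v (g *\<^sub>v y) = g *\<^sub>v (?A *\<^sub>v y)" if y: "y \<in> carrier_vec n" for y
  proof -
    have "g *\<^sub>v (?A *\<^sub>v y) = g *\<^sub>v (minv g *\<^sub>v (x *\<^sub>v (g *\<^sub>v y)))"
      using c x y by (simp add: assoc_mult_mat_vec[of _ n n _ n])
    then show ?thesis using minv_mult_mat_vec(2)[OF g, of "x *\<^sub>v (g *\<^sub>v y)"] c x y by simp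
  qed
  have step: "(\<lambda>v. x *\<^sub>v v) ` flag_of_mat n g i \<subseteq> flag_of_mat n g (m i)
      \<longleftrightarrow> (\<forall>y\<in>lead n i. ?A *\<^sub>v y \<in> lead n (m i))" if i: "i \<in> {1..n}" for i
  proof -
    have "x *\<^sub>v (g *\<^sub>v y) \<in> (*\<^sub>v) g ` lead n (m i) \<longleftrightarrow> ?A *\<^sub>v y \<in> lead n (m i)" if y: "y \<in> lead n i" for y
    proof
      have yc: "y \<in> carrier_vec n" using y by (simp add: lead_def)
      show "?A *\<^sub>v y \<in> lead n (m i)" if im: "x *\<^sub>v (g *\<^sub>v y) \<in> (*\<^sub>v) g ` lead n (m i)"
      proof -
        obtain z where z: "z \<in> lead n (m i)" "g *\<^sub>v (?A *\<^sub>v y) = g *\<^sub>v z"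
          using im unfolding comm[OF yc] by blast
        have zc: "z \<in> carrier_vec n" using z by (simp add: lead_def)
        have "?A *\<^sub>v y = z"
          using minv_mult_mat_vec(1)[OF g zc] minv_mult_mat_vec(1)[OF g, of "?A *\<^sub>v y"] z(2) A yc by simp
        then show ?thesis using z by simp
      qed
      show "x *\<^sub>v (g *\<^sub>v y) \<in> (*\<^sub>v) g ` lead n (m i)" if "?A *\<^sub>v y \<in> lead n (m i)"
        using that comm[OF yc] by auto
    qed
    then show ?thesis
      using i m_le[OF i] c by (auto simp: flag_of_mat_apply image_subset_iff)
  qed
  have "flag_of_mat n g \<in> Hess n x m \<longleftrightarrow> (\<forall>i\<in>{1..n}. \<forall>y\<in>lead n i. ?A *\<^sub>v y \<in> lead n (m i))"
    unfolding Hess_def using flag_of_mat_in_flags[OF g] step by auto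
  also have "\<dots> \<longleftrightarrow> ?R"
  proof
    assume L: "\<forall>i\<in>{1..n}. \<forall>y\<in>lead n i. ?A *\<^sub>v y \<in> lead n (m i)"
    show ?R
    proof (intro allI impI)
      fix a b assume ab: "a < n" "b < n" "m (Suc b) \<le> a"
      have "unit_vec n b \<in> lead n (Suc b)" using ab by (auto simp: lead_def)
      then have "?A *\<^sub>v unit_vec n b \<in> lead n (m (Suc b))" using L ab by auto
      then have "col ?A b \<in> lead n (m (Suc b))" using mult_mat_vec_unit[OF A ab(2)] by simp
      then have "col ?A b $ a = 0" using ab by (simp add: lead_def)
      then show "?A $$ (a, b) = 0" using ab A by (simp del: index_mult_mat)
    qed
  next
    assume R: ?R
    show "\<forall>i\<in>{1..n}. \<forall>y\<in>lead n i. ?A *\<^sub>v y \<in> lead n (m i)"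
    proof (intro ballI)
      fix i y assume i: "i \<in> {1..n}" and y: "y \<in> lead n i"
      have yc: "y \<in> carrier_vec n" using y by (simp add: lead_def)
      have "(?A *\<^sub>v y) $ a = 0" if a: "a < n" "m i \<le> a" for a
      proof -
        have "(?A *\<^sub>v y) $ a = (\<Sum>l<n. ?A $$ (a, l) * y $ l)" by (rule mult_mat_vec_entry[OF A yc a(1)])
        also have "\<dots> = 0"
        proof (rule sum.neutral, rule ballI)
          fix l assume l: "l \<in> {..<n}"
          show "?A $$ (a, l) * y $ l = 0"
          proof (cases "l < i")
            case True
            then have "m (Suc l) \<le> m i" using m i l by (auto simp: hessenberg_vector_def)
            then have "?A $$ (a, l) = 0" using R a l by auto
            then show ?thesis by simp
          next
            case False then show ?thesis using y l by (simp add: lead_def)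
          qed
        qed
        finally show ?thesis .
      qed
      then show "?A *\<^sub>v y \<in> lead n (m i)" using A yc by (auto simp: lead_def)
    qed
  qed
  finally show ?thesis .
qed

text \<open>Sizes of independent sets are bounded by \<open>n\<close>, so there is a largest one
  between \<open>A0\<close> and \<open>W\<close>; a vector of \<open>W\<close> outside its span
  would enlarge it.\<close>

lemma subspace_basis_extension:
  fixes W :: "complex vec set"
  assumes W: "VectorSpace.subspace class_ring W (cspace n)"
    and A0: "A0 \<subseteq> W" "\<not> LinearCombinations.module.lin_dep class_ring (cspace n) A0"
  obtains A where "A0 \<subseteq> A" "A \<subseteq> W" "finite A" "cspan n A = W"
    "card A = vectorspace.dim class_ring (cspace n\<lparr>carrier := W\<rparr>)"
proof -
  interpret vec_space "TYPE(complex)" n .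
  have sub: "submodule class_ring W V" using W by (simp add: VectorSpace.subspace_def)
  then have Wc: "W \<subseteq> carrier_vec n" by (auto simp: submodule_def)
  let ?P = "\<lambda>A. A0 \<subseteq> A \<and> A \<subseteq> W \<and> lin_indpt A"
  have bound: "finite A \<and> card A \<le> n" if "?P A" for A
    using li_le_dim[OF fin_dim] that Wc dim_is_n by auto
  have "\<exists>A. ?P A \<and> (\<forall>B. ?P B \<longrightarrow> card B \<le> card A)"
    by (rule ex_has_greatest_nat[where b = "Suc n" and k = A0])
      (use A0 bound in \<open>auto simp: less_Suc_eq_le\<close>)
  then obtain A where A: "?P A" and max: "\<And>B. ?P B \<Longrightarrow> card B \<le> card A" by blast
  have Ac: "A \<subseteq> carrier_vec n" using A Wc by blast
  have span: "span A = W"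
  proof
    show "span A \<subseteq> W" using A sub by (intro span_is_subset) auto
    show "W \<subseteq> span A"
    proof
      fix v assume v: "v \<in> W"
      show "v \<in> span A"
      proof (rule ccontr)
        assume n: "v \<notin> span A"
        then have vA: "v \<notin> A" using in_own_span[of A] Ac by auto
        have "lin_indpt (A \<union> {v})"
          using lin_dep_iff_in_span[of A v] Ac A v Wc vA n by auto
        then have "card (A \<union> {v}) \<le> card A" using A v by (intro max) auto
        then show False using vA bound[OF A] by simp
      qed
    qed
  qed
  interpret w: vectorspace class_ring "vs W" by (rule subspace_is_vs[OF W])
  have "w.basis A"
    unfolding w.basis_def
    using span_li_not_depend[of A W] A sub span by auto
  then have "w.dim = card A" using bound[OF A] by (intro w.dim_basis) auto
  then show thesis using that[of A] A bound[OF A] span by auto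
qed

text \<open>A basis adapted to the flag grows by one vector of the next member outside the current
  one; independence and the number of vectors force the span to be the whole next member.\<close>

lemma flag_of_mat_surj:
  assumes Fl: "Fl \<in> flags n"
  obtains g where "g \<in> GL n" "flag_of_mat n g = Fl"
proof -
  interpret vec_space "TYPE(complex)" n .
  have sub: "VectorSpace.subspace class_ring (Fl i) (cspace n)"
    and dimV: "vectorspace.dim class_ring (cspace n\<lparr>carrier := Fl i\<rparr>) = i" if "i \<le> n" for i
    using Fl that by (auto simp: flags_def)
  have mono: "Fl i \<subseteq> Fl (Suc i)" if "i < n" for i using Fl that by (auto simp: flags_def)
  have Vc: "Fl i \<subseteq> carrier_vec n" if "i \<le> n" for i
    using sub[OF that] by (auto simp: VectorSpace.subspace_def submodule_def)
  have span_eq: "span A = Fl i" if A: "i \<le> n" "A \<subseteq> Fl i" "lin_indpt A" "finite A" "card A = i" for A i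
  proof -
    obtain B where B: "A \<subseteq> B" "finite B" "span B = Fl i" "card B = i"
      using subspace_basis_extension[OF sub[OF A(1)] A(2,3)] dimV[OF A(1)] A(5) by metis
    then have "A = B" using A card_subset_eq by metis
    then show ?thesis using B by simp
  qed
  have "\<exists>vs. length vs = k \<and> distinct vs \<and> set vs \<subseteq> Fl k \<and> lin_indpt (set vs) \<and>
      (\<forall>i\<le>k. span (set (take i vs)) = Fl i)" if "k \<le> n" for k
    using that
  proof (induction k)
    case 0
    have li: "lin_indpt {}" by (simp add: lin_dep_def)
    have "span {} = Fl 0" by (rule span_eq) (use li in auto)
    then show ?case using li by (intro exI[of _ "[]"]) simp
  next
    case (Suc k)
    then obtain vs where vs: "length vs = k" "distinct vs" "set vs \<subseteq> Fl k" "lin_indpt (set vs)"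
      "\<And>i. i \<le> k \<Longrightarrow> span (set (take i vs)) = Fl i" by auto
    have "Fl k \<noteq> Fl (Suc k)" using dimV[of k] dimV[of "Suc k"] Suc.prems by (metis Suc_leD n_not_Suc_n)
    then obtain v where v: "v \<in> Fl (Suc k)" "v \<notin> Fl k" using mono[of k] Suc.prems by auto
    have span_vs: "span (set vs) = Fl k" using vs(5)[of k] vs(1) by simp
    have vs_c: "set vs \<subseteq> carrier_vec n" using vs(3) Vc[of k] Suc.prems by auto
    have vn: "v \<notin> set vs" using v vs(3) by auto
    have li: "lin_indpt (set vs \<union> {v})"
      using lin_dep_iff_in_span[of "set vs" v] vs_c vs(4) v span_vs vn Vc[of "Suc k"] Suc.prems by auto
    have "span (set (vs @ [v])) = Fl (Suc k)"
      by (rule span_eq) (use Suc.prems vs v vn li mono[of k] in \<open>auto simp: distinct_card\<close>)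
    then have "span (set (take i (vs @ [v]))) = Fl i" if "i \<le> Suc k" for i
      using vs(5)[of i] vs(1) that by (cases "i = Suc k") auto
    then show ?case
      using vs v vn li mono[of k] Suc.prems by (intro exI[of _ "vs @ [v]"]) auto
  qed
  then obtain vs where vs: "length vs = n" "distinct vs" "set vs \<subseteq> Fl n" "lin_indpt (set vs)"
      "\<And>i. i \<le> n \<Longrightarrow> span (set (take i vs)) = Fl i" by blast
  define g where "g = mat_of_cols n vs"
  have g: "g \<in> carrier_mat n n" using vs(1) by (auto simp: g_def)
  have vs_c: "set vs \<subseteq> carrier_vec n" using vs(3) Vc[of n] by auto
  have cols: "cols g = vs" unfolding g_def by (rule cols_mat_of_cols[OF vs_c])
  have "rank g = n" by (rule lin_indpt_full_rank[OF g]) (use vs cols in auto)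
  then have gGL: "g \<in> GL n" using det_rank_iff[OF g] g by (simp add: GL_iff_det)
  have "flag_of_mat n g = Fl"
  proof
    fix i
    show "flag_of_mat n g i = Fl i"
    proof (cases "i \<le> n")
      case True
      have "(\<lambda>k. col g (k - 1)) ` {1..i} = set (take i vs)"
      proof -
        have "set (take i vs) = (!) vs ` {0..<i}" using True vs(1) by (simp add: nth_image)
        also have "\<dots> = (\<lambda>s. col g s) ` {0..<i}"
          by (rule image_cong) (use True vs(1) cols g in \<open>auto simp: cols_nth[symmetric]\<close>)
        also have "{0..<i} = (\<lambda>k. k - 1) ` {1..i}"
          by (auto simp: image_iff intro!: bexI[of _ "Suc _"])
        finally show ?thesis by (simp add: image_image)
      qed
      then show ?thesis using True vs(5)[OF True] by (simp add: flag_of_mat_def flag_spanned_by_def)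
    next
      case False
      then show ?thesis using Fl by (auto simp: flags_def extensional_def flag_of_mat_outside)
    qed
  qed
  then show thesis using gGL that by blast
qed

section \<open>Irreducible and dense sets of flags\<close>

lemma openin_GL_nonvanishing:
  assumes "\<And>f. f \<in> F \<Longrightarrow> poly_on n f"
  shows "openin (GL_zariski n) {g \<in> GL n. \<exists>f\<in>F. f g \<noteq> 0}"
proof -
  have "\<exists>h. h \<in> poly_fun n \<and> (\<forall>g\<in>carrier_mat n n. f g = h g)" if "f \<in> F" for f
    using assms[OF that] unfolding poly_on_def by auto
  then obtain H where H: "\<And>f. f \<in> F \<Longrightarrow> H f \<in> poly_fun n"
      "\<And>f g. f \<in> F \<Longrightarrow> g \<in> carrier_mat n n \<Longrightarrow> f g = H f g" by metis
  have "{g \<in> GL n. \<exists>f\<in>F. f g \<noteq> 0} = GL n - GL_zero_locus n (H ` F)"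
    using H(2) by (auto simp: GL_zero_locus_def GL_carrier)
  then show ?thesis unfolding openin_GL_zariski using H(1) by (intro exI[of _ "H ` F"]) auto
qed

lemma openin_GL_witness:
  assumes "openin (GL_zariski n) U" "g \<in> U"
  obtains f where "poly_on n f" "f g \<noteq> 0" "\<And>h. h \<in> GL n \<Longrightarrow> f h \<noteq> 0 \<Longrightarrow> h \<in> U"
proof -
  obtain F where F: "F \<subseteq> poly_fun n" "U = GL n - GL_zero_locus n F"
    using assms(1) unfolding openin_GL_zariski by blast
  then obtain f where f: "f \<in> F" "f g \<noteq> 0" using assms(2) by (auto simp: GL_zero_locus_def)
  show thesis
  proof (rule that[of f])
    show "poly_on n f" by (rule poly_onI[of f]) (use f F in auto)
    show "h \<in> U" if "h \<in> GL n" "f h \<noteq> 0" for h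
      using that f F by (auto simp: GL_zero_locus_def)
  qed (rule f)
qed

lemma closedin_flag_witness:
  assumes "closedin (flag_zariski n) C" "g \<in> GL n" "flag_of_mat n g \<notin> C"
  obtains f where "poly_on n f" "f g \<noteq> 0"
    "\<And>h. h \<in> GL n \<Longrightarrow> f h \<noteq> 0 \<Longrightarrow> flag_of_mat n h \<notin> C"
proof -
  have "openin (flag_zariski n) (flags n - C)"
    using assms(1) by (simp add: closedin_def)
  then have "openin (GL_zariski n) {g \<in> GL n. flag_of_mat n g \<in> flags n - C}"
    by (simp add: openin_flag_zariski)
  moreover have "g \<in> {g \<in> GL n. flag_of_mat n g \<in> flags n - C}"
    using assms flag_of_mat_in_flags by auto
  ultimately obtain f where "poly_on n f" "f g \<noteq> 0"
      "\<And>h. h \<in> GL n \<Longrightarrow> f h \<noteq> 0 \<Longrightarrow> h \<in> {g \<in> GL n. flag_of_mat n g \<in> flags n - C}"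
    using openin_GL_witness by blast
  then show thesis using that[of f] by auto
qed

text \<open>Two proper closed subsets are avoided on the nonvanishing loci of suitable polynomial
  functions, each meeting the preimage of \<open>Y\<close>; a common point of nonvanishing lies in
  neither subset.\<close>

lemma irreducible_flags_if_prime:
  assumes Y: "Y \<subseteq> flags n" "Y \<noteq> {}" and T: "prime_set n {g \<in> GL n. flag_of_mat n g \<in> Y}"
  shows "irreducible_space (subtopology (flag_zariski n) Y)"
  unfolding irreducible_space_def
proof (intro conjI allI impI)
  let ?X = "subtopology (flag_zariski n) Y"
  have top: "topspace ?X = Y" using Y(1) by auto
  show "topspace ?X \<noteq> {}" using Y(2) top by simp
  fix A B assume A: "closedin ?X A" and B: "closedin ?X B" and AB: "A \<union> B = topspace ?X"
  obtain A' B' where A': "closedin (flag_zariski n) A'" "A = A' \<inter> Y"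
    and B': "closedin (flag_zariski n) B'" "B = B' \<inter> Y"
    using A B unfolding closedin_subtopology by blast
  show "A = topspace ?X \<or> B = topspace ?X"
  proof (rule ccontr)
    assume "\<not> (A = topspace ?X \<or> B = topspace ?X)"
    then obtain V W where VW: "V \<in> Y" "V \<notin> A'" "W \<in> Y" "W \<notin> B'" using A'(2) B'(2) top by blast
    obtain g where g: "g \<in> GL n" "flag_of_mat n g = V" using flag_of_mat_surj VW(1) Y(1) by blast
    obtain h where h: "h \<in> GL n" "flag_of_mat n h = W" using flag_of_mat_surj VW(3) Y(1) by blast
    obtain f1 where f1: "poly_on n f1" "f1 g \<noteq> 0" "\<And>u. u \<in> GL n \<Longrightarrow> f1 u \<noteq> 0 \<Longrightarrow> flag_of_mat n u \<notin> A'"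
      using closedin_flag_witness[OF A'(1) g(1)] VW g by blast
    obtain f2 where f2: "poly_on n f2" "f2 h \<noteq> 0" "\<And>u. u \<in> GL n \<Longrightarrow> f2 u \<noteq> 0 \<Longrightarrow> flag_of_mat n u \<notin> B'"
      using closedin_flag_witness[OF B'(1) h(1)] VW h by blast
    have gh: "g \<in> {g \<in> GL n. flag_of_mat n g \<in> Y}" "h \<in> {g \<in> GL n. flag_of_mat n g \<in> Y}"
      using VW g h by auto
    obtain u where u: "u \<in> GL n" "flag_of_mat n u \<in> Y" "f1 u \<noteq> 0" "f2 u \<noteq> 0"
      using prime_setD[OF T f1(1) f2(1) gh(1) f1(2) gh(2) f2(2)] by blast
    then show False using f1(3) f2(3) AB A'(2) B'(2) top by blast
  qed
qed

lemma prime_set_Borel: "prime_set n (Borel n)"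
proof -
  have "Borel n = {g \<in> GL n. \<forall>i<n. \<forall>j<n. j < i \<longrightarrow> g $$ (i, j) = (\<lambda>i j. 0) i j}"
    by (auto simp: Borel_def)
  then show ?thesis using prime_set_affine[of n "\<lambda>i j. j < i" "\<lambda>i j. 0"] by simp
qed

text \<open>A polynomial function need not be constant on the fibres of the map to flags.
  Irreducibility of \<open>Y\<close> therefore yields only a flag in whose fibre neither function
  vanishes identically; irreducibility of the fibre, a coset of the Borel subgroup, then yields a
  common matrix.\<close>

lemma prime_if_irreducible_flags:
  assumes Y: "Y \<subseteq> flags n" and irr: "irreducible_space (subtopology (flag_zariski n) Y)"
  shows "prime_set n {g \<in> GL n. flag_of_mat n g \<in> Y}"
  unfolding prime_set_def
proof (intro conjI allI impI)
  let ?T = "{g \<in> GL n. flag_of_mat n g \<in> Y}" and ?X = "subtopology (flag_zariski n) Y"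
  have top: "topspace ?X = Y" using Y(1) by auto
  show "?T \<subseteq> carrier_mat n n" by (auto simp: GL_carrier)
  fix f h assume fh: "poly_on n f" "poly_on n h" and ex: "\<exists>s\<in>?T. f s \<noteq> 0" "\<exists>s\<in>?T. h s \<noteq> 0"
  \<comment> \<open>The flags whose entire fibre consists of zeros of \<open>f\<close>. The
    complement is open because its preimage is the union of the nonvanishing loci of
    \<open>f (g * b)\<close> over all \<open>b\<close> in the Borel subgroup.\<close>
  define Z where "Z f = {V \<in> flags n. \<forall>g\<in>GL n. flag_of_mat n g = V \<longrightarrow> f g = 0}" for f :: "complex mat \<Rightarrow> complex"
  have closed: "closedin (flag_zariski n) (Z f)" if f: "poly_on n f" for f
  proof -
    have "{g \<in> GL n. flag_of_mat n g \<in> flags n - Z f} = {g \<in> GL n. \<exists>\<phi>\<in>(\<lambda>b g. f (g * b)) ` Borel n. \<phi> g \<noteq> 0}"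
      (is "?L = ?R")
    proof (intro equalityI subsetI)
      fix g assume "g \<in> ?L"
      then obtain h where h: "g \<in> GL n" "h \<in> GL n" "flag_of_mat n h = flag_of_mat n g" "f h \<noteq> 0"
        by (auto simp: Z_def)
      then obtain b where "b \<in> Borel n" "h = g * b" using flag_of_mat_eqD[of g n h] by auto
      then show "g \<in> ?R" using h by auto
    next
      fix g assume "g \<in> ?R"
      then obtain b where b: "g \<in> GL n" "b \<in> Borel n" "f (g * b) \<noteq> 0" by auto
      moreover have "g * b \<in> GL n" using b by (simp add: GL_mult Borel_GL)
      ultimately show "g \<in> ?L"
        using flag_of_mat_Borel[OF b(1,2)] flag_of_mat_in_flags by (auto simp: Z_def)
    qed
    also have "openin (GL_zariski n) ?R"
      by (rule openin_GL_nonvanishing) (auto intro!: poly_on_right_mult[OF f] simp: Borel_GL GL_carrier)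
    finally have "openin (flag_zariski n) (flags n - Z f)" by (simp add: openin_flag_zariski)
    then show ?thesis by (simp add: closedin_def Z_def subset_iff)
  qed
  have ne: "Z f \<inter> Y \<noteq> Y" if "\<exists>s\<in>?T. f s \<noteq> 0" for f using that by (auto simp: Z_def)
  have "Z f \<inter> Y \<union> Z h \<inter> Y \<noteq> Y"
    using irr ne[OF ex(1)] ne[OF ex(2)] closed[OF fh(1)] closed[OF fh(2)] top
    unfolding irreducible_space_def closedin_subtopology by metis
  then obtain V where V: "V \<in> Y" "V \<notin> Z f" "V \<notin> Z h" by blast
  obtain g1 where g1: "g1 \<in> GL n" "flag_of_mat n g1 = V" "f g1 \<noteq> 0" using V Y by (auto simp: Z_def)
  obtain g2 where g2: "g2 \<in> GL n" "flag_of_mat n g2 = V" "h g2 \<noteq> 0" using V Y by (auto simp: Z_def)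
  have c1: "g1 \<in> carrier_mat n n" using g1 by (simp add: GL_carrier)
  obtain b2 where b2: "b2 \<in> Borel n" "g2 = g1 * b2" using flag_of_mat_eqD[of g1 n g2] g1 g2 by auto
  have one: "1\<^sub>m n \<in> Borel n" by (auto simp: Borel_def one_GL)
  obtain b where b: "b \<in> Borel n" "f (g1 * b) \<noteq> 0" "h (g1 * b) \<noteq> 0"
    using prime_setD[OF prime_set_Borel poly_on_left_mult[OF fh(1) c1] poly_on_left_mult[OF fh(2) c1] one _ b2(1)]
      g1 g2 b2 c1 by auto
  have "g1 * b \<in> ?T"
    using flag_of_mat_Borel[OF g1(1) b(1)] g1 V b by (simp add: GL_mult Borel_GL)
  then show "\<exists>s\<in>?T. f s \<noteq> 0 \<and> h s \<noteq> 0" using b by blast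
qed

text \<open>If the closure missed a flag of \<open>Y\<close>, some \<open>f\<close> nonzero at a
  matrix of that flag would be nonzero only off the closure. By irreducibility \<open>f\<close> and
  \<open>d\<close> are both nonzero at some point, whose flag is then in \<open>Q\<close>.\<close>

lemma closure_of_flags_dense:
  assumes Y: "closedin (flag_zariski n) Y" and T: "prime_set n {g \<in> GL n. flag_of_mat n g \<in> Y}"
    and Q: "Q \<subseteq> Y" and d: "poly_on n d" "g0 \<in> GL n" "flag_of_mat n g0 \<in> Y" "d g0 \<noteq> 0"
    and dQ: "\<And>g. g \<in> GL n \<Longrightarrow> flag_of_mat n g \<in> Y \<Longrightarrow> d g \<noteq> 0 \<Longrightarrow> flag_of_mat n g \<in> Q"
  shows "flag_zariski n closure_of Q = Y"
proof
  show "flag_zariski n closure_of Q \<subseteq> Y" by (rule closure_of_minimal[OF Q Y])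
  have Yf: "Y \<subseteq> flags n" using closedin_subset[OF Y] by simp
  show "Y \<subseteq> flag_zariski n closure_of Q"
  proof (rule subsetI, rule ccontr)
    fix V assume V: "V \<in> Y" "V \<notin> flag_zariski n closure_of Q"
    obtain g where g: "g \<in> GL n" "flag_of_mat n g = V" using flag_of_mat_surj V(1) Yf by blast
    obtain f where f: "poly_on n f" "f g \<noteq> 0"
        "\<And>u. u \<in> GL n \<Longrightarrow> f u \<noteq> 0 \<Longrightarrow> flag_of_mat n u \<notin> flag_zariski n closure_of Q"
      using closedin_flag_witness[OF closedin_closure_of g(1)] V(2) g(2) by blast
    have gg: "g \<in> {g \<in> GL n. flag_of_mat n g \<in> Y}" "g0 \<in> {g \<in> GL n. flag_of_mat n g \<in> Y}"
      using g V d by auto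
    obtain u where u: "u \<in> GL n" "flag_of_mat n u \<in> Y" "f u \<noteq> 0" "d u \<noteq> 0"
      using prime_setD[OF T f(1) d(1) gg(1) f(2) gg(2) d(4)] by blast
    have "Q \<subseteq> flag_zariski n closure_of Q" by (rule closure_of_subset) (use Q Yf in auto)
    then show False using dQ[OF u(1,2,4)] f(3)[OF u(1,3)] by blast
  qed
qed

text \<open>The entries of \<open>g\<^sup>-\<^sup>1 \<pi> g\<close>, where \<open>\<pi>\<close> is the projection onto the last \<open>q\<close> coordinates.\<close>

definition conj_proj :: "nat \<Rightarrow> nat \<Rightarrow> complex mat \<Rightarrow> nat \<Rightarrow> nat \<Rightarrow> complex" where
  "conj_proj p q g a b = (\<Sum>c<q. minv g $$ (a, p + c) * g $$ (p + c, b))"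

definition hess_mats :: "nat \<Rightarrow> nat \<Rightarrow> (nat \<Rightarrow> nat) \<Rightarrow> complex mat set" where
  "hess_mats p q m =
     {g \<in> GL (p + q). \<forall>a<p + q. \<forall>b<p + q. m (Suc b) \<le> a \<longrightarrow> conj_proj p q g a b = 0}"

lemma sum_split_at:
  fixes f :: "nat \<Rightarrow> complex"
  shows "(\<Sum>l<p + q. f l) = (\<Sum>l<p. f l) + (\<Sum>c<q. f (p + c))"
  by (induction q) (simp_all add: algebra_simps)

lemma x_mat_carrier: "x_mat p q l1 l2 \<in> carrier_mat (p + q) (p + q)"
  by (simp add: x_mat_def)

text \<open>\<open>x_mat\<close> is \<open>l1\<close> times the identity plus \<open>l2 - l1\<close>
  times the projection, so conjugation only has to be computed for the projection.\<close>

lemma conj_x_mat: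
  assumes g: "g \<in> GL (p + q)" and ab: "a < p + q" "b < p + q"
  shows "(minv g * x_mat p q l1 l2 * g) $$ (a, b) = (if a = b then l1 else 0) + (l2 - l1) * conj_proj p q g a b"
proof -
  let ?n = "p + q" and ?x = "x_mat p q l1 l2"
  have c: "g \<in> carrier_mat ?n ?n" "minv g \<in> carrier_mat ?n ?n" using g by (auto simp: GL_carrier minv_carrier)
  have x: "(minv g * ?x) $$ (a, l) = minv g $$ (a, l) * (if l < p then l1 else l2)" if "l < ?n" for l
    unfolding x_mat_def using mat_diag_mult_right[OF c(2)] that ab c by simp
  have "(minv g * ?x * g) $$ (a, b) = (\<Sum>l<?n. (minv g * ?x) $$ (a, l) * g $$ (l, b))"
    by (rule mult_mat_entry[of _ ?n ?n _ ?n]) (use c ab x_mat_carrier in auto)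
  also have "\<dots> = (\<Sum>l<?n. minv g $$ (a, l) * (if l < p then l1 else l2) * g $$ (l, b))"
    by (rule sum.cong) (use x in auto)
  also have "\<dots> = (\<Sum>l<p. minv g $$ (a, l) * l1 * g $$ (l, b))
      + (\<Sum>l<q. minv g $$ (a, p + l) * l2 * g $$ (p + l, b))"
    by (simp add: sum_split_at)
  also have "\<dots> = l1 * (\<Sum>l<?n. minv g $$ (a, l) * g $$ (l, b)) + (l2 - l1) * conj_proj p q g a b"
    unfolding sum_split_at conj_proj_def by (simp add: sum_distrib_left algebra_simps sum_subtractf)
  also have "(\<Sum>l<?n. minv g $$ (a, l) * g $$ (l, b)) = (if a = b then 1 else 0)"
    by (rule minv_mult_entry[OF g ab])
  finally show ?thesis by simp
qed

lemma flag_in_Hess_iff: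
  assumes g: "g \<in> GL (p + q)" and m: "hessenberg_vector (p + q) m" and l: "l1 \<noteq> l2"
  shows "flag_of_mat (p + q) g \<in> Hess (p + q) (x_mat p q l1 l2) m \<longleftrightarrow> g \<in> hess_mats p q m"
proof -
  have "(minv g * x_mat p q l1 l2 * g) $$ (a, b) = 0 \<longleftrightarrow> conj_proj p q g a b = 0"
    if "a < p + q" "b < p + q" "m (Suc b) \<le> a" for a b
  proof -
    \<comment> \<open>Constrained positions lie strictly below the diagonal, so the scalar part of
      \<open>x_mat\<close> never contributes.\<close>
    have "Suc b \<le> m (Suc b)" using m that(2) by (simp add: hessenberg_vector_def)
    then show ?thesis using conj_x_mat[OF g that(1,2), of l1 l2] l that(3) by auto
  qed
  then show ?thesis
    unfolding flag_of_mat_in_Hess[OF g x_mat_carrier m] hess_mats_def using g by auto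
qed

lemma hess_mats_preimage:
  assumes m: "hessenberg_vector (p + q) m" and l: "l1 \<noteq> l2"
  shows "{g \<in> GL (p + q). flag_of_mat (p + q) g \<in> Hess (p + q) (x_mat p q l1 l2) m} = hess_mats p q m"
  using flag_in_Hess_iff[OF _ m l] by (auto simp: hess_mats_def)

text \<open>\<open>conj_proj\<close> with denominators cleared: it is polynomial in \<open>g\<close>
  and has the same zeros on \<open>GL (p + q)\<close>.\<close>

definition adj_proj :: "nat \<Rightarrow> nat \<Rightarrow> complex mat \<Rightarrow> nat \<Rightarrow> nat \<Rightarrow> complex" where
  "adj_proj p q g a b = (\<Sum>c<q. adj_mat g $$ (a, p + c) * g $$ (p + c, b))"

lemma adj_mat_eq_minv:
  assumes "g \<in> GL n" "i < n" "j < n"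
  shows "adj_mat g $$ (i, j) = det g * minv g $$ (i, j)"
  using assms adj_mat(1)[of g n] by (auto simp: minv_def GL_iff_det)

lemma adj_proj_eq:
  assumes "g \<in> GL (p + q)" "a < p + q"
  shows "adj_proj p q g a b = det g * conj_proj p q g a b"
  unfolding adj_proj_def conj_proj_def sum_distrib_left
  by (rule sum.cong) (use assms adj_mat_eq_minv in auto)

lemma poly_on_adj_proj: "a < p + q \<Longrightarrow> b < p + q \<Longrightarrow> poly_on (p + q) (\<lambda>g. adj_proj p q g a b)"
  unfolding adj_proj_def
  by (intro poly_on_sum poly_on_mult poly_on_adj poly_on_entry) auto

lemma closedin_Hess:
  assumes m: "hessenberg_vector (p + q) m" and l: "l1 \<noteq> l2"
  shows "closedin (flag_zariski (p + q)) (Hess (p + q) (x_mat p q l1 l2) m)"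
proof -
  let ?n = "p + q" and ?H = "Hess (p + q) (x_mat p q l1 l2) m"
  let ?F = "{\<lambda>g. adj_proj p q g a b |a b. a < ?n \<and> b < ?n \<and> m (Suc b) \<le> a}"
  have "{g \<in> GL ?n. flag_of_mat ?n g \<in> flags ?n - ?H} = GL ?n - hess_mats p q m"
    using flag_in_Hess_iff[OF _ m l] flag_of_mat_in_flags by auto
  also have "\<dots> = {g \<in> GL ?n. \<exists>f\<in>?F. f g \<noteq> 0}"
  proof -
    have "adj_proj p q g a b \<noteq> 0 \<longleftrightarrow> conj_proj p q g a b \<noteq> 0" if "g \<in> GL ?n" "a < ?n" for g a b
      using adj_proj_eq[OF that] that by (simp add: GL_iff_det)
    then show ?thesis by (fastforce simp: hess_mats_def)
  qed
  also have "openin (GL_zariski ?n) \<dots>"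
    by (rule openin_GL_nonvanishing) (auto intro: poly_on_adj_proj)
  finally have "openin (flag_zariski ?n) (flags ?n - ?H)" by (simp add: openin_flag_zariski)
  moreover have "?H \<subseteq> flags ?n" by (auto simp: Hess_def)
  ultimately show ?thesis by (simp add: closedin_def)
qed

text \<open>With eigenvalues 0 and 1, \<open>x_mat\<close> is the projection itself, so that
  invariance under the centralizer follows from commutation of matrices.\<close>

lemma conj_proj_eq_conj_mat:
  assumes "g \<in> GL (p + q)" "a < p + q" "b < p + q"
  shows "(minv g * x_mat p q 0 1 * g) $$ (a, b) = conj_proj p q g a b"
  using conj_x_mat[OF assms, of 0 1] by simp

section \<open>Irreducibility of the Hessenberg varieties\<close>

definition block_group :: "nat \<Rightarrow> nat \<Rightarrow> complex mat set" where
  "block_group p q = {k \<in> GL (p + q). \<forall>i<p + q. \<forall>j<p + q. (i < p) \<noteq> (j < p) \<longrightarrow> k $$ (i, j) = 0}"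

text \<open>Entry by entry, commuting means that the row eigenvalue and the column eigenvalue agree
  wherever the entry is nonzero.\<close>

lemma GL_centralizer_x_mat:
  assumes "l1 \<noteq> l2"
  shows "GL_centralizer (p + q) (x_mat p q l1 l2) = block_group p q"
proof -
  let ?n = "p + q" and ?x = "x_mat p q l1 l2"
  have "k * ?x = ?x * k \<longleftrightarrow> (\<forall>i<?n. \<forall>j<?n. (i < p) \<noteq> (j < p) \<longrightarrow> k $$ (i, j) = 0)"
    if k: "k \<in> carrier_mat ?n ?n" for k
  proof -
    let ?l = "\<lambda>i. if i < p then l1 else l2"
    have "(k * ?x) $$ (i, j) = k $$ (i, j) * ?l j" "(?x * k) $$ (i, j) = ?l i * k $$ (i, j)"
      if "i < ?n" "j < ?n" for i j
      using that mat_diag_mult_right[OF k] mat_diag_mult_left[OF k] k by (auto simp: x_mat_def)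
    then have "k * ?x = ?x * k \<longleftrightarrow> (\<forall>i<?n. \<forall>j<?n. k $$ (i, j) * ?l j = ?l i * k $$ (i, j))"
      using k x_mat_carrier[of p q l1 l2] by (metis carrier_matD eq_matI index_mult_mat(2,3))
    then show ?thesis using assms by (auto split: if_splits)
  qed
  then show ?thesis unfolding GL_centralizer_def block_group_def using GL_carrier by blast
qed

lemma block_group_commute: "k \<in> block_group p q \<Longrightarrow> k * x_mat p q 0 1 = x_mat p q 0 1 * k"
  using GL_centralizer_x_mat[of 0 1 p q] by (auto simp: GL_centralizer_def)

lemma block_group_GL: "k \<in> block_group p q \<Longrightarrow> k \<in> GL (p + q)"
  by (simp add: block_group_def)

lemma minv_block_group:
  assumes k: "k \<in> block_group p q"
  shows "minv k \<in> block_group p q"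
proof -
  let ?n = "p + q" and ?x = "x_mat p q 0 1"
  have g: "k \<in> GL ?n" by (rule block_group_GL[OF k])
  have c: "k \<in> carrier_mat ?n ?n" "minv k \<in> carrier_mat ?n ?n" "?x \<in> carrier_mat ?n ?n"
    using g by (auto simp: GL_carrier minv_carrier x_mat_carrier)
  have "minv k * ?x = minv k * ?x * k * minv k"
    by (rule mult_minv_cancel_right(1)[OF g, symmetric]) (use c in auto)
  also have "\<dots> = minv k * (?x * k) * minv k"
    using c by (simp add: assoc_mult_mat[of _ ?n ?n _ ?n _ ?n])
  also have "\<dots> = minv k * (k * ?x) * minv k" using block_group_commute[OF k] by simp
  also have "\<dots> = ?x * minv k" using mult_minv_cancel(2)[OF g c(3)] by simp
  finally have "minv k \<in> GL_centralizer ?n ?x" using minv_GL[OF g] by (simp add: GL_centralizer_def)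
  then show ?thesis using GL_centralizer_x_mat[of 0 1 p q] by simp
qed

lemma block_group_mult:
  assumes "k \<in> block_group p q" "k' \<in> block_group p q"
  shows "k * k' \<in> block_group p q"
proof -
  let ?n = "p + q" and ?x = "x_mat p q 0 1"
  have c: "k \<in> carrier_mat ?n ?n" "k' \<in> carrier_mat ?n ?n" "?x \<in> carrier_mat ?n ?n"
    using assms by (auto simp: GL_carrier block_group_GL x_mat_carrier)
  have "k * k' * ?x = ?x * (k * k')"
    using block_group_commute[OF assms(1)] block_group_commute[OF assms(2)] c
    by (metis assoc_mult_mat)
  then have "k * k' \<in> GL_centralizer ?n ?x"
    using assms by (simp add: GL_centralizer_def GL_mult block_group_GL)
  then show ?thesis using GL_centralizer_x_mat[of 0 1 p q] by simp
qed

lemma conj_proj_block_mult: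
  assumes k: "k \<in> block_group p q" and g: "g \<in> GL (p + q)" and ab: "a < p + q" "b < p + q"
  shows "conj_proj p q (k * g) a b = conj_proj p q g a b"
proof -
  let ?n = "p + q" and ?x = "x_mat p q 0 1"
  have kg: "k \<in> GL ?n" by (rule block_group_GL[OF k])
  have c: "k \<in> carrier_mat ?n ?n" "minv k \<in> carrier_mat ?n ?n" "?x \<in> carrier_mat ?n ?n"
      "g \<in> carrier_mat ?n ?n" "minv g \<in> carrier_mat ?n ?n"
    using kg g by (auto simp: GL_carrier minv_carrier x_mat_carrier)
  have "minv (k * g) * ?x * (k * g) = minv g * (minv k * (?x * k)) * g"
    unfolding minv_prod[OF kg g] using c by (simp add: assoc_mult_mat[of _ ?n ?n _ ?n _ ?n])
  also have "\<dots> = minv g * ?x * g"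
    unfolding block_group_commute[OF k, symmetric] using mult_minv_cancel(2)[OF kg c(3)] by simp
  finally show ?thesis
    using conj_proj_eq_conj_mat[OF GL_mult[OF kg g] ab] conj_proj_eq_conj_mat[OF g ab] by simp
qed

lemma prime_set_block_group: "prime_set (p + q) (block_group p q)"
  using prime_set_affine[of "p + q" "\<lambda>i j. (i < p) \<noteq> (j < p)" "\<lambda>i j. 0"]
  by (simp add: block_group_def)

section \<open>Elementary 2 x 2 blocks\<close>

definition blk :: "nat \<Rightarrow> nat \<Rightarrow> complex \<Rightarrow> complex \<Rightarrow> complex \<Rightarrow> complex \<Rightarrow> complex mat" where
  "blk n j a b c d = mat n n (\<lambda>(r, s).
     if r = j \<and> s = j then a else if r = j \<and> s = Suc j then b
     else if r = Suc j \<and> s = j then c else if r = Suc j \<and> s = Suc j then d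
     else if r = s then 1 else 0)"

lemma blk_carrier [simp]: "blk n j a b c d \<in> carrier_mat n n"
  by (simp add: blk_def)

lemma mult_blk:
  assumes g: "g \<in> carrier_mat k n" and j: "Suc j < n" and r: "r < k" and s: "s < n"
  shows "(g * blk n j a b c d) $$ (r, s) =
    (if s = j then g $$ (r, j) * a + g $$ (r, Suc j) * c
     else if s = Suc j then g $$ (r, j) * b + g $$ (r, Suc j) * d else g $$ (r, s))"
proof -
  have "(g * blk n j a b c d) $$ (r, s) = (\<Sum>l<n. g $$ (r, l) * blk n j a b c d $$ (l, s))"
    by (rule mult_mat_entry[OF g _ r s]) simp
  also have "\<dots> = (\<Sum>l\<in>(if s = j \<or> s = Suc j then {j, Suc j} else {s}). g $$ (r, l) * blk n j a b c d $$ (l, s))"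
    by (rule sum.mono_neutral_right) (use j s in \<open>auto simp: blk_def\<close>)
  also have "\<dots> = (if s = j then g $$ (r, j) * a + g $$ (r, Suc j) * c
     else if s = Suc j then g $$ (r, j) * b + g $$ (r, Suc j) * d else g $$ (r, s))"
    using j s by (auto simp: blk_def)
  finally show ?thesis .
qed

lemma blk_mult:
  assumes g: "g \<in> carrier_mat n k" and j: "Suc j < n" and r: "r < n" and s: "s < k"
  shows "(blk n j a b c d * g) $$ (r, s) =
    (if r = j then a * g $$ (j, s) + b * g $$ (Suc j, s)
     else if r = Suc j then c * g $$ (j, s) + d * g $$ (Suc j, s) else g $$ (r, s))"
proof -
  have "(blk n j a b c d * g) $$ (r, s) = (\<Sum>l<n. blk n j a b c d $$ (r, l) * g $$ (l, s))"
    by (rule mult_mat_entry[OF _ g r s]) simp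
  also have "\<dots> = (\<Sum>l\<in>(if r = j \<or> r = Suc j then {j, Suc j} else {r}). blk n j a b c d $$ (r, l) * g $$ (l, s))"
    by (rule sum.mono_neutral_right) (use j r in \<open>auto simp: blk_def\<close>)
  also have "\<dots> = (if r = j then a * g $$ (j, s) + b * g $$ (Suc j, s)
     else if r = Suc j then c * g $$ (j, s) + d * g $$ (Suc j, s) else g $$ (r, s))"
    using j r by (auto simp: blk_def)
  finally show ?thesis .
qed

lemma blk_mult_blk:
  assumes j: "Suc j < n" and D: "a * d - b * c \<noteq> 0"
  shows "blk n j a b c d * blk n j (d / (a * d - b * c)) (- b / (a * d - b * c))
    (- c / (a * d - b * c)) (a / (a * d - b * c)) = 1\<^sub>m n" (is "?A * ?B = _")
proof (rule eq_matI)
  fix r s assume "r < dim_row (1\<^sub>m n :: complex mat)" "s < dim_col (1\<^sub>m n :: complex mat)"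
  then have rs: "r < n" "s < n" by auto
  show "(?A * ?B) $$ (r, s) = 1\<^sub>m n $$ (r, s)"
    unfolding blk_mult[OF blk_carrier j rs] using D rs j
    by (auto simp: blk_def divide_simps)
qed (simp_all add: blk_def)

text \<open>Right multiplication by these matrices mixes columns \<open>j\<close> and
  \<open>Suc j\<close>, so it changes only the flag member \<open>Suc j\<close>. Together with the
  Borel subgroup they generate a minimal parabolic subgroup.\<close>

definition blk_group :: "nat \<Rightarrow> nat \<Rightarrow> complex mat set" where
  "blk_group n j = {blk n j a b c d |a b c d. a * d - b * c \<noteq> 0}"

lemma blk_GL: "Suc j < n \<Longrightarrow> a * d - b * c \<noteq> 0 \<Longrightarrow> blk n j a b c d \<in> GL n"
  by (rule GL_I[OF _ _ blk_mult_blk]) simp_all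

lemma minv_blk:
  "Suc j < n \<Longrightarrow> a * d - b * c \<noteq> 0 \<Longrightarrow> minv (blk n j a b c d) =
    blk n j (d / (a * d - b * c)) (- b / (a * d - b * c)) (- c / (a * d - b * c)) (a / (a * d - b * c))"
  by (rule minv_unique[OF _ _ blk_mult_blk]) simp_all

lemma minv_blk_in_group:
  assumes "Suc j < n" "a * d - b * c \<noteq> 0"
  shows "minv (blk n j a b c d) \<in> blk_group n j"
proof -
  have "d / (a * d - b * c) * (a / (a * d - b * c)) - (- b / (a * d - b * c)) * (- c / (a * d - b * c))
      = 1 / (a * d - b * c)"
    using assms(2) by (simp add: divide_simps)
  then have "d / (a * d - b * c) * (a / (a * d - b * c)) - (- b / (a * d - b * c)) * (- c / (a * d - b * c)) \<noteq> 0"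
    using assms(2) by simp
  then show ?thesis unfolding blk_group_def minv_blk[OF assms] by blast
qed

lemma prime_set_blk_group:
  assumes j: "Suc j < n"
  shows "prime_set n (blk_group n j)"
proof (rule prime_set_line)
  let ?d = "\<lambda>g :: complex mat. g $$ (j, j) * g $$ (Suc j, Suc j) + (- 1) * (g $$ (j, Suc j) * g $$ (Suc j, j))"
  show "blk_group n j \<subseteq> carrier_mat n n" by (auto simp: blk_group_def)
  show "poly_on n ?d"
    using j by (intro poly_on_add poly_on_mult poly_on_const poly_on_entry) auto
  have dblk: "?d (blk n j a b c d) = a * d - b * c" for a b c d using j by (simp add: blk_def)
  show "?d g \<noteq> 0" if g: "g \<in> blk_group n j" for g
  proof -
    obtain a b c d where "g = blk n j a b c d" "a * d - b * c \<noteq> 0" using g by (auto simp: blk_group_def)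
    then show ?thesis using dblk[of a b c d] by simp
  qed
  fix g h t assume gh: "g \<in> blk_group n j" "h \<in> blk_group n j" and d: "?d (line_mat g h t) \<noteq> 0"
  obtain a b c d a' b' c' d' where e: "g = blk n j a b c d" "h = blk n j a' b' c' d'"
    using gh unfolding blk_group_def by blast
  have "line_mat g h t = blk n j (a + t * (a' - a)) (b + t * (b' - b)) (c + t * (c' - c)) (d + t * (d' - d))"
    unfolding e by (rule eq_matI) (auto simp: blk_def)
  then show "line_mat g h t \<in> blk_group n j"
    using d unfolding blk_group_def mem_Collect_eq by (metis dblk)
qed

text \<open>If \<open>F\<^sub>b\<close> is spanned by the first \<open>b\<close> basis vectors of the second eigenspace \<open>E\<^sub>2\<close> and \<open>s\<close>, \<open>e\<close> are
  increasing, then the conditions on the flag \<open>V\<close> of \<open>g\<close> are that \<open>V\<close> at index \<open>s b\<close> is contained in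
  \<open>E\<^sub>1 + F\<^sub>b\<close> and at index \<open>e b + 1\<close> contains \<open>F\<^sub>b\<^sub>+\<^sub>1\<close>.\<close>

definition shape_mats :: "nat \<Rightarrow> nat \<Rightarrow> (nat \<Rightarrow> nat) \<Rightarrow> (nat \<Rightarrow> nat) \<Rightarrow> complex mat set" where
  "shape_mats p q s e = {g \<in> GL (p + q). \<forall>b<q. \<forall>i<p + q.
     (i < s b \<longrightarrow> g $$ (p + b, i) = 0) \<and> (e b < i \<longrightarrow> minv g $$ (i, p + b) = 0)}"

lemma shape_matsI:
  assumes "g \<in> GL (p + q)"
    "\<And>b i. b < q \<Longrightarrow> i < p + q \<Longrightarrow> i < s b \<Longrightarrow> g $$ (p + b, i) = 0"
    "\<And>b i. b < q \<Longrightarrow> i < p + q \<Longrightarrow> e b < i \<Longrightarrow> minv g $$ (i, p + b) = 0"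
  shows "g \<in> shape_mats p q s e"
  using assms by (auto simp: shape_mats_def)

lemma shape_matsD:
  assumes "g \<in> shape_mats p q s e"
  shows "g \<in> GL (p + q)"
    "\<And>b i. b < q \<Longrightarrow> i < p + q \<Longrightarrow> i < s b \<Longrightarrow> g $$ (p + b, i) = 0"
    "\<And>b i. b < q \<Longrightarrow> i < p + q \<Longrightarrow> e b < i \<Longrightarrow> minv g $$ (i, p + b) = 0"
  using assms by (auto simp: shape_mats_def)

lemma shape_mats_cong:
  assumes "\<And>b. b < q \<Longrightarrow> s b = s' b" "\<And>b. b < q \<Longrightarrow> e b = e' b"
  shows "shape_mats p q s e = shape_mats p q s' e'"
  using assms by (auto simp: shape_mats_def)

text \<open>A line that contains \<open>u\<close> and is annihilated by \<open>v\<close>: spanned by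
  \<open>u\<close> itself if that is nonzero, otherwise by any nonzero vector orthogonal to
  \<open>v\<close>.\<close>

lemma exists_common_kernel_line:
  fixes u1 u2 :: complex
  assumes "v1 * u1 + v2 * u2 = 0"
  obtains w1 w2 where "(w1, w2) \<noteq> (0, 0)" "u1 * w2 = u2 * w1" "v1 * w1 + v2 * w2 = 0"
proof (cases "(u1, u2) = (0, 0)")
  case True
  show thesis
  proof (cases "(v1, v2) = (0, 0)")
    case True then show ?thesis using that[of 1 0] \<open>(u1, u2) = (0, 0)\<close> by simp
  next
    case False
    have "(v2, - v1) \<noteq> (0, 0)" using False by auto
    moreover have "v1 * v2 + v2 * - v1 = 0" by (simp add: algebra_simps)
    moreover have "u1 * - v1 = u2 * v2" using True by simp
    ultimately show ?thesis using that by blast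
  qed
next
  case False then show thesis using that[of u1 u2] assms by simp
qed

text \<open>If \<open>s b = j\<close> for some \<open>b \<noteq> a\<close>, the relevant parts of row \<open>p + b\<close> of \<open>g\<close> and of column \<open>p + a\<close> of its
  inverse live on the coordinates \<open>j\<close> and \<open>j + 1\<close>, where they are orthogonal; hence one change of basis
  in this plane shortens both supports.\<close>

lemma shape_mats_exchange:
  fixes s e :: "nat \<Rightarrow> nat"
  assumes j: "Suc j < p + q" and a: "a < q" "e a = Suc j"
    and s1: "\<And>b. b < q \<Longrightarrow> s b \<noteq> Suc j" and e1: "\<And>b. b < q \<Longrightarrow> e b \<noteq> j"
    and inj: "\<And>b b'. b < q \<Longrightarrow> b' < q \<Longrightarrow> s b = j \<Longrightarrow> s b' = j \<Longrightarrow> b = b'"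
  defines "s' \<equiv> \<lambda>b. if s b = j \<and> b \<noteq> a then Suc j else s b" and "e' \<equiv> e(a := j)"
  shows "shape_mats p q s e = {g * h |g h. g \<in> shape_mats p q s' e' \<and> h \<in> blk_group (p + q) j}"
proof (intro equalityI subsetI)
  let ?n = "p + q"
  fix g assume g: "g \<in> shape_mats p q s e"
  note gD = shape_matsD[OF g]
  have c: "g \<in> carrier_mat ?n ?n" "minv g \<in> carrier_mat ?n ?n" using gD(1) by (auto simp: GL_carrier minv_carrier)
  define u1 u2 where "u1 = minv g $$ (j, p + a)" and "u2 = minv g $$ (Suc j, p + a)"
  have rel: "g $$ (p + b, j) * u1 + g $$ (p + b, Suc j) * u2 = 0"
    if b: "b < q" "s b = j" "b \<noteq> a" for b
  proof -
    have "0 = (\<Sum>l<?n. g $$ (p + b, l) * minv g $$ (l, p + a))"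
      using mult_minv_entry[OF gD(1), of "p + b" "p + a"] b a by simp
    \<comment> \<open>Row \<open>p + b\<close> starts at \<open>j\<close> and column
      \<open>p + a\<close> of the inverse ends at \<open>Suc j\<close>, so only two summands
      survive.\<close>
    also have "\<dots> = (\<Sum>l\<in>{j, Suc j}. g $$ (p + b, l) * minv g $$ (l, p + a))"
    proof (rule sum.mono_neutral_right)
      show "\<forall>l\<in>{..<?n} - {j, Suc j}. g $$ (p + b, l) * minv g $$ (l, p + a) = 0"
      proof
        fix l assume l: "l \<in> {..<?n} - {j, Suc j}"
        then consider "l < j" | "Suc j < l" by force
        then show "g $$ (p + b, l) * minv g $$ (l, p + a) = 0"
          by cases (use l gD(2)[OF b(1), of l] gD(3)[OF a(1), of l] a b in auto)
      qed
    qed (use j in auto)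
    finally show ?thesis by (simp add: u1_def u2_def)
  qed
  \<comment> \<open>\<open>w\<close> becomes the first column of the block \<open>h\<close>. Being
    annihilated by row \<open>p + b\<close>, it clears the entry of that row at \<open>j\<close>;
    being proportional to \<open>u\<close>, it makes the second coordinate of \<open>u\<close> in
    the new basis vanish.\<close>
  obtain w1 w2 where w: "(w1, w2) \<noteq> (0, 0)" "u1 * w2 = u2 * w1"
    and wb: "\<And>b. b < q \<Longrightarrow> s b = j \<Longrightarrow> b \<noteq> a \<Longrightarrow> g $$ (p + b, j) * w1 + g $$ (p + b, Suc j) * w2 = 0"
  proof (cases "\<exists>b<q. s b = j \<and> b \<noteq> a")
    case True
    then obtain b where b: "b < q" "s b = j" "b \<noteq> a" by blast
    obtain w1 w2 where "(w1, w2) \<noteq> (0, 0)" "u1 * w2 = u2 * w1" "g $$ (p + b, j) * w1 + g $$ (p + b, Suc j) * w2 = 0"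
      using exists_common_kernel_line[OF rel[OF b]] by blast
    then show thesis using that[of w1 w2] inj b by metis
  next
    case False
    obtain w1 w2 where "(w1, w2) \<noteq> (0, 0)" "u1 * w2 = u2 * w1"
      using exists_common_kernel_line[of 0 u1 0 u2] by auto
    then show thesis using that[of w1 w2] False by blast
  qed
  \<comment> \<open>A unit vector that completes \<open>w\<close> to a basis of the plane.\<close>
  define x y where "x = (if w1 = 0 then 1 else 0 :: complex)" and "y = (if w1 = 0 then 0 else 1 :: complex)"
  define D where "D = w1 * y - x * w2"
  have D: "D \<noteq> 0" using w(1) by (auto simp: D_def x_def y_def)
  define h where "h = blk ?n j w1 x w2 y"
  have hGL: "h \<in> GL ?n" unfolding h_def by (rule blk_GL[OF j]) (use D D_def in simp)
  have mh: "minv h = blk ?n j (y / D) (- x / D) (- w2 / D) (w1 / D)"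
    unfolding h_def D_def by (rule minv_blk[OF j]) (use D D_def in simp)
  have "g * h \<in> shape_mats p q s' e'"
  proof (rule shape_matsI)
    show "g * h \<in> GL ?n" by (rule GL_mult[OF gD(1) hGL])
    fix b i assume b: "b < q" "i < ?n"
    show "(g * h) $$ (p + b, i) = 0" if i: "i < s' b"
    proof -
      have z: "g $$ (p + b, i') = 0" if "i' < s b" "i' < ?n" for i' using gD(2) b that by simp
      have e: "(g * h) $$ (p + b, i) = (if i = j then g $$ (p + b, j) * w1 + g $$ (p + b, Suc j) * w2
          else if i = Suc j then g $$ (p + b, j) * x + g $$ (p + b, Suc j) * y else g $$ (p + b, i))"
        unfolding h_def by (rule mult_blk[OF c(1) j]) (use b in auto)
      show ?thesis
      proof (cases "s b = j \<and> b \<noteq> a")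
        case True
        then have "i < Suc j" using i by (simp add: s'_def)
        then show ?thesis using e wb[OF b(1)] True z[of i] b j by (cases "i = j") auto
      next
        case False
        have "s' b = s b" unfolding s'_def by (rule if_not_P[OF False])
          then have i': "i < s b" using i by simp
        show ?thesis
        proof (cases "i = j \<or> i = Suc j")
          case True
          \<comment> \<open>No row starts at \<open>Suc j\<close>, so a row that has not started in
            one of the two mixed columns has started in neither. The hypothesis on \<open>e\<close>
            plays the same part for the columns of the inverse.\<close>
          then have "Suc j < s b" using i' s1[OF b(1)] by auto
          then show ?thesis using e z[of j] z[of "Suc j"] j True by auto
        next
          case False then show ?thesis using e z[OF i' b(2)] by auto
        qed
      qed
    qed
    show "minv (g * h) $$ (i, p + b) = 0" if i: "e' b < i"
    proof -
      have z: "minv g $$ (i', p + b) = 0" if "e b < i'" "i' < ?n" for i' using gD(3) b that by simp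
      have e: "minv (g * h) $$ (i, p + b) = (if i = j then y / D * minv g $$ (j, p + b) + - x / D * minv g $$ (Suc j, p + b)
          else if i = Suc j then - w2 / D * minv g $$ (j, p + b) + w1 / D * minv g $$ (Suc j, p + b)
          else minv g $$ (i, p + b))"
        unfolding minv_prod[OF gD(1) hGL] mh by (rule blk_mult[OF c(2) j]) (use b in auto)
      show ?thesis
      proof (cases "b = a")
        case True
        then have ij: "j < i" using i by (simp add: e'_def)
        show ?thesis
        proof (cases "i = Suc j")
          case True
          have "- w2 / D * u1 + w1 / D * u2 = 0" using w(2) by (simp add: field_simps)
          then show ?thesis using e True \<open>b = a\<close> by (simp add: u1_def u2_def)
        next
          case False
          then show ?thesis using e ij z[of i] a \<open>b = a\<close> b by auto
        qed
      next
        case False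
        then have eb: "e b < i" using i by (simp add: e'_def)
        show ?thesis
        proof (cases "i = j \<or> i = Suc j")
          case True
          then have "e b < j" using eb e1[OF b(1)] by auto
          then show ?thesis using e z[of j] z[of "Suc j"] j True by auto
        next
          case False then show ?thesis using e z[OF eb b(2)] by auto
        qed
      qed
    qed
  qed
  moreover have "minv h \<in> blk_group ?n j"
    unfolding h_def by (rule minv_blk_in_group[OF j]) (use D D_def in simp)
  moreover have "g = g * h * minv h" using mult_minv_cancel_right(1)[OF hGL c(1)] by simp
  ultimately show "g \<in> {g * h |g h. g \<in> shape_mats p q s' e' \<and> h \<in> blk_group ?n j}" by blast
next
  let ?n = "p + q"
  fix g' assume "g' \<in> {g * h |g h. g \<in> shape_mats p q s' e' \<and> h \<in> blk_group ?n j}"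
  then obtain g w1 x w2 y where g': "g' = g * blk ?n j w1 x w2 y" and g: "g \<in> shape_mats p q s' e'"
    and D: "w1 * y - x * w2 \<noteq> 0" unfolding blk_group_def by blast
  note gD = shape_matsD[OF g]
  have c: "g \<in> carrier_mat ?n ?n" "minv g \<in> carrier_mat ?n ?n" using gD(1) by (auto simp: GL_carrier minv_carrier)
  show "g' \<in> shape_mats p q s e"
    unfolding g'
  proof (rule shape_matsI)
    show "g * blk ?n j w1 x w2 y \<in> GL ?n" by (rule GL_mult[OF gD(1) blk_GL[OF j D]])
    fix b i assume b: "b < q" "i < ?n"
    show "(g * blk ?n j w1 x w2 y) $$ (p + b, i) = 0" if i: "i < s b"
    proof -
      have z: "g $$ (p + b, i') = 0" if "i' < s b" "i' < ?n" for i'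
        using gD(2)[OF b(1), of i'] that by (auto simp: s'_def split: if_splits)
      have "i = j \<or> i = Suc j \<Longrightarrow> Suc j < s b" using i s1[OF b(1)] by auto
      then show ?thesis using mult_blk[OF c(1) j, of "p + b" i w1 x w2 y] b z[OF i b(2)] z[of j] z[of "Suc j"] j by auto
    qed
    show "minv (g * blk ?n j w1 x w2 y) $$ (i, p + b) = 0" if i: "e b < i"
    proof -
      have z: "minv g $$ (i', p + b) = 0" if "e b < i'" "i' < ?n" for i'
        using gD(3)[OF b(1), of i'] that a by (cases "b = a") (auto simp: e'_def)
      have "i = j \<or> i = Suc j \<Longrightarrow> e b < j" using i e1[OF b(1)] by auto
      then show ?thesis
        unfolding minv_prod[OF gD(1) blk_GL[OF j D]] minv_blk[OF j D]
        using blk_mult[OF c(2) j, of i "p + b"] b z[OF i b(2)] z[of j] z[of "Suc j"] j by auto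
    qed
  qed
qed

lemma prime_set_shape_exchange:
  fixes s e :: "nat \<Rightarrow> nat"
  assumes j: "Suc j < p + q" and a: "a < q" "e a = Suc j"
    and s1: "\<And>b. b < q \<Longrightarrow> s b \<noteq> Suc j" and e1: "\<And>b. b < q \<Longrightarrow> e b \<noteq> j"
    and inj: "\<And>b b'. b < q \<Longrightarrow> b' < q \<Longrightarrow> s b = j \<Longrightarrow> s b' = j \<Longrightarrow> b = b'"
    and prime: "prime_set (p + q) (shape_mats p q (\<lambda>b. if s b = j \<and> b \<noteq> a then Suc j else s b) (e(a := j)))"
  shows "prime_set (p + q) (shape_mats p q s e)"
proof -
  have "shape_mats p q s e = {g * h |g h.
      g \<in> shape_mats p q (\<lambda>b. if s b = j \<and> b \<noteq> a then Suc j else s b) (e(a := j)) \<and> h \<in> blk_group (p + q) j}"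
    by (rule shape_mats_exchange) (fact j a s1 e1 inj)+
  then show ?thesis using prime_set_mult[OF prime prime_set_blk_group[OF j]] by simp
qed

text \<open>Column operations by an upper triangular \<open>B\<close> bring \<open>g\<close> to the
  form where row \<open>p + a\<close> and column \<open>s a\<close> are zero except for a 1 where
  they cross; the other entries are free. What remains is an affine slice of \<open>GL\<close> times
  the Borel subgroup.\<close>

lemma prime_set_shape_diagonal:
  assumes inj: "inj_on s {..<q}" and sn: "\<And>b. b < q \<Longrightarrow> s b < p + q"
  shows "prime_set (p + q) (shape_mats p q s s)"
proof -
  let ?n = "p + q"
  let ?L = "{l \<in> GL ?n. \<forall>i<?n. \<forall>j<?n. j \<in> s ` {..<q} \<or> p \<le> i \<longrightarrow>
    l $$ (i, j) = (if \<exists>a<q. j = s a \<and> i = p + a then 1 else 0)}"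
  have "shape_mats p q s s = {l * b |l b. l \<in> ?L \<and> b \<in> Borel ?n}"
  proof (intro equalityI subsetI)
    fix g assume g: "g \<in> shape_mats p q s s"
    note gD = shape_matsD[OF g]
    have c: "g \<in> carrier_mat ?n ?n" "minv g \<in> carrier_mat ?n ?n" using gD(1) by (auto simp: GL_carrier minv_carrier)
    \<comment> \<open>Column \<open>s a\<close> is chosen so that \<open>g * B\<close> has the unit
      vector of \<open>p + a\<close> there. In every other column, the last \<open>q\<close>
      coordinates of the column of \<open>g\<close> are subtracted by means of these
      vectors.\<close>
    define B where "B = mat ?n ?n (\<lambda>(i, j). if j \<in> s ` {..<q} then minv g $$ (i, p + the_inv_into {..<q} s j)
      else (if i = j then 1 else 0) - (\<Sum>b<q. g $$ (p + b, j) * minv g $$ (i, p + b)))"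
    have Bc: "B \<in> carrier_mat ?n ?n" by (simp add: B_def)
    have Bs: "B $$ (i, s a) = minv g $$ (i, p + a)" if "a < q" "i < ?n" for a i
      using that sn[of a] the_inv_into_f_f[OF inj, of a] by (simp add: B_def)
    have Bn: "B $$ (i, j) = (if i = j then 1 else 0) - (\<Sum>b<q. g $$ (p + b, j) * minv g $$ (i, p + b))"
      if "j \<notin> s ` {..<q}" "i < ?n" "j < ?n" for i j
      using that by (simp add: B_def)
    have vanish: "g $$ (p + b, j) * minv g $$ (i, p + b) = 0"
      if "j \<notin> s ` {..<q}" "j \<le> i" "i < ?n" "b < q" for i j b
    proof -
      have "j \<noteq> s b" using that by auto
      then show ?thesis using gD(2)[of b j] gD(3)[of b i] that by (cases "j < s b") auto
    qed
    have "B $$ (i, j) = 0" if ij: "j < i" "i < ?n" for i j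
    proof (cases "j \<in> s ` {..<q}")
      case True
      then show ?thesis using Bs gD(3) ij by auto
    next
      case False
      then show ?thesis using Bn[OF False, of i] vanish[OF False, of i] ij by simp
    qed
    moreover have "B $$ (i, i) \<noteq> 0" if i: "i < ?n" for i
    proof (cases "i \<in> s ` {..<q}")
      case True
      then obtain a where a: "a < q" "i = s a" by auto
      have "1 = (\<Sum>l<?n. g $$ (p + a, l) * minv g $$ (l, p + a))"
        using mult_minv_entry[OF gD(1), of "p + a" "p + a"] a by simp
      also have "\<dots> = (\<Sum>l\<in>{s a}. g $$ (p + a, l) * minv g $$ (l, p + a))"
      proof (rule sum.mono_neutral_right)
        show "\<forall>l\<in>{..<?n} - {s a}. g $$ (p + a, l) * minv g $$ (l, p + a) = 0"
          using gD(2,3) a(1) by (auto simp: neq_iff)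
      qed (use sn a in auto)
      finally have "minv g $$ (s a, p + a) \<noteq> 0" by auto
      then show ?thesis using Bs[OF a(1), of "s a"] a i by simp
    next
      case False
      then show ?thesis using Bn[OF False i i] vanish[OF False _ i, of ] by simp
    qed
    ultimately have B: "B \<in> Borel ?n" using Borel_iff_diag[OF Bc] by blast
    have "g * B \<in> ?L"
    proof (intro CollectI conjI allI impI)
      show "g * B \<in> GL ?n" by (rule GL_mult[OF gD(1) Borel_GL[OF B]])
      fix i j assume ij: "i < ?n" "j < ?n" "j \<in> s ` {..<q} \<or> p \<le> i"
      have m: "(g * B) $$ (i, j) = (\<Sum>l<?n. g $$ (i, l) * B $$ (l, j))"
        by (rule mult_mat_entry[OF c(1) Bc ij(1,2)])
      show "(g * B) $$ (i, j) = (if \<exists>a<q. j = s a \<and> i = p + a then 1 else 0)"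
      proof (cases "j \<in> s ` {..<q}")
        case True
        then obtain a where a: "a < q" "j = s a" by auto
        have "(g * B) $$ (i, j) = (\<Sum>l<?n. g $$ (i, l) * minv g $$ (l, p + a))"
          unfolding m by (rule sum.cong) (use Bs a in auto)
        also have "\<dots> = (if i = p + a then 1 else 0)"
          using mult_minv_entry[OF gD(1) ij(1), of "p + a"] a by simp
        also have "\<dots> = (if \<exists>a<q. j = s a \<and> i = p + a then 1 else 0)"
          using a inj by (auto dest: inj_onD)
        finally show ?thesis .
      next
        case False
        then obtain b where b: "b < q" "i = p + b" using ij by (metis add_less_cancel_left le_Suc_ex)
        have "(g * B) $$ (i, j) = (\<Sum>l<?n. g $$ (i, l) * (if l = j then 1 else 0))
            - (\<Sum>l<?n. \<Sum>b'<q. g $$ (p + b', j) * (g $$ (i, l) * minv g $$ (l, p + b')))"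
          unfolding m sum_subtractf[symmetric]
          by (rule sum.cong) (simp_all add: Bn[OF False _ ij(2)] right_diff_distrib sum_distrib_left mult.left_commute)
        also have "(\<Sum>l<?n. \<Sum>b'<q. g $$ (p + b', j) * (g $$ (i, l) * minv g $$ (l, p + b')))
            = (\<Sum>b'<q. g $$ (p + b', j) * (\<Sum>l<?n. g $$ (i, l) * minv g $$ (l, p + b')))"
          by (subst sum.swap) (simp add: sum_distrib_left)
        also have "\<dots> = (\<Sum>b'<q. g $$ (p + b', j) * (if b = b' then 1 else 0))"
          by (rule sum.cong) (use mult_minv_entry[OF gD(1) ij(1)] b in auto)
        also have "\<dots> = g $$ (i, j)" using b by (simp add: if_distrib cong: if_cong)
        also have "(\<Sum>l<?n. g $$ (i, l) * (if l = j then 1 else 0)) = g $$ (i, j)"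
          using ij by (simp add: if_distrib cong: if_cong)
        finally show ?thesis using False by auto
      qed
    qed
    moreover have "g = g * B * minv B" using mult_minv_cancel_right(1)[OF Borel_GL[OF B] c(1)] by simp
    ultimately show "g \<in> {l * b |l b. l \<in> ?L \<and> b \<in> Borel ?n}" using minv_Borel[OF B] by blast
  next
    fix g assume "g \<in> {l * b |l b. l \<in> ?L \<and> b \<in> Borel ?n}"
    then obtain l b where g: "g = l * b" and l: "l \<in> ?L" and b: "b \<in> Borel ?n" by blast
    have lGL: "l \<in> GL ?n" and lv: "\<And>i j. i < ?n \<Longrightarrow> j < ?n \<Longrightarrow> j \<in> s ` {..<q} \<or> p \<le> i \<Longrightarrow>
      l $$ (i, j) = (if \<exists>a<q. j = s a \<and> i = p + a then 1 else 0)" using l by auto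
    have bGL: "b \<in> GL ?n" by (rule Borel_GL[OF b])
    have c: "l \<in> carrier_mat ?n ?n" "minv l \<in> carrier_mat ?n ?n" "b \<in> carrier_mat ?n ?n" "minv b \<in> carrier_mat ?n ?n"
      using lGL bGL by (auto simp: GL_carrier minv_carrier)
    have col: "l $$ (i, s a) = (if i = p + a then 1 else 0)" if "a < q" "i < ?n" for a i
      using lv[OF that(2) sn[OF that(1)]] that inj by (auto dest: inj_onD)
    have row: "l $$ (p + a, j) = (if j = s a then 1 else 0)" if "a < q" "j < ?n" for a j
      using lv[of "p + a" j] that by auto
    have ml: "minv l $$ (i, p + a) = (if i = s a then 1 else 0)" if "a < q" "i < ?n" for a i
    proof -
      have "(if i = s a then 1 else 0) = (\<Sum>k<?n. minv l $$ (i, k) * l $$ (k, s a))"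
        using minv_mult_entry[OF lGL that(2) sn[OF that(1)]] by simp
      also have "\<dots> = (\<Sum>k<?n. minv l $$ (i, k) * (if k = p + a then 1 else 0))"
        by (rule sum.cong) (use col that in auto)
      also have "\<dots> = minv l $$ (i, p + a)" using that by (simp add: if_distrib cong: if_cong)
      finally show ?thesis by simp
    qed
    show "g \<in> shape_mats p q s s"
      unfolding g
    proof (rule shape_matsI)
      show "l * b \<in> GL ?n" by (rule GL_mult[OF lGL bGL])
      fix a i assume ai: "a < q" "i < ?n"
      show "(l * b) $$ (p + a, i) = 0" if i: "i < s a"
      proof -
        have "(l * b) $$ (p + a, i) = (\<Sum>k<?n. l $$ (p + a, k) * b $$ (k, i))"
          by (rule mult_mat_entry[OF c(1,3)]) (use ai in auto)
        also have "\<dots> = (\<Sum>k<?n. (if k = s a then b $$ (k, i) else 0))"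
          by (rule sum.cong) (use row ai in auto)
        also have "\<dots> = b $$ (s a, i)" using sn[OF ai(1)] by simp
        finally show ?thesis using BorelD[OF b i sn[OF ai(1)]] by simp
      qed
      show "minv (l * b) $$ (i, p + a) = 0" if i: "s a < i"
      proof -
        have "minv (l * b) $$ (i, p + a) = (\<Sum>k<?n. minv b $$ (i, k) * minv l $$ (k, p + a))"
          unfolding minv_prod[OF lGL bGL] by (rule mult_mat_entry[OF c(4,2)]) (use ai in auto)
        also have "\<dots> = (\<Sum>k<?n. (if k = s a then minv b $$ (i, k) else 0))"
          by (rule sum.cong) (use ml ai in auto)
        also have "\<dots> = minv b $$ (i, s a)" using sn[OF ai(1)] by simp
        finally show ?thesis using BorelD[OF minv_Borel[OF b] i ai(2)] by simp
      qed
    qed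
  qed
  then show ?thesis
    using prime_set_mult[OF prime_set_affine[of ?n "\<lambda>i j. j \<in> s ` {..<q} \<or> p \<le> i"
      "\<lambda>i j. if \<exists>a<q. j = s a \<and> i = p + a then 1 else 0"] prime_set_Borel[of ?n]] by simp
qed

text \<open>The first end that exceeds its start moves down by one, and a start in its way moves up
  to the place thus freed. The invariant that a start meets only its own end keeps the old place
  free of starts; strict monotonicity and the minimal choice keep the new place free of ends. The
  sum of the ends decreases until starts and ends agree.\<close>

lemma prime_set_shape_strict:
  assumes "\<And>b. b < q \<Longrightarrow> s b \<le> e b" "\<And>b. b < q \<Longrightarrow> e b < p + q"
    "\<And>b b'. b < b' \<Longrightarrow> b' < q \<Longrightarrow> s b < s b'" "\<And>b b'. b < b' \<Longrightarrow> b' < q \<Longrightarrow> e b < e b'"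
    "\<And>b b'. b < q \<Longrightarrow> b' < q \<Longrightarrow> s b = e b' \<Longrightarrow> b = b'"
  shows "prime_set (p + q) (shape_mats p q s e)"
  using assms
proof (induction "\<Sum>b<q. e b" arbitrary: s e rule: less_induct)
  case less
  note se = less.prems(1) and en = less.prems(2) and smono = less.prems(3) and emono = less.prems(4)
    and sep = less.prems(5)
  have sinj: "b = b'" if "b < q" "b' < q" "s b = s b'" for b b'
    using smono[of b b'] smono[of b' b] that by (metis less_irrefl nat_neq_iff)
  have einj: "b = b'" if "b < q" "b' < q" "e b = e b'" for b b'
    using emono[of b b'] emono[of b' b] that by (metis less_irrefl nat_neq_iff)
  show ?case
  proof (cases "\<forall>b<q. s b = e b")
    case True
    have "shape_mats p q s e = shape_mats p q s s" by (rule shape_mats_cong) (use True in auto)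
    then show ?thesis
      using prime_set_shape_diagonal[of s q p] sinj se en by (force simp: inj_on_def)
  next
    case False
    define a where "a = (LEAST b. b < q \<and> s b < e b)"
    have "\<exists>b. b < q \<and> s b < e b" using False se by (metis le_neq_implies_less)
    then have a: "a < q" "s a < e a" unfolding a_def by (metis (mono_tags, lifting) LeastI_ex)+
    have amin: "s b = e b" if "b < a" for b
      using not_less_Least[of b "\<lambda>b. b < q \<and> s b < e b"] that a se[of b] unfolding a_def by force
    obtain j where j: "e a = Suc j" using a by (cases "e a") auto
    have s1: "s b \<noteq> Suc j" if "b < q" for b using sep[of b a] that a j by auto
    have elow: "e b < j" if "b < a" for b using amin[OF that] smono[OF that a(1)] a j by simp
    have e1: "e b \<noteq> j" if "b < q" for b
      using elow[of b] emono[of a b] that j by (cases b a rule: linorder_cases) auto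
    have above: "Suc j < e b" if "a < b" "b < q" for b using emono[OF that] j by simp
    let ?s = "\<lambda>b. if s b = j \<and> b \<noteq> a then Suc j else s b" and ?e = "e(a := j)"
    show ?thesis
    proof (rule prime_set_shape_exchange[of j p q a e s])
      show "Suc j < p + q" using en[OF a(1)] j by simp
      show "prime_set (p + q) (shape_mats p q ?s ?e)"
      proof (rule less.hyps)
        show "(\<Sum>b<q. ?e b) < (\<Sum>b<q. e b)"
          by (rule sum_strict_mono_ex1) (use a j in auto)
        show "?s b \<le> ?e b" if "b < q" for b
        proof (cases "b = a")
          case True then show ?thesis using a j by simp
        next
          case False
          then show ?thesis
            using above[of b] elow[of b] amin[of b] se[OF that] that by (cases b a rule: linorder_cases) auto
        qed
        show "?e b < p + q" if "b < q" for b using en[OF that] j by auto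
        show "?s b < ?s b'" if b: "b < b'" "b' < q" for b b'
          using smono[OF b] s1[OF b(2)] sinj[of b b'] b by auto
        show "?e b < ?e b'" if b: "b < b'" "b' < q" for b b'
          using emono[OF b] elow[of b] above[of b'] b j by auto
        show "b = b'" if b: "b < q" "b' < q" "?s b = ?e b'" for b b'
        proof (cases "b' = a")
          case True then show ?thesis using b by (auto split: if_splits)
        next
          case False
          then have "?s b = e b'" using b by simp
          then show ?thesis using sep[of b b'] einj[of b' a] b a j False by (auto split: if_splits)
        qed
      qed
    qed (use a j s1 e1 sinj in auto)
  qed
qed

text \<open>Here the ends are only lowered to \<open>p + b\<close>, after which they increase
  strictly. The place below the first end that is too high is free: earlier ends
  \<open>p + b\<close> lie below it, later ends above it. Starts are less than
  \<open>q \<le> p\<close> and stay out of the way.\<close>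

lemma prime_set_shape:
  assumes "q \<le> p" "\<And>b. b < q \<Longrightarrow> p + b \<le> e b" "\<And>b. b < q \<Longrightarrow> e b < p + q"
    "\<And>b b'. b < b' \<Longrightarrow> b' < q \<Longrightarrow> e b \<le> e b'"
  shows "prime_set (p + q) (shape_mats p q (\<lambda>b. b) e)"
  using assms
proof (induction "\<Sum>b<q. e b" arbitrary: e rule: less_induct)
  case less
  note low = less.prems(2) and en = less.prems(3) and emono = less.prems(4)
  show ?case
  proof (cases "\<forall>b<q. e b = p + b")
    case True
    then show ?thesis by (intro prime_set_shape_strict) (use less.prems(1) in auto)
  next
    case False
    define a where "a = (LEAST b. b < q \<and> p + b < e b)"
    have "\<exists>b. b < q \<and> p + b < e b" using False low by (metis le_neq_implies_less)
    then have a: "a < q" "p + a < e a" unfolding a_def by (metis (mono_tags, lifting) LeastI_ex)+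
    have amin: "e b = p + b" if "b < a" for b
      using not_less_Least[of b "\<lambda>b. b < q \<and> p + b < e b"] that a low[of b] unfolding a_def by force
    obtain j where j: "e a = Suc j" using a by (cases "e a") auto
    have e1: "e b \<noteq> j" if "b < q" for b
      using amin[of b] emono[of a b] that a j by (cases b a rule: linorder_cases) auto
    let ?s = "\<lambda>b. if b = j \<and> b \<noteq> a then Suc j else b" and ?e = "e(a := j)"
    show ?thesis
    proof (rule prime_set_shape_exchange[of j p q a e])
      show "Suc j < p + q" using en[OF a(1)] j by simp
      have "prime_set (p + q) (shape_mats p q (\<lambda>b. b) ?e)"
      proof (rule less.hyps)
        show "(\<Sum>b<q. ?e b) < (\<Sum>b<q. e b)"
          by (rule sum_strict_mono_ex1) (use a j in auto)
        show "p + b \<le> ?e b" if "b < q" for b using low[OF that] a j by auto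
        show "?e b < p + q" if "b < q" for b using en[OF that] j by auto
        show "?e b \<le> ?e b'" if b: "b < b'" "b' < q" for b b'
          using emono[OF b] amin[of b] b j a by auto
      qed (rule less.prems(1))
      moreover have "shape_mats p q ?s ?e = shape_mats p q (\<lambda>b. b) ?e"
        by (rule shape_mats_cong) (use a j less.prems(1) in auto)
      ultimately show "prime_set (p + q) (shape_mats p q ?s ?e)" by simp
    qed (use a j e1 less.prems(1) in auto)
  qed
qed

text \<open>\<open>u\<close> sends basis vector \<open>k\<close> of \<open>E\<^sub>2\<close> to
  \<open>z\<close>, basis vector \<open>l\<close> (if different) to basis vector \<open>k\<close>,
  and fixes all others. So the next member of the flag of \<open>E\<^sub>2\<close> can be made to
  contain \<open>z\<close> without disturbing the first \<open>k\<close> basis vectors.\<close>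

lemma block_change_of_basis:
  fixes z :: "nat \<Rightarrow> complex"
  assumes kl: "k \<le> l" "l < q" and z: "z l \<noteq> 0"
  obtains u where "u \<in> block_group p q"
    "\<And>v r. r < p + q \<Longrightarrow> (\<Sum>c<p + q. u $$ (r, c) * v c) =
      (if p \<le> r then z (r - p) * v (p + k) else 0) + (if l \<noteq> k \<and> r = p + k then v (p + l) else 0)
      + (if r \<noteq> p + k \<and> r \<noteq> p + l then v r else 0)"
    "\<And>v. (\<Sum>r<p + q. v r * u $$ (r, p + k)) = (\<Sum>c<q. v (p + c) * z c)"
    "\<And>v a. a < k \<Longrightarrow> (\<Sum>r<p + q. v r * u $$ (r, p + a)) = v (p + a)"
proof -
  let ?n = "p + q"
  define K L where "K = p + k" and "L = p + l"
  define u where "u = mat ?n ?n (\<lambda>(r, c). if c = K then (if p \<le> r then z (r - p) else 0)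
     else if c = L then (if r = K then 1 else 0) else if r = c then 1 else 0)"
  have KL: "K < ?n" "L < ?n" using kl by (auto simp: K_def L_def)
  have uc: "u \<in> carrier_mat ?n ?n" by (simp add: u_def)
  have row: "(\<Sum>c<?n. u $$ (r, c) * v c) = (if p \<le> r then z (r - p) * v K else 0)
      + (if l \<noteq> k \<and> r = K then v L else 0) + (if r \<noteq> K \<and> r \<noteq> L then v r else 0)" if r: "r < ?n" for v r
  proof -
    have "(\<Sum>c<?n. u $$ (r, c) * v c) = (\<Sum>c<?n. (if c = K then (if p \<le> r then z (r - p) * v K else 0) else 0)
        + (if c = L then (if l \<noteq> k \<and> r = K then v L else 0) else 0)
        + (if c = r then (if r \<noteq> K \<and> r \<noteq> L then v r else 0) else 0))"
      by (rule sum.cong) (use r in \<open>auto simp: u_def K_def L_def\<close>)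
    also have "\<dots> = (if p \<le> r then z (r - p) * v K else 0)
      + (if l \<noteq> k \<and> r = K then v L else 0) + (if r \<noteq> K \<and> r \<noteq> L then v r else 0)"
      using KL r by (simp add: sum.distrib)
    finally show ?thesis .
  qed
  have "det u \<noteq> 0"
  proof
    assume "det u = 0"
    then obtain v where v: "\<And>i. i < ?n \<Longrightarrow> (\<Sum>c<?n. u $$ (i, c) * v c) = 0" "\<exists>c<?n. v c \<noteq> 0"
      using singular_imp_kernel[OF uc] by blast
    have vK: "v K = 0"
      using v(1)[OF KL(2)] row[OF KL(2), of v] z by (auto simp: K_def L_def split: if_splits)
    have vL: "v L = 0"
      using v(1)[OF KL(1)] row[OF KL(1), of v] vK by (auto simp: K_def L_def split: if_splits)
    have "v r = 0" if "r < ?n" for r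
      using v(1)[OF that] row[OF that, of v] vK vL by (auto split: if_splits)
    then show False using v(2) by blast
  qed
  then have uGL: "u \<in> GL ?n" using uc by (simp add: GL_iff_det)
  show thesis
  proof (rule that[of u])
    show "u \<in> block_group p q"
      unfolding block_group_def using uGL by (auto simp: u_def K_def L_def)
    show "(\<Sum>c<?n. u $$ (r, c) * v c) =
      (if p \<le> r then z (r - p) * v (p + k) else 0) + (if l \<noteq> k \<and> r = p + k then v (p + l) else 0)
      + (if r \<noteq> p + k \<and> r \<noteq> p + l then v r else 0)" if "r < ?n" for v r
      using row[OF that, of v] by (simp add: K_def L_def)
    show "(\<Sum>r<?n. v r * u $$ (r, p + k)) = (\<Sum>c<q. v (p + c) * z c)" for v
      unfolding sum_split_at using KL by (simp add: u_def K_def)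
    show "(\<Sum>r<?n. v r * u $$ (r, p + a)) = v (p + a)" if a: "a < k" for v a
    proof -
      have "(\<Sum>r<?n. v r * u $$ (r, p + a)) = (\<Sum>r<?n. if r = p + a then v r else 0)"
        by (rule sum.cong) (use a kl in \<open>auto simp: u_def K_def L_def\<close>)
      then show ?thesis using a kl by simp
    qed
  qed
qed

text \<open>In terms of flags: there is a complete flag \<open>F\<close> of the second eigenspace such that \<open>F\<^sub>i\<close>
  contains the projection of \<open>V\<^sub>i\<close> and is contained in \<open>V\<close> at index \<open>m i\<close>. Its members are
  chosen one by one.\<close>

lemma hess_mats_interpolation:
  assumes m: "hessenberg_vector (p + q) m" and low: "\<And>b. b < q \<Longrightarrow> p + b < m (Suc b)"
    and g: "g \<in> hess_mats p q m" and k: "k \<le> q"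
  shows "\<exists>\<kappa>\<in>block_group p q.
    (\<forall>a<k. \<forall>i<p + q. m (Suc a) \<le> i \<longrightarrow> minv (\<kappa> * g) $$ (i, p + a) = 0) \<and>
    (\<forall>j<k. \<forall>b<q. j < b \<longrightarrow> (\<kappa> * g) $$ (p + b, j) = 0)"
  using k
proof (induction k)
  case 0
  have "1\<^sub>m (p + q) \<in> block_group p q" by (auto simp: block_group_def one_GL)
  then show ?case by blast
next
  case (Suc k)
  let ?n = "p + q"
  have kq: "k < q" using Suc.prems by simp
  have gGL: "g \<in> GL ?n" using g by (simp add: hess_mats_def)
  obtain \<kappa> where \<kappa>: "\<kappa> \<in> block_group p q"
    and \<kappa>C: "\<And>a i. a < k \<Longrightarrow> i < ?n \<Longrightarrow> m (Suc a) \<le> i \<Longrightarrow> minv (\<kappa> * g) $$ (i, p + a) = 0"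
    and \<kappa>D: "\<And>j b. j < k \<Longrightarrow> b < q \<Longrightarrow> j < b \<Longrightarrow> (\<kappa> * g) $$ (p + b, j) = 0"
    using Suc by auto
  define s where "s = \<kappa> * g"
  have sGL: "s \<in> GL ?n" unfolding s_def by (rule GL_mult[OF block_group_GL[OF \<kappa>] gGL])
  have sc: "s \<in> carrier_mat ?n ?n" "minv s \<in> carrier_mat ?n ?n" using sGL by (auto simp: GL_carrier minv_carrier)
  have sT: "conj_proj p q s i k = 0" if "i < ?n" "m (Suc k) \<le> i" for i
    unfolding s_def using conj_proj_block_mult[OF \<kappa> gGL that(1), of k] g that kq by (simp add: hess_mats_def)
  \<comment> \<open>The new member of the flag is spanned by the previous one and \<open>z\<close>:
    \<open>zC\<close> says that \<open>z\<close> lies in the flag of \<open>s\<close> at index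
    \<open>m (Suc k)\<close>, \<open>zD\<close> that the projection of column \<open>k\<close> is a
    multiple of \<open>z\<close> modulo the previous member, and \<open>z l \<noteq> 0\<close> that
    \<open>z\<close> is outside the previous member.\<close>
  obtain z l where l: "k \<le> l" "l < q" "z l \<noteq> 0"
    and zC: "\<And>i. i < ?n \<Longrightarrow> m (Suc k) \<le> i \<Longrightarrow> (\<Sum>c<q. minv s $$ (i, p + c) * z c) = 0"
    and zD: "\<And>r. k \<le> r \<Longrightarrow> r < q \<Longrightarrow> s $$ (p + r, k) * z l = s $$ (p + l, k) * z r"
  proof (cases "\<exists>l<q. k \<le> l \<and> s $$ (p + l, k) \<noteq> 0")
    case True
    then obtain l where l: "l < q" "k \<le> l" "s $$ (p + l, k) \<noteq> 0" by blast
    show thesis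
    \<comment> \<open>If the projection of column \<open>k\<close> leaves the previous member, there
      is no choice: \<open>z\<close> must be this projection, and the Hessenberg condition says that
      it is admissible.\<close>
    proof (rule that[of l "\<lambda>c. s $$ (p + c, k)"])
      show "(\<Sum>c<q. minv s $$ (i, p + c) * s $$ (p + c, k)) = 0" if "i < ?n" "m (Suc k) \<le> i" for i
        using sT[OF that] by (simp add: conj_proj_def)
    qed (use l in auto)
  next
    case False
    define M where "M = m (Suc k)"
    have M: "p + k < M" "M \<le> ?n"
      using low[OF kq] m kq by (auto simp: M_def hessenberg_vector_def)
    \<comment> \<open>The previous member already contains the projection, so only a dimension count
      is left: fewer than \<open>q - k\<close> equations for the \<open>q - k\<close> coordinates of
      a vector in the standard complement of that member.\<close>
    have lt: "?n - M < q - k" using M kq by linarith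
    obtain z0 where z0: "\<And>i. i < ?n - M \<Longrightarrow> (\<Sum>c<q - k. minv s $$ (M + i, p + (k + c)) * z0 c) = 0"
        "\<exists>c<q - k. z0 c \<noteq> 0"
      by (rule underdetermined_system[OF lt, of "\<lambda>i c. minv s $$ (M + i, p + (k + c))"]) blast
    then obtain c0 where c0: "c0 < q - k" "z0 c0 \<noteq> 0" by blast
    define z where "z c = (if c < k then 0 else z0 (c - k))" for c
    show thesis
    proof (rule that[of "k + c0" z])
      show "(\<Sum>c<q. minv s $$ (i, p + c) * z c) = 0" if i: "i < ?n" "m (Suc k) \<le> i" for i
      proof -
        have "(\<Sum>c<k + (q - k). minv s $$ (i, p + c) * z c)
            = (\<Sum>c<q - k. minv s $$ (i, p + (k + c)) * z0 c)"
          unfolding sum_split_at by (simp add: z_def)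
        also have "\<dots> = 0" using z0(1)[of "i - M"] i M by (simp add: M_def)
        finally show ?thesis using kq by simp
      qed
    qed (use c0 kq False in \<open>auto simp: z_def\<close>)
  qed
  obtain u where u: "u \<in> block_group p q"
    and urow: "\<And>v r. r < ?n \<Longrightarrow> (\<Sum>c<?n. u $$ (r, c) * v c) =
      (if p \<le> r then z (r - p) * v (p + k) else 0) + (if l \<noteq> k \<and> r = p + k then v (p + l) else 0)
      + (if r \<noteq> p + k \<and> r \<noteq> p + l then v r else 0)"
    and ucol: "\<And>v. (\<Sum>r<?n. v r * u $$ (r, p + k)) = (\<Sum>c<q. v (p + c) * z c)"
      "\<And>v a. a < k \<Longrightarrow> (\<Sum>r<?n. v r * u $$ (r, p + a)) = v (p + a)"
    using block_change_of_basis[of k l q z p] l by blast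
  have uGL: "u \<in> GL ?n" by (rule block_group_GL[OF u])
  have uc: "u \<in> carrier_mat ?n ?n" "minv u \<in> carrier_mat ?n ?n" using uGL by (auto simp: GL_carrier minv_carrier)
  define s' where "s' = minv u * s"
  have s'c: "s' \<in> carrier_mat ?n ?n" using uc sc by (simp add: s'_def)
  have us': "u * s' = s" unfolding s'_def by (rule mult_minv_cancel(1)[OF uGL sc(1)])
  have s'inv: "minv s' = minv s * u"
    unfolding s'_def minv_prod[OF minv_GL[OF uGL] sGL] minv_minv[OF uGL] ..
  have s'\<kappa>: "s' = minv u * \<kappa> * g"
    unfolding s'_def s_def using uc block_group_GL[OF \<kappa>] gGL
    by (simp add: assoc_mult_mat[of _ ?n ?n _ ?n _ ?n] GL_carrier)
  \<comment> \<open>Columns of \<open>s' = minv u * s\<close> are found by guessing a solution of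
    the system with matrix \<open>u\<close>, without computing the inverse of
    \<open>u\<close>.\<close>
  have solve: "s' $$ (r, j) = w r"
    if w: "\<And>i. i < ?n \<Longrightarrow> (\<Sum>c<?n. u $$ (i, c) * w c) = s $$ (i, j)" and "j < ?n" "r < ?n" for w r j
  proof -
    have "s' $$ (r, j) - w r = 0"
    proof (rule nonsingular_imp_no_kernel[of u ?n "\<lambda>c. s' $$ (c, j) - w c"])
      fix i assume i: "i < ?n"
      have "(\<Sum>c<?n. u $$ (i, c) * s' $$ (c, j)) = s $$ (i, j)"
        using mult_mat_entry[OF uc(1) s'c i \<open>j < ?n\<close>] us' by simp
      then show "(\<Sum>c<?n. u $$ (i, c) * (s' $$ (c, j) - w c)) = 0"
        using w[OF i] by (simp add: right_diff_distrib sum_subtractf)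
    qed (use uGL that in \<open>auto simp: GL_iff_det\<close>)
    then show ?thesis by simp
  qed
  define t where "t = s $$ (p + l, k) / z l"
  have zt: "s $$ (p + r, k) = t * z r" if "k \<le> r" "r < q" for r
    using zD[OF that] l(3) by (simp add: t_def field_simps)
  have "minv u * \<kappa> \<in> block_group p q" by (rule block_group_mult[OF minv_block_group[OF u] \<kappa>])
  moreover have "minv s' $$ (i, p + a) = 0" if a: "a < Suc k" "i < ?n" "m (Suc a) \<le> i" for a i
  proof -
    have e: "minv s' $$ (i, p + a) = (\<Sum>r<?n. minv s $$ (i, r) * u $$ (r, p + a))"
      unfolding s'inv by (rule mult_mat_entry[OF sc(2) uc(1)]) (use a kq in auto)
    show ?thesis
    proof (cases "a = k")
      case True then show ?thesis using e ucol(1)[of "\<lambda>r. minv s $$ (i, r)"] zC a by simp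
    next
      case False
      then show ?thesis using e ucol(2)[of a "\<lambda>r. minv s $$ (i, r)"] \<kappa>C[of a i] a by (simp add: s_def)
    qed
  qed
  moreover have "s' $$ (p + b, j) = 0" if j: "j < Suc k" "b < q" "j < b" for j b
  proof (cases "j = k")
    case False
    then have jk: "j < k" using j by simp
    have z0: "s $$ (p + c, j) = 0" if "c < q" "j < c" for c using \<kappa>D[OF jk that] by (simp add: s_def)
    have "s' $$ (p + b, j) = s $$ (p + b, j)"
      by (rule solve[of "\<lambda>r. s $$ (r, j)"])
        (use urow[of _ "\<lambda>r. s $$ (r, j)"] z0[of k] z0[of l] l jk kq j in auto)
    then show ?thesis using z0 j by simp
  next
    case True
    \<comment> \<open>Column \<open>k\<close> of \<open>s\<close> in the new basis: coefficient
      \<open>t\<close> at \<open>z\<close>, corrected coordinates at the first \<open>k\<close>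
      vectors, and zero beyond.\<close>
    define w where "w r = (if r < p then s $$ (r, k) else if r - p < k then s $$ (r, k) - t * z (r - p)
      else if r = p + k then t else 0)" for r
    have "(\<Sum>c<?n. u $$ (i, c) * w c) = s $$ (i, k)" if i: "i < ?n" for i
    proof (cases "i < p")
      case True
      then show ?thesis using urow[OF i, of w] l kq by (simp add: w_def)
    next
      case False
      then obtain c where c: "i = p + c" "c < q" using i by (metis add_less_cancel_left le_Suc_ex not_less)
      have "w (p + k) = t" "l \<noteq> k \<Longrightarrow> w (p + l) = 0" using l by (auto simp: w_def)
      then show ?thesis using urow[OF i, of w] c zt[of c] l by (auto simp: w_def)
    qed
    then have "s' $$ (p + b, k) = w (p + b)" by (rule solve) (use kq j in auto)
    then show ?thesis using True j by (simp add: w_def)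
  qed
  ultimately show ?case unfolding s'\<kappa> by blast
qed

text \<open>Interpolation up to \<open>q\<close> gives one inclusion. For the other, each summand
  \<open>c\<close> of \<open>conj_proj\<close> at \<open>(a, b)\<close> vanishes: if
  \<open>b < c\<close>, row \<open>p + c\<close> has not started at \<open>b\<close>; if
  \<open>c \<le> b\<close>, monotonicity of \<open>m\<close> shows that column \<open>p + c\<close>
  of the inverse has ended before \<open>a\<close>. The end \<open>m (Suc b) - 1\<close> is the last
  admissible position.\<close>

lemma hess_mats_eq_block_shape:
  assumes m: "hessenberg_vector (p + q) m" and low: "\<And>b. b < q \<Longrightarrow> p + b < m (Suc b)"
  shows "hess_mats p q m =
    {k * g |k g. k \<in> block_group p q \<and> g \<in> shape_mats p q (\<lambda>b. b) (\<lambda>b. m (Suc b) - 1)}"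
proof (intro equalityI subsetI)
  let ?n = "p + q"
  fix g assume g: "g \<in> hess_mats p q m"
  have gGL: "g \<in> GL ?n" using g by (simp add: hess_mats_def)
  obtain \<kappa> where \<kappa>: "\<kappa> \<in> block_group p q"
    and \<kappa>C: "\<And>a i. a < q \<Longrightarrow> i < ?n \<Longrightarrow> m (Suc a) \<le> i \<Longrightarrow> minv (\<kappa> * g) $$ (i, p + a) = 0"
    and \<kappa>D: "\<And>j b. j < q \<Longrightarrow> b < q \<Longrightarrow> j < b \<Longrightarrow> (\<kappa> * g) $$ (p + b, j) = 0"
    using hess_mats_interpolation[OF m low g order.refl] by blast
  have "\<kappa> * g \<in> shape_mats p q (\<lambda>b. b) (\<lambda>b. m (Suc b) - 1)"
    by (rule shape_matsI) (use GL_mult[OF block_group_GL[OF \<kappa>] gGL] \<kappa>C \<kappa>D in auto)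
  moreover have "g = minv \<kappa> * (\<kappa> * g)"
    using mult_minv_cancel(2)[OF block_group_GL[OF \<kappa>] GL_carrier[OF gGL]] by simp
  ultimately show "g \<in> {k * g |k g. k \<in> block_group p q \<and> g \<in> shape_mats p q (\<lambda>b. b) (\<lambda>b. m (Suc b) - 1)}"
    using minv_block_group[OF \<kappa>] by blast
next
  let ?n = "p + q"
  fix x assume "x \<in> {k * g |k g. k \<in> block_group p q \<and> g \<in> shape_mats p q (\<lambda>b. b) (\<lambda>b. m (Suc b) - 1)}"
  then obtain k g where x: "x = k * g" and k: "k \<in> block_group p q"
    and g: "g \<in> shape_mats p q (\<lambda>b. b) (\<lambda>b. m (Suc b) - 1)" by blast
  note gD = shape_matsD[OF g]
  have "conj_proj p q x a b = 0" if ab: "a < ?n" "b < ?n" "m (Suc b) \<le> a" for a b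
  proof -
    have "minv g $$ (a, p + c) * g $$ (p + c, b) = 0" if c: "c < q" for c
    proof (cases "b < c")
      case True then show ?thesis using gD(2)[OF c ab(2)] by simp
    next
      case False
      then have "m (Suc c) \<le> m (Suc b)" using m ab c by (simp add: hessenberg_vector_def)
      moreover have "0 < m (Suc c)" using low[OF c] by simp
      ultimately have "m (Suc c) - 1 < a" using ab by simp
      then show ?thesis using gD(3)[OF c ab(1)] by simp
    qed
    then show ?thesis
      unfolding x conj_proj_block_mult[OF k gD(1) ab(1,2)] unfolding conj_proj_def by (intro sum.neutral) auto
  qed
  then show "x \<in> hess_mats p q m"
    unfolding hess_mats_def using GL_mult[OF block_group_GL[OF k] gD(1)] x by simp
qed

lemma prime_set_hess_mats:
  assumes "q \<le> p" and m: "hessenberg_vector (p + q) m" and low: "\<And>b. b < q \<Longrightarrow> p + b < m (Suc b)"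
  shows "prime_set (p + q) (hess_mats p q m)"
proof -
  have "prime_set (p + q) (shape_mats p q (\<lambda>b. b) (\<lambda>b. m (Suc b) - 1))"
  proof (rule prime_set_shape[OF assms(1)])
    fix b assume b: "b < q"
    show "p + b \<le> m (Suc b) - 1" using low[OF b] by simp
    have "m (Suc b) \<le> p + q" using m b by (simp add: hessenberg_vector_def)
    then show "m (Suc b) - 1 < p + q" using low[OF b] by simp
  next
    fix b b' assume "b < b'" "b' < q"
    then have "m (Suc b) \<le> m (Suc b')" using m by (simp add: hessenberg_vector_def)
    then show "m (Suc b) - 1 \<le> m (Suc b') - 1" by simp
  qed
  moreover have "hess_mats p q m =
      {k * g |k g. k \<in> block_group p q \<and> g \<in> shape_mats p q (\<lambda>b. b) (\<lambda>b. m (Suc b) - 1)}"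
    by (rule hess_mats_eq_block_shape) (fact m low)+
  ultimately show ?thesis using prime_set_mult[OF prime_set_block_group] by simp
qed

section \<open>The dense orbit\<close>

text \<open>The vector solves \<open>i\<close> equations in the \<open>i + 1\<close> unknowns
  \<open>0, ..., i\<close>. If \<open>b i\<close> were 0, it would be in the kernel of the minor of
  size \<open>i\<close>; if row \<open>i\<close> killed it as well, in the kernel of the minor of
  size \<open>i + 1\<close>.\<close>

lemma leading_minors_elimination:
  fixes M :: "nat \<Rightarrow> nat \<Rightarrow> complex"
  assumes minors: "\<And>k. k \<le> q \<Longrightarrow> det (mat k k (\<lambda>(r, s). M r s)) \<noteq> 0" and i: "i < q"
  obtains b where "b i \<noteq> 0" "\<And>s. i < s \<Longrightarrow> b s = 0"
    "\<And>r. r < i \<Longrightarrow> (\<Sum>s<q. M r s * b s) = 0" "(\<Sum>s<q. M i s * b s) \<noteq> 0"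
proof -
  have kernel: "z s = 0" if "k \<le> q" "s < k" "\<And>r. r < k \<Longrightarrow> (\<Sum>s<k. M r s * z s) = 0" for k s z
  proof (rule nonsingular_imp_no_kernel[OF mat_carrier minors[OF that(1)]])
    fix r assume r: "r < k"
    have "(\<Sum>l<k. mat k k (\<lambda>(r, s). M r s) $$ (r, l) * z l) = (\<Sum>l<k. M r l * z l)"
      by (rule sum.cong) (use r in auto)
    then show "(\<Sum>l<k. mat k k (\<lambda>(r, s). M r s) $$ (r, l) * z l) = 0" using that(3)[OF r] by simp
  qed (rule that(2))
  have "\<exists>z. (\<forall>r<i. (\<Sum>s<Suc i. M r s * z s) = 0) \<and> (\<exists>s<Suc i. z s \<noteq> 0)"
    by (rule underdetermined_system[OF lessI, of i M], rule exI, rule conjI, rule allI, rule impI)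
  then obtain z where z: "\<And>r. r < i \<Longrightarrow> (\<Sum>s<Suc i. M r s * z s) = 0" "\<exists>s<Suc i. z s \<noteq> 0"
    by blast
  define b where "b s = (if s \<le> i then z s else 0)" for s
  have sum_b: "(\<Sum>s<q. M r s * b s) = (\<Sum>s<Suc i. M r s * z s)" for r
  proof -
    have "(\<Sum>s<q. M r s * b s) = (\<Sum>s<Suc i. M r s * b s)"
      by (rule sum.mono_neutral_right) (use i in \<open>auto simp: b_def\<close>)
    also have "\<dots> = (\<Sum>s<Suc i. M r s * z s)" by (rule sum.cong) (auto simp: b_def)
    finally show ?thesis .
  qed
  show thesis
  proof (rule that[of b])
    show "b i \<noteq> 0"
    proof
      assume "b i = 0"
      then have zi: "z i = 0" by (simp add: b_def)
      have "z s = 0" if "s < i" for s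
        proof (rule kernel[of i s z])
        show "(\<Sum>s<i. M r s * z s) = 0" if "r < i" for r using z(1)[OF that] zi by simp
      qed (use i that in auto)
      then show False using z(2) zi by (auto simp: less_Suc_eq)
    qed
    show "(\<Sum>s<q. M i s * b s) \<noteq> 0"
    proof
      assume "(\<Sum>s<q. M i s * b s) = 0"
      have "z s = 0" if "s < Suc i" for s
        proof (rule kernel[of "Suc i" s z])
        show "(\<Sum>s<Suc i. M r s * z s) = 0" if "r < Suc i" for r
          using z(1)[of r] sum_b[of i] \<open>(\<Sum>s<q. M i s * b s) = 0\<close> that by (cases "r = i") auto
      qed (use i that in auto)
      then show False using z(2) by blast
    qed
  qed (use z sum_b in \<open>auto simp: b_def\<close>)
qed

section \<open>The base point of the orbit and the passage to it\<close>

definition clan_mat :: "nat \<Rightarrow> nat \<Rightarrow> (nat \<Rightarrow> nat) \<Rightarrow> (nat \<Rightarrow> nat) \<Rightarrow> complex mat" where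
  "clan_mat p q \<sigma> \<tau> = mat (p + q) (p + q) (\<lambda>(r, s).
     if s < q then (if r = s then 1 else 0) + (if r = p + \<sigma> s then 1 else 0)
     else if s < p then (if r = s then 1 else 0)
     else (if r = \<tau> (s - p) then 1 else 0) - (if r = s then 1 else 0))"

lemma mult_clan_mat:
  assumes k: "k \<in> carrier_mat (p + q) (p + q)" and qp: "q \<le> p"
    and \<sigma>: "\<And>c. c < q \<Longrightarrow> \<sigma> c < q" and \<tau>: "\<And>c. c < q \<Longrightarrow> \<tau> c < q"
    and rs: "r < p + q" "s < p + q"
  shows "(k * clan_mat p q \<sigma> \<tau>) $$ (r, s) =
    (if s < q then k $$ (r, s) + k $$ (r, p + \<sigma> s) else if s < p then k $$ (r, s)
     else k $$ (r, \<tau> (s - p)) - k $$ (r, s))"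
proof -
  let ?n = "p + q"
  have b: "s < q \<Longrightarrow> p + \<sigma> s < ?n" "\<not> s < p \<Longrightarrow> \<tau> (s - p) < ?n"
    using \<sigma>[of s] \<tau>[of "s - p"] rs by linarith+
  have "(k * clan_mat p q \<sigma> \<tau>) $$ (r, s) = (\<Sum>l<?n. k $$ (r, l) * clan_mat p q \<sigma> \<tau> $$ (l, s))"
    by (rule mult_mat_entry[OF k _ rs]) (simp add: clan_mat_def)
  also have "\<dots> = (\<Sum>l<?n. if s < q then (if l = s then k $$ (r, l) else 0) + (if l = p + \<sigma> s then k $$ (r, l) else 0)
     else if s < p then (if l = s then k $$ (r, l) else 0)
     else (if l = \<tau> (s - p) then k $$ (r, l) else 0) - (if l = s then k $$ (r, l) else 0))"
    by (rule sum.cong) (use rs in \<open>auto simp: clan_mat_def\<close>)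
  also have "\<dots> = (if s < q then k $$ (r, s) + k $$ (r, p + \<sigma> s) else if s < p then k $$ (r, s)
     else k $$ (r, \<tau> (s - p)) - k $$ (r, s))"
    using b rs by (simp add: sum.distrib sum_subtractf)
  finally show ?thesis .
qed

text \<open>Columns \<open>s\<close> and \<open>p + \<sigma> s\<close> of \<open>clan_mat\<close>
  are the sum and the difference of the same two unit vectors; half their sum and half their
  difference recover these.\<close>

definition clan_mat_inv :: "nat \<Rightarrow> nat \<Rightarrow> (nat \<Rightarrow> nat) \<Rightarrow> (nat \<Rightarrow> nat) \<Rightarrow> complex mat" where
  "clan_mat_inv p q \<sigma> \<tau> = mat (p + q) (p + q) (\<lambda>(r, s).
     if s < q then (if r = s then 1 / 2 else 0) + (if r = p + \<sigma> s then 1 / 2 else 0)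
     else if s < p then (if r = s then 1 else 0)
     else (if r = \<tau> (s - p) then 1 / 2 else 0) - (if r = s then 1 / 2 else 0))"

lemma clan_mat_inverse:
  assumes qp: "q \<le> p" and \<sigma>: "\<And>c. c < q \<Longrightarrow> \<sigma> c < q" and \<tau>: "\<And>c. c < q \<Longrightarrow> \<tau> c < q"
    and \<tau>\<sigma>: "\<And>c. c < q \<Longrightarrow> \<tau> (\<sigma> c) = c" and \<sigma>\<tau>: "\<And>c. c < q \<Longrightarrow> \<sigma> (\<tau> c) = c"
  shows "clan_mat_inv p q \<sigma> \<tau> * clan_mat p q \<sigma> \<tau> = 1\<^sub>m (p + q)"
proof (rule eq_matI)
  let ?n = "p + q"
  fix r s assume "r < dim_row (1\<^sub>m ?n :: complex mat)" "s < dim_col (1\<^sub>m ?n :: complex mat)"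
  then have rs: "r < ?n" "s < ?n" by auto
  have c: "clan_mat_inv p q \<sigma> \<tau> \<in> carrier_mat ?n ?n" by (simp add: clan_mat_inv_def)
  have m: "(clan_mat_inv p q \<sigma> \<tau> * clan_mat p q \<sigma> \<tau>) $$ (r, s) =
    (if s < q then clan_mat_inv p q \<sigma> \<tau> $$ (r, s) + clan_mat_inv p q \<sigma> \<tau> $$ (r, p + \<sigma> s)
     else if s < p then clan_mat_inv p q \<sigma> \<tau> $$ (r, s)
     else clan_mat_inv p q \<sigma> \<tau> $$ (r, \<tau> (s - p)) - clan_mat_inv p q \<sigma> \<tau> $$ (r, s))"
    by (rule mult_clan_mat) (fact c qp \<sigma> \<tau> rs)+
  consider "s < q" | "q \<le> s" "s < p" | t where "t < q" "s = p + t"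
    using rs by (metis add_less_cancel_left le_Suc_ex linorder_not_le)
  then show "(clan_mat_inv p q \<sigma> \<tau> * clan_mat p q \<sigma> \<tau>) $$ (r, s) = 1\<^sub>m ?n $$ (r, s)"
  proof cases
    case 1
    then show ?thesis unfolding m using rs qp \<sigma>[OF 1] \<tau>\<sigma>[OF 1] by (auto simp: clan_mat_inv_def)
  next
    case 2
    then show ?thesis unfolding m using rs by (auto simp: clan_mat_inv_def)
  next
    case 3
    then show ?thesis unfolding m using rs qp \<tau>[OF 3(1)] \<sigma>\<tau>[OF 3(1)] by (auto simp: clan_mat_inv_def)
  qed
qed (simp_all add: clan_mat_def clan_mat_inv_def)

lemma clan_mat_GL:
  assumes qp: "q \<le> p" and \<sigma>: "\<And>c. c < q \<Longrightarrow> \<sigma> c < q" and \<tau>: "\<And>c. c < q \<Longrightarrow> \<tau> c < q"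
    and \<tau>\<sigma>: "\<And>c. c < q \<Longrightarrow> \<tau> (\<sigma> c) = c" and \<sigma>\<tau>: "\<And>c. c < q \<Longrightarrow> \<sigma> (\<tau> c) = c"
  shows "clan_mat p q \<sigma> \<tau> \<in> GL (p + q)" "minv (clan_mat p q \<sigma> \<tau>) = clan_mat_inv p q \<sigma> \<tau>"
proof -
  let ?n = "p + q"
  have c: "clan_mat p q \<sigma> \<tau> \<in> carrier_mat ?n ?n" "clan_mat_inv p q \<sigma> \<tau> \<in> carrier_mat ?n ?n"
    by (simp_all add: clan_mat_def clan_mat_inv_def)
  have inv: "clan_mat_inv p q \<sigma> \<tau> * clan_mat p q \<sigma> \<tau> = 1\<^sub>m ?n"
    by (rule clan_mat_inverse) (fact assms)+
  have "clan_mat_inv p q \<sigma> \<tau> \<in> GL ?n" by (rule GL_I[OF c(2,1) inv])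
  moreover have "minv (clan_mat_inv p q \<sigma> \<tau>) = clan_mat p q \<sigma> \<tau>" by (rule minv_unique[OF c(2,1) inv])
  ultimately show "clan_mat p q \<sigma> \<tau> \<in> GL ?n" "minv (clan_mat p q \<sigma> \<tau>) = clan_mat_inv p q \<sigma> \<tau>"
    using minv_GL minv_minv by metis+
qed

text \<open>The projection of column \<open>b\<close> is the unit vector of
  \<open>p + \<sigma> b\<close>, which is half the difference of columns \<open>b\<close> and
  \<open>p + \<sigma> b\<close>.\<close>

lemma conj_proj_clan_mat:
  assumes qp: "q \<le> p" and \<sigma>: "\<And>c. c < q \<Longrightarrow> \<sigma> c < q" and \<tau>: "\<And>c. c < q \<Longrightarrow> \<tau> c < q"
    and \<tau>\<sigma>: "\<And>c. c < q \<Longrightarrow> \<tau> (\<sigma> c) = c" and \<sigma>\<tau>: "\<And>c. c < q \<Longrightarrow> \<sigma> (\<tau> c) = c"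
    and ab: "a < p + q" "b < q"
  shows "conj_proj p q (clan_mat p q \<sigma> \<tau>) a b =
    (if a = b then 1 / 2 else 0) - (if a = p + \<sigma> b then 1 / 2 else 0)"
proof -
  have inv: "minv (clan_mat p q \<sigma> \<tau>) = clan_mat_inv p q \<sigma> \<tau>"
    by (rule clan_mat_GL(2)) (fact assms)+
  have "conj_proj p q (clan_mat p q \<sigma> \<tau>) a b
      = (\<Sum>c<q. if c = \<sigma> b then (if a = \<tau> c then 1 / 2 else 0) - (if a = p + c then 1 / 2 else 0) else 0)"
    unfolding conj_proj_def inv
    by (rule sum.cong) (use qp ab in \<open>auto simp: clan_mat_def clan_mat_inv_def\<close>)
  then show ?thesis using \<sigma>[OF ab(2)] \<tau>\<sigma>[OF ab(2)] by simp
qed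

text \<open>The adapted basis of the flag of \<open>g\<close> consists of the \<open>\<beta>\<^sub>i\<close>, of corrections of the middle
  basis vectors that put them into the first eigenspace, and of the reflections \<open>\<beta>\<^sub>i - 2 \<pi> \<beta>\<^sub>i\<close>.\<close>

lemma clan_factorization:
  fixes \<beta> :: "nat \<Rightarrow> nat \<Rightarrow> complex"
  assumes qp: "q \<le> p" and \<sigma>: "\<And>c. c < q \<Longrightarrow> \<sigma> c < q" and \<tau>: "\<And>c. c < q \<Longrightarrow> \<tau> c < q"
    and \<tau>\<sigma>: "\<And>c. c < q \<Longrightarrow> \<tau> (\<sigma> c) = c" and \<sigma>\<tau>: "\<And>c. c < q \<Longrightarrow> \<sigma> (\<tau> c) = c"
    and g: "g \<in> GL (p + q)"
    and \<beta>: "\<And>i. i < q \<Longrightarrow> \<beta> i i \<noteq> 0" "\<And>i l. i < q \<Longrightarrow> i < l \<Longrightarrow> \<beta> i l = 0"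
    and N: "\<And>i. i < q \<Longrightarrow> (\<Sum>l<q. conj_proj p q g (p + \<sigma> i) l * \<beta> i l) \<noteq> 0"
      "\<And>i a. i < q \<Longrightarrow> a < p + q \<Longrightarrow> p + \<sigma> i < a \<Longrightarrow> (\<Sum>l<q. conj_proj p q g a l * \<beta> i l) = 0"
  shows "\<exists>k\<in>block_group p q. \<exists>b\<in>Borel (p + q). g * b = k * clan_mat p q \<sigma> \<tau>"
proof -
  let ?n = "p + q"
  have c: "g \<in> carrier_mat ?n ?n" "minv g \<in> carrier_mat ?n ?n" using g by (auto simp: GL_carrier minv_carrier)
  \<comment> \<open>Column \<open>c\<close> holds the coordinates in \<open>E\<^sub>2\<close> of the
    projection of the vector \<open>\<beta> (\<tau> c)\<close>; \<open>Nb\<close> below gives the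
    same projections in the basis of columns of \<open>g\<close>.\<close>
  define Hf where "Hf r c = (\<Sum>l<q. g $$ (p + r, l) * \<beta> (\<tau> c) l)" for r c
  define H where "H = mat q q (\<lambda>(r, c). Hf r c)"
  have Hc: "H \<in> carrier_mat q q" by (simp add: H_def)
  define Nb where "Nb i a = (\<Sum>l<q. conj_proj p q g a l * \<beta> i l)" for i a
  have NbH: "Nb (\<tau> c) a = (\<Sum>r<q. minv g $$ (a, p + r) * Hf r c)" for c a
    unfolding Nb_def conj_proj_def Hf_def sum_distrib_left sum_distrib_right
    by (subst sum.swap) (simp add: mult.assoc)
  have Nb_top: "Nb (\<tau> c) (p + c) \<noteq> 0" if "c < q" for c
    using N(1)[OF \<tau>[OF that]] \<sigma>\<tau>[OF that] by (simp add: Nb_def)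
  have Nb_zero: "Nb (\<tau> c) a = 0" if "c < q" "a < ?n" "p + c < a" for c a
    using N(2)[OF \<tau>[OF that(1)] that(2)] \<sigma>\<tau>[OF that(1)] that(3) by (simp add: Nb_def)
  \<comment> \<open>The projection numbered \<open>c\<close> ends exactly at \<open>p + c\<close>,
    so the projections are independent: a relation among them is killed from the largest
    \<open>c\<close> downwards.\<close>
  have detH: "det H \<noteq> 0"
  proof
    assume "det H = 0"
    then obtain x where x: "\<And>i. i < q \<Longrightarrow> (\<Sum>c<q. H $$ (i, c) * x c) = 0" "\<exists>c<q. x c \<noteq> 0"
      using singular_imp_kernel[OF Hc] by blast
    have xH: "(\<Sum>c<q. Hf r c * x c) = 0" if "r < q" for r
    proof -
      have "(\<Sum>c<q. Hf r c * x c) = (\<Sum>c<q. H $$ (r, c) * x c)"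
        by (rule sum.cong) (use that in \<open>auto simp: H_def\<close>)
      then show ?thesis using x(1)[OF that] by simp
    qed
    have xN: "(\<Sum>c<q. Nb (\<tau> c) a * x c) = 0" for a
    proof -
      have "(\<Sum>c<q. Nb (\<tau> c) a * x c) = (\<Sum>r<q. minv g $$ (a, p + r) * (\<Sum>c<q. Hf r c * x c))"
        unfolding NbH sum_distrib_left sum_distrib_right by (subst sum.swap) (simp add: mult.assoc)
      then show ?thesis using xH by simp
    qed
    have "x c = 0" if "c < q" for c
      using that
    proof (induction "q - c" arbitrary: c rule: less_induct)
      case less
      have "0 = (\<Sum>c'<q. Nb (\<tau> c') (p + c) * x c')" using xN by simp
      also have "\<dots> = (\<Sum>c'\<in>{c}. Nb (\<tau> c') (p + c) * x c')"
      proof (rule sum.mono_neutral_right)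
        show "\<forall>c'\<in>{..<q} - {c}. Nb (\<tau> c') (p + c) * x c' = 0"
        proof
          fix c' assume c': "c' \<in> {..<q} - {c}"
          show "Nb (\<tau> c') (p + c) * x c' = 0"
          proof (cases "c' < c")
            case True then show ?thesis using Nb_zero[of c' "p + c"] less.prems by simp
          next
            case False
            then have "q - c' < q - c" "c' < q" using c' less.prems by (auto intro: diff_less_mono2)
            then show ?thesis using less.hyps[of c'] by simp
          qed
        qed
      qed (use less.prems in auto)
      finally show ?case using Nb_top[OF less.prems] by simp
    qed
    then show False using x(2) by blast
  qed
  have HGL: "H \<in> GL q" using Hc detH by (simp add: GL_iff_det)
  define xs where "xs i = minv H *\<^sub>v vec q (\<lambda>r. g $$ (p + r, i))" for i
  have xs: "(\<Sum>c<q. Hf r c * xs i $ c) = g $$ (p + r, i)" if r: "r < q" for r i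
  proof -
    have v: "vec q (\<lambda>r. g $$ (p + r, i)) \<in> carrier_vec q" by simp
    have xc: "xs i \<in> carrier_vec q" using minv_carrier[OF Hc] by (simp add: xs_def)
    have "(\<Sum>c<q. Hf r c * xs i $ c) = (\<Sum>c<q. H $$ (r, c) * xs i $ c)"
      by (rule sum.cong) (use r in \<open>auto simp: H_def\<close>)
    also have "\<dots> = (H *\<^sub>v xs i) $ r" by (rule mult_mat_vec_entry[OF Hc xc r, symmetric])
    also have "H *\<^sub>v xs i = vec q (\<lambda>r. g $$ (p + r, i))"
      unfolding xs_def by (rule minv_mult_mat_vec(2)[OF HGL v])
    finally show ?thesis using r by simp
  qed
  \<comment> \<open>The combination of the \<open>\<beta>\<close> with the same projection as column
    \<open>i\<close> of \<open>g\<close>; subtracting it puts that column into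
    \<open>E\<^sub>1\<close>.\<close>
  define y where "y i l = (\<Sum>c<q. xs i $ c * \<beta> (\<tau> c) l)" for i l
  have \<beta>0: "\<beta> i l = 0" if "i < q" "q \<le> l" for i l using \<beta>(2)[OF that(1)] that by simp
  have y0: "y i l = 0" if "q \<le> l" for i l
    unfolding y_def by (rule sum.neutral) (use \<beta>0[OF \<tau> that] in simp)
  define B where "B = mat ?n ?n (\<lambda>(l, i). if i < q then \<beta> i l
     else if i < p then (if l = i then 1 else 0) - y i l
     else \<beta> (\<tau> (i - p)) l - 2 * Nb (\<tau> (i - p)) l)"
  have Bc: "B \<in> carrier_mat ?n ?n" by (simp add: B_def)
  have "B \<in> Borel ?n"
  proof -
    have "B $$ (l, i) = 0" if li: "i < l" "l < ?n" for l i
    proof -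
      consider "i < q" | "q \<le> i" "i < p" | t where "t < q" "i = p + t"
        using li by (metis add_less_cancel_left le_Suc_ex linorder_not_le order.strict_trans)
      then show ?thesis
        by cases (use li \<beta>(2)[of i l] y0[of l i] Nb_zero \<beta>0[OF \<tau>] qp in \<open>auto simp: B_def\<close>)
    qed
    moreover have "B $$ (i, i) \<noteq> 0" if i: "i < ?n" for i
    proof -
      consider "i < q" | "q \<le> i" "i < p" | t where "t < q" "i = p + t"
        using i by (metis add_less_cancel_left le_Suc_ex linorder_not_le)
      then show ?thesis
        by cases (use i \<beta>(1) y0 Nb_top \<beta>0[OF \<tau>] qp in \<open>auto simp: B_def\<close>)
    qed
    ultimately show ?thesis using Borel_iff_diag[OF Bc] by blast
  qed
  have gB: "(g * B) $$ (r, i) = (\<Sum>l<?n. g $$ (r, l) * B $$ (l, i))" if "r < ?n" "i < ?n" for r i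
    by (rule mult_mat_entry[OF c(1) Bc that])
  have g\<beta>: "(\<Sum>l<?n. g $$ (r, l) * \<beta> i l) = (\<Sum>l<q. g $$ (r, l) * \<beta> i l)" if "i < q" for r i
    by (rule sum.mono_neutral_right) (use \<beta>0[OF that] in auto)
  have gB1: "(g * B) $$ (r, i) = (\<Sum>l<q. g $$ (r, l) * \<beta> i l)" if "r < ?n" "i < q" for r i
    using gB[OF that(1), of i] that g\<beta>[OF that(2)] by (simp add: B_def)
  have gB2: "(g * B) $$ (p + t, i) = 0" if t: "t < q" and i: "q \<le> i" "i < p" for t i
  proof -
    have "(g * B) $$ (p + t, i) = (\<Sum>l<?n. g $$ (p + t, l) * ((if l = i then 1 else 0) - y i l))"
      unfolding gB[of "p + t" i, simplified, OF t trans_less_add1[OF i(2)]]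
      by (rule sum.cong) (use i in \<open>auto simp: B_def\<close>)
    also have "\<dots> = g $$ (p + t, i) - (\<Sum>l<?n. g $$ (p + t, l) * y i l)"
    proof -
      have "(\<Sum>l<?n. g $$ (p + t, l) * ((if l = i then 1 else 0) - y i l))
          = (\<Sum>l<?n. (if l = i then g $$ (p + t, l) else 0) - g $$ (p + t, l) * y i l)"
        by (rule sum.cong) (auto simp: algebra_simps)
      then show ?thesis using i by (simp add: sum_subtractf)
    qed
    also have "(\<Sum>l<?n. g $$ (p + t, l) * y i l) = (\<Sum>l<q. g $$ (p + t, l) * y i l)"
      by (rule sum.mono_neutral_right) (use y0 in auto)
    also have "\<dots> = (\<Sum>c<q. Hf t c * xs i $ c)"
      unfolding y_def Hf_def sum_distrib_left sum_distrib_right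
      by (subst sum.swap) (simp add: mult.assoc mult.left_commute mult.commute)
    finally show ?thesis using xs[OF t] by simp
  qed
  have gNb: "(\<Sum>l<?n. g $$ (r, l) * Nb (\<tau> t) l) = (if r < p then 0 else Hf (r - p) t)" if r: "r < ?n" for r t
  proof -
    have "(\<Sum>l<?n. g $$ (r, l) * Nb (\<tau> t) l) = (\<Sum>u<q. (\<Sum>l<?n. g $$ (r, l) * minv g $$ (l, p + u)) * Hf u t)"
      unfolding NbH sum_distrib_left sum_distrib_right by (subst sum.swap) (simp add: mult.assoc)
    also have "\<dots> = (\<Sum>u<q. if u = r - p then (if r < p then 0 else Hf (r - p) t) else 0)"
      by (rule sum.cong) (use mult_minv_entry[OF g r] in auto)
    finally show ?thesis using r by auto
  qed
  have gB3: "(g * B) $$ (r, p + t) = (\<Sum>l<q. g $$ (r, l) * \<beta> (\<tau> t) l) - 2 * (if r < p then 0 else Hf (r - p) t)"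
    if r: "r < ?n" and t: "t < q" for r t
  proof -
    have "(g * B) $$ (r, p + t) = (\<Sum>l<?n. g $$ (r, l) * (\<beta> (\<tau> t) l - 2 * Nb (\<tau> t) l))"
      unfolding gB[OF r, of "p + t", simplified, OF t]
      by (rule sum.cong) (use t qp in \<open>auto simp: B_def\<close>)
    also have "\<dots> = (\<Sum>l<?n. g $$ (r, l) * \<beta> (\<tau> t) l) - 2 * (\<Sum>l<?n. g $$ (r, l) * Nb (\<tau> t) l)"
      by (simp add: right_diff_distrib sum_subtractf sum_distrib_left mult.left_commute)
    finally show ?thesis unfolding g\<beta>[OF \<tau>[OF t]] gNb[OF r] .
  qed
  \<comment> \<open>The base point is built from unit vectors of both eigenspaces; \<open>k\<close>
    sends these to the \<open>E\<^sub>1\<close> parts of the first \<open>p\<close> adapted vectors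
    and to the projections \<open>Hf\<close>. A vector and its reflection are then sum and
    difference of its two parts, as in \<open>clan_mat\<close>.\<close>
  define k where "k = mat ?n ?n (\<lambda>(r, s). if s < p then (if r < p then (g * B) $$ (r, s) else 0)
      else (if r < p then 0 else Hf (r - p) (s - p)))"
  have kc: "k \<in> carrier_mat ?n ?n" by (simp add: k_def)
  have eq: "g * B = k * clan_mat p q \<sigma> \<tau>"
  proof (rule eq_matI)
    fix r s assume "r < dim_row (k * clan_mat p q \<sigma> \<tau>)" "s < dim_col (k * clan_mat p q \<sigma> \<tau>)"
    then have rs: "r < ?n" "s < ?n" using kc by (auto simp: clan_mat_def)
    have m: "(k * clan_mat p q \<sigma> \<tau>) $$ (r, s) =
      (if s < q then k $$ (r, s) + k $$ (r, p + \<sigma> s) else if s < p then k $$ (r, s)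
       else k $$ (r, \<tau> (s - p)) - k $$ (r, s))"
      by (rule mult_clan_mat) (fact kc qp \<sigma> \<tau> rs)+
    consider "s < q" | "q \<le> s" "s < p" | t where "t < q" "s = p + t"
      using rs by (metis add_less_cancel_left le_Suc_ex linorder_not_le)
    then show "(g * B) $$ (r, s) = (k * clan_mat p q \<sigma> \<tau>) $$ (r, s)"
    proof cases
      case 1
      then show ?thesis
        unfolding m gB1[OF rs(1) 1] using rs qp \<sigma>[OF 1] \<tau>\<sigma>[OF 1] gB1[OF rs(1) 1] by (auto simp: k_def Hf_def)
    next
      case 2
      show ?thesis
      proof (cases "r < p")
        case True then show ?thesis unfolding m using 2 rs by (simp add: k_def)
      next
        case False
        then have "(g * B) $$ (r, s) = 0" using gB2[of "r - p" s] 2 rs by auto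
        then show ?thesis unfolding m using False 2 rs by (simp add: k_def)
      qed
    next
      case 3
      show ?thesis
      proof (cases "r < p")
        case True
        then show ?thesis
          unfolding m using 3 qp rs \<tau>[OF 3(1)] gB3[OF rs(1) 3(1)] gB1[OF rs(1) \<tau>[OF 3(1)]] by (simp add: k_def)
      next
        case False
        then have "(\<Sum>l<q. g $$ (r, l) * \<beta> (\<tau> t) l) = Hf (r - p) t" by (simp add: Hf_def)
        then show ?thesis
          unfolding m using False 3 qp rs \<tau>[OF 3(1)] gB3[OF rs(1) 3(1)] by (simp add: k_def)
      qed
    qed
  qed (use c Bc kc in \<open>simp_all add: clan_mat_def\<close>)
  have "det (g * B) \<noteq> 0" using GL_mult[OF g Borel_GL[OF \<open>B \<in> Borel ?n\<close>]] by (simp add: GL_iff_det)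
  then have "det k \<noteq> 0" unfolding eq using det_mult[OF kc, of "clan_mat p q \<sigma> \<tau>"] by (auto simp: clan_mat_def)
  then have "k \<in> block_group p q" using kc by (auto simp: block_group_def GL_iff_det k_def)
  then show ?thesis using \<open>B \<in> Borel ?n\<close> eq by blast
qed

section \<open>The orbit of a 231-avoiding permutation is dense\<close>

context
  fixes p q :: nat and w :: "nat \<Rightarrow> nat"
  assumes q: "1 \<le> q" "q \<le> p" and w: "w permutes {1..q}"
begin

text \<open>The permutation and its inverse, shifted to \<open>{0..<q}\<close>.\<close>

definition inv0 :: "nat \<Rightarrow> nat" where "inv0 c = Hilbert_Choice.inv w (Suc c) - 1"

definition perm0 :: "nat \<Rightarrow> nat" where "perm0 c = w (Suc c) - 1"

lemma inv_Suc: "c < q \<Longrightarrow> Hilbert_Choice.inv w (Suc c) = Suc (inv0 c)"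
  using permutes_in_image[OF permutes_inv[OF w], of "Suc c"] by (simp add: inv0_def)

lemma w_Suc: "c < q \<Longrightarrow> w (Suc c) = Suc (perm0 c)"
  using permutes_in_image[OF w, of "Suc c"] by (simp add: perm0_def)

lemma inv0_less: "c < q \<Longrightarrow> inv0 c < q"
  using permutes_in_image[OF permutes_inv[OF w], of "Suc c"] inv_Suc[of c] by simp

lemma perm0_less: "c < q \<Longrightarrow> perm0 c < q"
  using permutes_in_image[OF w, of "Suc c"] w_Suc[of c] by simp

lemma perm0_inv0: "c < q \<Longrightarrow> perm0 (inv0 c) = c"
  using permutes_inverses(1)[OF w, of "Suc c"] inv_Suc[of c] w_Suc[OF inv0_less, of c] by simp

lemma inv0_perm0: "c < q \<Longrightarrow> inv0 (perm0 c) = c"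
  using permutes_inverses(2)[OF w, of "Suc c"] w_Suc[of c] inv_Suc[OF perm0_less, of c] by simp

lemma inv0_inj: "b < q \<Longrightarrow> c < q \<Longrightarrow> inv0 b = inv0 c \<Longrightarrow> b = c"
  by (metis perm0_inv0)

abbreviation (input) mw :: "nat \<Rightarrow> nat" where "mw \<equiv> hess_vec_of_perm p q w"

abbreviation (input) gw :: "complex mat" where "gw \<equiv> clan_mat p q inv0 perm0"

lemma mw_le_iff: "b < q \<Longrightarrow> mw (Suc b) \<le> a \<longleftrightarrow> (\<forall>c\<le>b. p + inv0 c < a)"
proof -
  assume b: "b < q"
  have "mw (Suc b) \<le> a \<longleftrightarrow> (\<forall>k\<in>{1..Suc b}. Hilbert_Choice.inv w k + p \<le> a)"
    using b by (simp add: hess_vec_of_perm_def)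
  also have "\<dots> \<longleftrightarrow> (\<forall>c\<le>b. Hilbert_Choice.inv w (Suc c) + p \<le> a)"
    by (metis One_nat_def Suc_le_mono atLeastAtMost_iff le0 not0_implies_Suc not_one_le_zero)
  also have "\<dots> \<longleftrightarrow> (\<forall>c\<le>b. p + inv0 c < a)" using inv_Suc b by (simp add: less_eq_Suc_le add.commute)
  finally show ?thesis .
qed

lemma hess_mw: "hessenberg_vector (p + q) mw"
  by (rule hessenberg_vector_of_perm[OF q(2) w])

text \<open>Pigeonhole: \<open>inv0\<close> is injective, so it cannot map the \<open>b + 1\<close>
  numbers up to \<open>b\<close> into the \<open>b\<close> numbers below \<open>b\<close>.\<close>

lemma mw_low: "b < q \<Longrightarrow> p + b < mw (Suc b)"
proof (rule ccontr)
  assume b: "b < q" and "\<not> p + b < mw (Suc b)"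
  then have "inv0 ` {..b} \<subseteq> {..<b}" using mw_le_iff[OF b, of "p + b"] by auto
  then have "card (inv0 ` {..b}) \<le> b" using card_mono[of "{..<b}"] by simp
  moreover have "inj_on inv0 {..b}" using inv0_inj b by (intro inj_onI) simp
  ultimately show False by (simp add: card_image)
qed

lemma clan_flag: "flag_spanned_by (p + q) (clan_vec p q w) = flag_of_mat (p + q) gw"
proof -
  have "clan_vec p q w k = col gw (k - 1)" if k: "k \<in> {1..p + q}" for k
  proof -
    obtain s where s: "k = Suc s" "s < p + q" using k by (cases k) auto
    show ?thesis
    proof (rule eq_vecI)
      show "dim_vec (clan_vec p q w k) = dim_vec (col gw (k - 1))"
        by (simp add: clan_vec_def e_vec_def clan_mat_def)
      fix r assume "r < dim_vec (col gw (k - 1))"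
      then have r: "r < p + q" by (simp add: clan_mat_def)
      consider "s < q" | "q \<le> s" "s < p" | t where "t < q" "s = p + t"
        using s by (metis add_less_cancel_left le_Suc_ex linorder_not_le)
      then show "clan_vec p q w k $ r = col gw (k - 1) $ r"
      proof cases
        case 1
        then show ?thesis
          using s r q inv_Suc[OF 1] inv0_less[OF 1] by (auto simp: clan_vec_def e_vec_def clan_mat_def)
      next
        case 2
        then show ?thesis
          using s r q by (auto simp: clan_vec_def e_vec_def clan_mat_def)
      next
        case 3
        then show ?thesis
          using s r q w_Suc[OF 3(1)] perm0_less[OF 3(1)]
          by (auto simp: clan_vec_def e_vec_def clan_mat_def Suc_diff_le)
      qed
    qed
  qed
  then have img: "clan_vec p q w ` {1..i} = (\<lambda>k. col gw (k - 1)) ` {1..i}" if "i \<in> {0..p + q}" for i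
    using that by (intro image_cong) auto
  show ?thesis
    unfolding flag_spanned_by_def flag_of_mat_def by (rule restrict_ext) (simp only: img)
qed

lemma gw_GL: "gw \<in> GL (p + q)"
  by (rule clan_mat_GL(1)) (fact q inv0_less perm0_less perm0_inv0 inv0_perm0)+

lemma conj_proj_gw:
  assumes "a < p + q" "b < q"
  shows "conj_proj p q gw a b = (if a = b then 1 / 2 else 0) - (if a = p + inv0 b then 1 / 2 else 0)"
  by (rule conj_proj_clan_mat) (fact q inv0_less perm0_less perm0_inv0 inv0_perm0 assms)+

lemma mw_ge: "q \<le> b \<Longrightarrow> b < p + q \<Longrightarrow> mw (Suc b) = p + q"
  by (simp add: hess_vec_of_perm_def)

lemma gw_hess: "gw \<in> hess_mats p q mw"
proof -
  have "conj_proj p q gw a b = 0" if ab: "a < p + q" "b < p + q" "mw (Suc b) \<le> a" for a b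
  proof (cases "b < q")
    case True
    then have "p + inv0 b < a" using mw_le_iff ab by auto
    then show ?thesis using conj_proj_gw[OF ab(1) True] True q by simp
  next
    case False
    then show ?thesis using mw_ge[of b] ab by simp
  qed
  then show ?thesis using gw_GL by (simp add: hess_mats_def)
qed

text \<open>The product of the leading principal minors of the lower left block of \<open>g\<^sup>-\<^sup>1 \<pi> g\<close>, up to powers of
  \<open>det g\<close>, after permuting its rows by \<open>w\<close>.\<close>

definition clan_minors :: "complex mat \<Rightarrow> complex" where
  "clan_minors g = (\<Prod>k\<le>q. det (mat k k (\<lambda>(r, s). adj_proj p q g (p + inv0 r) s)))"

lemma poly_on_clan_minors: "poly_on (p + q) clan_minors"
  unfolding clan_minors_def
  by (intro poly_on_prod poly_on_det_mat poly_on_adj_proj) (use inv0_less in auto)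

text \<open>The rows used are at least \<open>p\<close> and the columns less than \<open>q\<close>,
  so at the base point only the term \<open>- 1 / 2\<close> of \<open>conj_proj\<close> is seen;
  each matrix is a nonzero scalar matrix.\<close>

lemma clan_minors_gw: "clan_minors gw \<noteq> 0"
proof -
  have "det (mat k k (\<lambda>(r, s). adj_proj p q gw (p + inv0 r) s)) \<noteq> 0" if k: "k \<le> q" for k
  proof -
    have "mat k k (\<lambda>(r, s). adj_proj p q gw (p + inv0 r) s) = (- det gw / 2) \<cdot>\<^sub>m 1\<^sub>m k"
    proof (rule eq_matI)
      fix r s assume "r < dim_row ((- det gw / 2) \<cdot>\<^sub>m 1\<^sub>m k)" "s < dim_col ((- det gw / 2) \<cdot>\<^sub>m 1\<^sub>m k)"
      then have rs: "r < k" "s < k" by auto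
      have "inv0 r = inv0 s \<longleftrightarrow> r = s" using inv0_inj rs k by auto
      then show "mat k k (\<lambda>(r, s). adj_proj p q gw (p + inv0 r) s) $$ (r, s)
          = ((- det gw / 2) \<cdot>\<^sub>m 1\<^sub>m k) $$ (r, s)"
        using rs k q inv0_less[of r] adj_proj_eq[OF gw_GL, of "p + inv0 r" s] conj_proj_gw[of "p + inv0 r" s]
        by simp
    qed auto
    then show ?thesis using gw_GL by (simp add: GL_iff_det det_smult)
  qed
  then show ?thesis by (simp add: clan_minors_def)
qed

text \<open>The projection of \<open>\<beta> i\<close> has to end at \<open>p + inv0 i\<close>. A
  later row is \<open>p + inv0 r\<close> for some \<open>r \<noteq> i\<close>: for
  \<open>r < i\<close> it is cleared by elimination, and for \<open>r > i\<close> all its entries in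
  columns \<open>0, ..., i\<close> already vanish on the variety.\<close>

lemma mem_clan_orbit:
  assumes l: "l1 \<noteq> l2" and av: "avoids_231 q w" and g: "g \<in> hess_mats p q mw" and d: "clan_minors g \<noteq> 0"
  shows "flag_of_mat (p + q) g \<in> clan_orbit p q l1 l2 w"
proof -
  let ?n = "p + q"
  have gGL: "g \<in> GL ?n" using g by (simp add: hess_mats_def)
  have minors: "det (mat k k (\<lambda>(r, s). adj_proj p q g (p + inv0 r) s)) \<noteq> 0" if "k \<le> q" for k
    using d that by (auto simp: clan_minors_def)
  have elim: "\<exists>b. b i \<noteq> 0 \<and> (\<forall>s>i. b s = 0) \<and> (\<forall>r<i. (\<Sum>s<q. adj_proj p q g (p + inv0 r) s * b s) = 0) \<and>
      (\<Sum>s<q. adj_proj p q g (p + inv0 i) s * b s) \<noteq> 0" if i: "i < q" for i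
  proof -
    let ?M = "\<lambda>r s. adj_proj p q g (p + inv0 r) s"
    obtain b where b: "b i \<noteq> 0" "\<And>s. i < s \<Longrightarrow> b s = 0"
      "\<And>r. r < i \<Longrightarrow> (\<Sum>s<q. ?M r s * b s) = 0" "(\<Sum>s<q. ?M i s * b s) \<noteq> 0"
      using leading_minors_elimination[of q ?M i, OF minors i] by metis
    show ?thesis by (rule exI[of _ b]) (simp add: b)
  qed
  define \<beta> where "\<beta> i = (SOME b. b i \<noteq> 0 \<and> (\<forall>s>i. b s = 0) \<and>
      (\<forall>r<i. (\<Sum>s<q. adj_proj p q g (p + inv0 r) s * b s) = 0) \<and>
      (\<Sum>s<q. adj_proj p q g (p + inv0 i) s * b s) \<noteq> 0)" for i
  note \<beta>_props = someI_ex[OF elim, folded \<beta>_def]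
  have \<beta>: "\<And>i. i < q \<Longrightarrow> \<beta> i i \<noteq> 0" "\<And>i s. i < q \<Longrightarrow> i < s \<Longrightarrow> \<beta> i s = 0"
    and \<beta>0: "\<And>i r. i < q \<Longrightarrow> r < i \<Longrightarrow> (\<Sum>s<q. adj_proj p q g (p + inv0 r) s * \<beta> i s) = 0"
    and \<beta>1: "\<And>i. i < q \<Longrightarrow> (\<Sum>s<q. adj_proj p q g (p + inv0 i) s * \<beta> i s) \<noteq> 0"
    using \<beta>_props by simp_all
  have scale: "(\<Sum>s<q. adj_proj p q g a s * b s) = det g * (\<Sum>s<q. conj_proj p q g a s * b s)" if "a < ?n" for a b
    using adj_proj_eq[OF gGL that] by (simp add: sum_distrib_left mult.assoc)
  have detg: "det g \<noteq> 0" using gGL by (simp add: GL_iff_det)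
  have "\<exists>k\<in>block_group p q. \<exists>b\<in>Borel ?n. g * b = k * gw"
  proof (rule clan_factorization[of q p inv0 perm0 g \<beta>])
    show "(\<Sum>l<q. conj_proj p q g (p + inv0 i) l * \<beta> i l) \<noteq> 0" if "i < q" for i
      using \<beta>1[OF that] scale[of "p + inv0 i"] inv0_less[OF that] by auto
    show "(\<Sum>l<q. conj_proj p q g a l * \<beta> i l) = 0" if i: "i < q" and a: "a < ?n" "p + inv0 i < a" for i a
    proof -
      define c where "c = a - p"
      have c: "a = p + c" "c < q" "inv0 i < c" using a by (auto simp: c_def)
      define r where "r = perm0 c"
      have r: "r < q" "inv0 r = c" using perm0_less inv0_perm0 c by (auto simp: r_def)
      show ?thesis
      proof (cases "r < i")
        case True
        then show ?thesis using \<beta>0[OF i True] scale[OF a(1)] detg c r by simp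
      next
        case False
        then have ri: "i < r" using r c by (cases "r = i") auto
        \<comment> \<open>Otherwise \<open>w\<close> takes the values \<open>i\<close>,
          \<open>r\<close>, \<open>s\<close> (shifted by one) at increasing positions, with
          \<open>s < i < r\<close>: this is the pattern 231.\<close>
        have "inv0 s < c" if s: "s \<le> i" for s
        proof (rule ccontr)
          assume "\<not> inv0 s < c"
          then have "c < inv0 s" using r ri s inv0_inj[of s r] i by (cases "inv0 s = c") auto
          then have si: "s < i" using s c by (cases "s = i") auto
          have "Suc (inv0 i) \<in> {1..q}" "Suc c \<in> {1..q}" "Suc (inv0 s) \<in> {1..q}"
            using inv0_less[OF i] inv0_less[of s] i c s by simp_all
          moreover have "w (Suc (inv0 i)) = Suc i" "w (Suc c) = Suc r" "w (Suc (inv0 s)) = Suc s"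
            using w_Suc[OF inv0_less, of i] w_Suc[OF c(2)] w_Suc[OF inv0_less, of s]
              perm0_inv0[of i] perm0_inv0[of s] i s by (simp_all add: r_def)
          ultimately have "\<exists>i j k. i \<in> {1..q} \<and> j \<in> {1..q} \<and> k \<in> {1..q} \<and> i < j \<and> j < k \<and> w k < w i \<and> w i < w j"
            using c(3) \<open>c < inv0 s\<close> si ri
            by (intro exI[of _ "Suc (inv0 i)"] exI[of _ "Suc c"] exI[of _ "Suc (inv0 s)"]) simp
          then show False by (rule notE[OF av[unfolded avoids_231_def]])
        qed
        then have mz: "mw (Suc s) \<le> a" if "s \<le> i" for s
          using mw_le_iff[of s a] that i c by auto
        show ?thesis
        proof (rule sum.neutral, rule ballI)
          fix l assume l: "l \<in> {..<q}"
          show "conj_proj p q g a l * \<beta> i l = 0"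
          proof (cases "l \<le> i")
            case True
            then have "conj_proj p q g a l = 0" using g mz[OF True] a l by (simp add: hess_mats_def)
            then show ?thesis by simp
          next
            case False then show ?thesis using \<beta>(2)[OF i] by simp
          qed
        qed
      qed
    qed
  qed (fact q inv0_less perm0_less perm0_inv0 inv0_perm0 gGL \<beta>)+
  then obtain k b where kb: "k \<in> block_group p q" "b \<in> Borel ?n" "g * b = k * gw" by blast
  have "flag_of_mat ?n g = flag_of_mat ?n (k * gw)"
    using flag_of_mat_Borel[OF gGL kb(2)] kb(3) by simp
  also have "\<dots> = flag_act ?n k (flag_spanned_by ?n (clan_vec p q w))"
    unfolding clan_flag using flag_act_flag_of_mat[OF block_group_GL[OF kb(1)] gw_GL] by simp
  finally show ?thesis
    unfolding clan_orbit_def using GL_centralizer_x_mat[OF l, of p q] kb(1) by blast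
qed

lemma clan_orbit_subset:
  assumes l: "l1 \<noteq> l2"
  shows "clan_orbit p q l1 l2 w \<subseteq> Hess (p + q) (x_mat p q l1 l2) mw"
proof
  let ?n = "p + q"
  fix V assume "V \<in> clan_orbit p q l1 l2 w"
  then obtain k where k: "k \<in> block_group p q" and V: "V = flag_act ?n k (flag_of_mat ?n gw)"
    unfolding clan_orbit_def clan_flag GL_centralizer_x_mat[OF l] by blast
  have "k * gw \<in> hess_mats p q mw"
    using gw_hess conj_proj_block_mult[OF k gw_GL] GL_mult[OF block_group_GL[OF k] gw_GL]
    by (simp add: hess_mats_def)
  then show "V \<in> Hess ?n (x_mat p q l1 l2) mw"
    unfolding V flag_act_flag_of_mat[OF block_group_GL[OF k] gw_GL]
    using flag_in_Hess_iff[OF _ hess_mw l] by (simp add: hess_mats_def)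
qed

lemma Hess_eq_closure:
  assumes l: "l1 \<noteq> l2" and av: "avoids_231 q w"
  shows "irreducible_space (subtopology (flag_zariski (p + q)) (Hess (p + q) (x_mat p q l1 l2) mw))"
    "flag_zariski (p + q) closure_of clan_orbit p q l1 l2 w = Hess (p + q) (x_mat p q l1 l2) mw"
proof -
  let ?n = "p + q" and ?H = "Hess (p + q) (x_mat p q l1 l2) mw"
  have pre: "{g \<in> GL ?n. flag_of_mat ?n g \<in> ?H} = hess_mats p q mw"
    by (rule hess_mats_preimage[OF hess_mw l])
  have prime: "prime_set ?n {g \<in> GL ?n. flag_of_mat ?n g \<in> ?H}"
    unfolding pre by (rule prime_set_hess_mats[OF q(2) hess_mw mw_low])
  have gwH: "flag_of_mat ?n gw \<in> ?H" using flag_in_Hess_iff[OF gw_GL hess_mw l] gw_hess by simp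
  show "irreducible_space (subtopology (flag_zariski ?n) ?H)"
    by (rule irreducible_flags_if_prime[OF _ _ prime]) (use gwH in \<open>auto simp: Hess_def\<close>)
  show "flag_zariski ?n closure_of clan_orbit p q l1 l2 w = ?H"
  proof (rule closure_of_flags_dense[OF closedin_Hess[OF hess_mw l] prime clan_orbit_subset[OF l]
        poly_on_clan_minors gw_GL gwH clan_minors_gw])
    fix g assume "g \<in> GL ?n" "flag_of_mat ?n g \<in> ?H" "clan_minors g \<noteq> 0"
    then show "flag_of_mat ?n g \<in> clan_orbit p q l1 l2 w"
      using mem_clan_orbit[OF l av] flag_in_Hess_iff[OF _ hess_mw l] by blast
  qed
qed

end

section \<open>Reducible Hessenberg varieties\<close>

text \<open>For every flag in the variety, \<open>V\<^sub>i\<close> meets \<open>E\<^sub>1\<close> nontrivially or \<open>V\<close> at index \<open>m i\<close> meets \<open>E\<^sub>2\<close> in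
  dimension at least \<open>i\<close>. The functions \<open>\<mu>\<close> and \<open>\<nu>\<close> vanish in the first and in the second case.\<close>

lemma not_prime_hess_mats:
  assumes qp: "q \<le> p" and m: "hessenberg_vector (p + q) m" and i: "i \<in> {1..q}" "m i < p + i"
  shows "\<not> prime_set (p + q) (hess_mats p q m)"
proof
  let ?n = "p + q"
  assume prime: "prime_set ?n (hess_mats p q m)"
  \<comment> \<open>A nonzero vector of \<open>V\<^sub>i\<close> in \<open>E\<^sub>1\<close> gives a
    kernel vector of this minor.\<close>
  define \<mu> where "\<mu> g = det (mat i i (\<lambda>(r, s). g $$ (p + r, s)))" for g :: "complex mat"
  \<comment> \<open>For invertible \<open>g\<close>, the kernel consists of the vectors of
    \<open>E\<^sub>2\<close> whose first \<open>i - 1\<close> coordinates vanish and which lie in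
    the flag at index \<open>p + i - 1\<close>. As \<open>m i \<le> p + i - 1\<close>, it is nonzero
    once the intersection at index \<open>m i\<close> has dimension at least
    \<open>i\<close>.\<close>
  define \<nu> where "\<nu> g = det (mat q q (\<lambda>(r, c). if r < i - 1 then (if r = c then 1 else 0)
    else adj_mat g $$ (p + r, p + c)))" for g :: "complex mat"
  have "poly_on ?n (\<lambda>g. \<mu> g)"
    unfolding \<mu>_def by (rule poly_on_det_mat, rule poly_on_entry) (use i in auto)
  moreover have "poly_on ?n (\<lambda>g. \<nu> g)"
    unfolding \<nu>_def
  proof (rule poly_on_det_mat)
    fix r c assume rc: "r < q" "c < q"
    show "poly_on ?n (\<lambda>g. if r < i - 1 then (if r = c then 1 else 0) else adj_mat g $$ (p + r, p + c))"
      by (cases "r < i - 1") (use rc poly_on_adj[of "p + r" ?n "p + c"] in auto)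
  qed
  moreover have "\<exists>g\<in>hess_mats p q m. \<mu> g \<noteq> 0"
  proof
    \<comment> \<open>The coordinate flag that begins with the first \<open>i\<close> basis vectors
      of \<open>E\<^sub>2\<close>; they trade places with those of \<open>E\<^sub>1\<close>.\<close>
    define \<pi> where "\<pi> s = (if s < i then p + s else if p \<le> s \<and> s < p + i then s - p else s)" for s
    define g where "g = mat ?n ?n (\<lambda>(r, s). if r = \<pi> s then 1 else 0 :: complex)"
    have \<pi>: "\<pi> (\<pi> s) = s" "\<pi> s < ?n" if "s < ?n" for s using that i qp by (auto simp: \<pi>_def)
    have gc: "g \<in> carrier_mat ?n ?n" by (simp add: g_def)
    have gg: "g * g = 1\<^sub>m ?n"
    proof (rule eq_matI)
      fix r s assume "r < dim_row (1\<^sub>m ?n :: complex mat)" "s < dim_col (1\<^sub>m ?n :: complex mat)"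
      then have rs: "r < ?n" "s < ?n" by auto
      have "(g * g) $$ (r, s) = (\<Sum>l<?n. g $$ (r, l) * g $$ (l, s))" by (rule mult_mat_entry[OF gc gc rs])
      also have "\<dots> = (\<Sum>l<?n. if l = \<pi> s then (if r = \<pi> l then 1 else 0) else 0)"
        by (rule sum.cong) (use rs in \<open>auto simp: g_def\<close>)
      finally show "(g * g) $$ (r, s) = 1\<^sub>m ?n $$ (r, s)" using rs \<pi>[of s] by simp
    qed (simp_all add: g_def)
    have gGL: "g \<in> GL ?n" by (rule GL_I[OF gc gc gg])
    have mg: "minv g = g" by (rule minv_unique[OF gc gc gg])
    have "conj_proj p q g a b = 0" if ab: "a < ?n" "b < ?n" "m (Suc b) \<le> a" for a b
    proof -
      \<comment> \<open>For a coordinate flag the conjugated projection is diagonal, and diagonal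
        positions are not constrained; so coordinate flags lie in every such variety.\<close>
      have "Suc b \<le> m (Suc b)" using m ab by (simp add: hessenberg_vector_def)
      then have "a \<noteq> b" using ab by simp
      then have "g $$ (a, p + c) * g $$ (p + c, b) = 0" if "c < q" for c
        using ab that \<pi>(1)[OF ab(2)] by (auto simp: g_def)
      then show ?thesis unfolding conj_proj_def mg by (intro sum.neutral) auto
    qed
    then show "g \<in> hess_mats p q m" using gGL by (simp add: hess_mats_def)
    have "mat i i (\<lambda>(r, s). g $$ (p + r, s)) = 1\<^sub>m i"
      by (rule eq_matI) (use i in \<open>auto simp: g_def \<pi>_def\<close>)
    then show "\<mu> g \<noteq> 0" by (simp add: \<mu>_def)
  qed
  moreover have "\<exists>g\<in>hess_mats p q m. \<nu> g \<noteq> 0"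
  proof
    \<comment> \<open>The standard coordinate flag, which begins with all of
      \<open>E\<^sub>1\<close>.\<close>
    have one: "minv (1\<^sub>m ?n) = 1\<^sub>m ?n" by (rule minv_unique[of _ ?n]) auto
    have "conj_proj p q (1\<^sub>m ?n) a b = 0" if ab: "a < ?n" "b < ?n" "m (Suc b) \<le> a" for a b
    proof -
      have "Suc b \<le> m (Suc b)" using m ab by (simp add: hessenberg_vector_def)
      then show ?thesis unfolding conj_proj_def one by (intro sum.neutral) (use ab in auto)
    qed
    then show "1\<^sub>m ?n \<in> hess_mats p q m" using one_GL by (simp add: hess_mats_def)
    have "mat q q (\<lambda>(r, c). if r < i - 1 then (if r = c then 1 else 0) else adj_mat (1\<^sub>m ?n) $$ (p + r, p + c))
        = (1\<^sub>m q :: complex mat)"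
      by (rule eq_matI) (use adj_mat_eq_minv[OF one_GL] one in auto)
    then show "\<nu> (1\<^sub>m ?n) \<noteq> 0" by (simp add: \<nu>_def)
  qed
  ultimately obtain g where g: "g \<in> hess_mats p q m" "\<mu> g \<noteq> 0" "\<nu> g \<noteq> 0"
    using prime unfolding prime_set_def by blast
  have gGL: "g \<in> GL ?n" using g by (simp add: hess_mats_def)
  have "i - 1 < i" using i by simp
  \<comment> \<open>A nonzero vector of \<open>V\<^sub>i\<close> whose projection \<open>x\<close>
    has its first \<open>i - 1\<close> coordinates zero. Since \<open>x\<close> lies in the flag at
    index \<open>m i\<close>, nonvanishing of \<open>\<nu>\<close> forces \<open>x = 0\<close>, and
    then nonvanishing of \<open>\<mu>\<close> forces \<open>z = 0\<close>.\<close>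
  have "\<exists>z. (\<forall>r<i - 1. (\<Sum>l<i. g $$ (p + r, l) * z l) = 0) \<and> (\<exists>l<i. z l \<noteq> 0)"
    by (rule underdetermined_system[OF \<open>i - 1 < i\<close>, of "\<lambda>r l. g $$ (p + r, l)"],
      rule exI, rule conjI, rule allI, rule impI)
  then obtain z where z: "\<And>r. r < i - 1 \<Longrightarrow> (\<Sum>l<i. g $$ (p + r, l) * z l) = 0" "\<exists>l<i. z l \<noteq> 0"
    by blast
  define x where "x c = (\<Sum>l<i. g $$ (p + c, l) * z l)" for c
  have x0: "x c = 0" if "c < q" for c
  proof (rule nonsingular_imp_no_kernel[OF mat_carrier g(3)[unfolded \<nu>_def] _ that])
    fix r assume r: "r < q"
    let ?Q = "mat q q (\<lambda>(r, c). if r < i - 1 then (if r = c then 1 else 0) else adj_mat g $$ (p + r, p + c))"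
    show "(\<Sum>c<q. ?Q $$ (r, c) * x c) = 0"
    proof (cases "r < i - 1")
      case True
      have "(\<Sum>c<q. ?Q $$ (r, c) * x c) = (\<Sum>c<q. if c = r then x c else 0)"
        by (rule sum.cong) (use r True in auto)
      then show ?thesis using r z(1)[OF True] by (simp add: x_def)
    next
      case False
      have a: "p + r < ?n" "m i \<le> p + r" using r False i by auto
      have "(\<Sum>c<q. ?Q $$ (r, c) * x c) = (\<Sum>c<q. adj_mat g $$ (p + r, p + c) * x c)"
        by (rule sum.cong) (use r False in auto)
      also have "\<dots> = (\<Sum>l<i. adj_proj p q g (p + r) l * z l)"
        unfolding x_def adj_proj_def sum_distrib_left sum_distrib_right
        by (subst sum.swap) (simp add: mult.assoc)
      also have "\<dots> = 0"
      proof (rule sum.neutral, rule ballI)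
        fix l assume l: "l \<in> {..<i}"
        have "m (Suc l) \<le> m i" using m l i by (simp add: hessenberg_vector_def)
        then have "conj_proj p q g (p + r) l = 0" using g(1) a l i by (simp add: hess_mats_def)
        then show "adj_proj p q g (p + r) l * z l = 0" using adj_proj_eq[OF gGL a(1)] by simp
      qed
      finally show ?thesis .
    qed
  qed
  have "z l = 0" if "l < i" for l
  proof (rule nonsingular_imp_no_kernel[OF mat_carrier g(2)[unfolded \<mu>_def] _ that])
    fix r assume r: "r < i"
    have "(\<Sum>l<i. mat i i (\<lambda>(r, s). g $$ (p + r, s)) $$ (r, l) * z l) = x r"
      unfolding x_def by (rule sum.cong) (use r in auto)
    then show "(\<Sum>l<i. mat i i (\<lambda>(r, s). g $$ (p + r, s)) $$ (r, l) * z l) = 0"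
      using x0[of r] r i by simp
  qed
  then show False using z(2) by blast
qed

text \<open>The inverse permutation takes the largest unused value below the prescribed running maximum;
  this is what excludes the pattern 312 in it.\<close>

primrec greedy_image :: "(nat \<Rightarrow> nat) \<Rightarrow> nat \<Rightarrow> nat set" where
  "greedy_image h 0 = {}"
| "greedy_image h (Suc k) = insert (Max ({1..h (Suc k)} - greedy_image h k)) (greedy_image h k)"

definition greedy :: "(nat \<Rightarrow> nat) \<Rightarrow> nat \<Rightarrow> nat" where
  "greedy h k = Max ({1..h k} - greedy_image h (k - 1))"

lemma greedy_image_eq: "greedy_image h k = greedy h ` {1..k}"
proof (induction k)
  case (Suc k)
  have "{1..Suc k} = insert (Suc k) {1..k}" by auto
  then show ?case using Suc by (simp add: greedy_def)
qed simp

lemma exists_perm_with_running_max: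
  assumes h: "\<And>i. i \<in> {1..q} \<Longrightarrow> i \<le> h i \<and> h i \<le> q"
    and mono: "\<And>i j. 1 \<le> i \<Longrightarrow> i \<le> j \<Longrightarrow> j \<le> q \<Longrightarrow> h i \<le> h j"
  shows "\<exists>w. w permutes {1..q} \<and> avoids_231 q w \<and>
    (\<forall>i\<in>{1..q}. Max (Hilbert_Choice.inv w ` {1..i}) = h i)"
proof -
  let ?v = "greedy h"
  have step: "?v k \<in> {1..h k} - ?v ` {1..k - 1}" if k: "k \<in> {1..q}" for k
  proof -
    have "card (?v ` {1..k - 1}) \<le> k - 1" using card_image_le[of "{1..k - 1}" ?v] by simp
    moreover have "k \<le> card {1..h k}" using h[OF k] by simp
    ultimately have "\<not> {1..h k} \<subseteq> ?v ` {1..k - 1}"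
      using k card_mono[of "?v ` {1..k - 1}" "{1..h k}"] by auto
    then have "{1..h k} - greedy_image h (k - 1) \<noteq> {}" by (auto simp: greedy_image_eq)
    then have "?v k \<in> {1..h k} - greedy_image h (k - 1)"
      unfolding greedy_def by (intro Max_in) auto
    then show ?thesis by (simp add: greedy_image_eq)
  qed
  have vmax: "x \<le> ?v k" if "x \<in> {1..h k}" "x \<notin> ?v ` {1..k - 1}" for k x
    unfolding greedy_def using that by (intro Max_ge) (auto simp: greedy_image_eq)
  have inj: "inj_on ?v {1..q}"
  proof (rule linorder_inj_onI)
    fix i j assume ij: "i < j" "i \<in> {1..q}" "j \<in> {1..q}"
    then have "?v i \<in> ?v ` {1..j - 1}" by auto
    then show "?v i \<noteq> ?v j" using step[OF ij(3)] by auto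
  qed auto
  have "?v k \<in> {1..q}" if "k \<in> {1..q}" for k
    using step[OF that] h[OF that] by auto
  then have "?v ` {1..q} = {1..q}" using inj by (intro endo_inj_surj) auto
  then have bij: "bij_betw ?v {1..q} {1..q}" using inj by (simp add: bij_betw_def)
  define V where "V x = (if x \<in> {1..q} then ?v x else x)" for x
  have V: "V permutes {1..q}"
  proof (rule bij_imp_permutes)
    show "bij_betw V {1..q} {1..q}"
      using bij by (subst bij_betw_cong[of _ V ?v]) (auto simp: V_def)
    show "V x = x" if "x \<notin> {1..q}" for x using that unfolding V_def by (rule if_not_P)
  qed
  let ?w = "Hilbert_Choice.inv V"
  have w: "?w permutes {1..q}" by (rule permutes_inv[OF V])
  have inv: "Hilbert_Choice.inv ?w = V" by (rule inv_inv_eq[OF permutes_bij[OF V]])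
  have Vw: "?v (?w x) = x" "?w x \<in> {1..q}" if "x \<in> {1..q}" for x
  proof -
    show *: "?w x \<in> {1..q}" using permutes_in_image[OF w] that by blast
    have "V (?w x) = x" using permutes_inverses(1)[OF V] .
    then show "?v (?w x) = x" using * by (simp add: V_def)
  qed
  show ?thesis
  proof (intro exI[of _ ?w] conjI ballI)
    show "?w permutes {1..q}" by (rule w)
    show "avoids_231 q ?w"
      unfolding avoids_231_def
    proof (intro notI, elim exE conjE)
      fix i j k assume ijk: "i \<in> {1..q}" "j \<in> {1..q}" "k \<in> {1..q}" "i < j" "j < k" "?w k < ?w i" "?w i < ?w j"
      let ?a = "?w k" and ?b = "?w i" and ?c = "?w j"
      have "k \<le> h ?a" using step[OF Vw(2)[OF ijk(3)]] Vw(1)[OF ijk(3)] by simp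
      also have "\<dots> \<le> h ?b" using mono[of ?a ?b] Vw(2)[OF ijk(3)] Vw(2)[OF ijk(1)] ijk by simp
      finally have "j \<in> {1..h ?b}" using ijk by simp
      moreover have "j \<notin> ?v ` {1..?b - 1}"
      proof
        assume "j \<in> ?v ` {1..?b - 1}"
        then obtain y where y: "y \<in> {1..?b - 1}" "?v y = ?v ?c" using Vw(1)[OF ijk(2)] by auto
        then have "y = ?c" using inj Vw(2)[OF ijk(2)] Vw(2)[OF ijk(1)] by (auto dest: inj_onD)
        then show False using y ijk by simp
      qed
      ultimately have "j \<le> ?v ?b" by (rule vmax)
      then show False using Vw(1)[OF ijk(1)] ijk by simp
    qed
    fix i assume i: "i \<in> {1..q}"
    have img: "V ` {1..i} = ?v ` {1..i}" by (rule image_cong) (use i in \<open>auto simp: V_def\<close>)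
    show "Max (Hilbert_Choice.inv ?w ` {1..i}) = h i"
      unfolding inv img
    proof (rule Max_eqI)
      show "y \<le> h i" if y: "y \<in> ?v ` {1..i}" for y
      proof -
        obtain k where k: "k \<in> {1..i}" "y = ?v k" using y by blast
        then have "y \<le> h k" using step[of k] i by simp
        also have "\<dots> \<le> h i" using mono k i by simp
        finally show ?thesis .
      qed
      show "h i \<in> ?v ` {1..i}"
      proof (cases "h i \<in> ?v ` {1..i - 1}")
        case False
        have "h i \<le> ?v i" by (rule vmax) (use h[OF i] i False in auto)
        then have "h i = ?v i" using step[OF i] by simp
        then show ?thesis using i by auto
      qed auto
    qed simp
  qed
qed

lemma Hess_cong:
  assumes "\<And>i. i \<in> {1..n} \<Longrightarrow> m i = m' i"
  shows "Hess n x m = Hess n x m'"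
  using assms by (auto simp: Hess_def)

theorem theorem3p10:
  fixes p q :: nat and lam1 lam2 :: complex
  assumes "1 \<le> q" and "q \<le> p" and "lam1 \<noteq> lam2"
  shows "(\<forall>w. w permutes {1..q} \<and> avoids_231 q w \<longrightarrow>
            irreducible_space (subtopology (flag_zariski (p + q))
              (Hess (p + q) (x_mat p q lam1 lam2) (hess_vec_of_perm p q w))) \<and>
            Hess (p + q) (x_mat p q lam1 lam2) (hess_vec_of_perm p q w)
              = flag_zariski (p + q) closure_of (clan_orbit p q lam1 lam2 w)) \<and>
         (\<forall>m. hessenberg_vector (p + q) m \<and>
              irreducible_space (subtopology (flag_zariski (p + q))
                (Hess (p + q) (x_mat p q lam1 lam2) m)) \<longrightarrow>
            (\<exists>w. w permutes {1..q} \<and> avoids_231 q w \<and>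
              Hess (p + q) (x_mat p q lam1 lam2) m
                = Hess (p + q) (x_mat p q lam1 lam2) (hess_vec_of_perm p q w)))"
proof (intro conjI allI impI; elim conjE)
  fix w assume w: "w permutes {1..q}" "avoids_231 q w"
  show "irreducible_space (subtopology (flag_zariski (p + q))
      (Hess (p + q) (x_mat p q lam1 lam2) (hess_vec_of_perm p q w)))"
    by (rule Hess_eq_closure(1)[OF assms(1,2) w(1) assms(3) w(2)])
  show "Hess (p + q) (x_mat p q lam1 lam2) (hess_vec_of_perm p q w)
      = flag_zariski (p + q) closure_of (clan_orbit p q lam1 lam2 w)"
    by (rule Hess_eq_closure(2)[OF assms(1,2) w(1) assms(3) w(2), symmetric])
next
  let ?n = "p + q"
  fix m assume m: "hessenberg_vector ?n m"
    and irr: "irreducible_space (subtopology (flag_zariski ?n) (Hess ?n (x_mat p q lam1 lam2) m))"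
  have "prime_set ?n {g \<in> GL ?n. flag_of_mat ?n g \<in> Hess ?n (x_mat p q lam1 lam2) m}"
    by (rule prime_if_irreducible_flags[OF _ irr]) (auto simp: Hess_def)
  then have "prime_set ?n (hess_mats p q m)" unfolding hess_mats_preimage[OF m assms(3)] .
  then have low: "p + i \<le> m i" if "i \<in> {1..q}" for i
    using not_prime_hess_mats[OF assms(2) m that] by (meson linorder_not_le)
  have mle: "m i \<le> ?n" if "i \<in> {1..?n}" for i using m that by (simp add: hessenberg_vector_def)
  have mono: "m i \<le> m j" if "1 \<le> i" "i \<le> j" "j \<le> ?n" for i j
    using m that by (simp add: hessenberg_vector_def)
  have "\<exists>w. w permutes {1..q} \<and> avoids_231 q w \<and>
      (\<forall>i\<in>{1..q}. Max (Hilbert_Choice.inv w ` {1..i}) = m i - p)"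
  proof (rule exists_perm_with_running_max[of q "\<lambda>i. m i - p"])
    show "i \<le> m i - p \<and> m i - p \<le> q" if "i \<in> {1..q}" for i
      using low[OF that] mle[of i] that by auto
    show "m i - p \<le> m j - p" if "1 \<le> i" "i \<le> j" "j \<le> q" for i j
      using mono[of i j] that by simp
  qed
  then obtain w where w: "w permutes {1..q}" "avoids_231 q w"
    and h: "\<And>i. i \<in> {1..q} \<Longrightarrow> Max (Hilbert_Choice.inv w ` {1..i}) = m i - p"
    by blast
  have "m i = hess_vec_of_perm p q w i" if i: "i \<in> {1..?n}" for i
  proof (cases "i \<le> q")
    case True
    have "Max ((\<lambda>k. Hilbert_Choice.inv w k + p) ` {1..i}) = Max (Hilbert_Choice.inv w ` {1..i}) + p"
      using Max_add_commute[of "{1..i}" "Hilbert_Choice.inv w" p] i by simp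
    then show ?thesis using True h[of i] low[of i] i by (simp add: hess_vec_of_perm_def)
  next
    case False
    \<comment> \<open>The bound at \<open>q\<close> gives \<open>m q = p + q\<close>, so
      monotonicity settles all later indices.\<close>
    then have "?n \<le> m i" using low[of q] mono[of q i] i assms(1) by auto
    then show ?thesis using False mle[OF i] by (simp add: hess_vec_of_perm_def)
  qed
  then have "Hess ?n (x_mat p q lam1 lam2) m = Hess ?n (x_mat p q lam1 lam2) (hess_vec_of_perm p q w)"
    by (rule Hess_cong)
  then show "\<exists>w. w permutes {1..q} \<and> avoids_231 q w \<and>
      Hess ?n (x_mat p q lam1 lam2) m = Hess ?n (x_mat p q lam1 lam2) (hess_vec_of_perm p q w)"
    using w by blast
qed

end
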